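(* Let $I\subset R=\mathbb{C}[x_1,\dots,x_N]$ be an ideal that is one-dimensional at the origin (i.e. $\dim R_0/IR_0=1$) and in regular position relative to $x_1$, meaning that no one-dimensional irreducible component of $\mathbb{V}(I)$ passing through the origin is contained in the hyperplane $x_1=0$. Let $r=\rho_0(I)$ be the regularity index of the local Hilbert function of $I$ at the origin, let $m=\mu_0(I)$ be the multiplicity of $I$ at the origin, and let $k=\max(r,m-1)$. Then the origin is an embedded component of $I$ (i.e. $\mathfrak m=\langle x_1,\dots,x_N\rangle$ is an associated prime of $R/I$) if and only if $$x_1\cdot E_0^{k}[I,\{x_1\}]\subsetneq E_0^{k-1}[I,\{x_1\}].$$ (That is, the algorithm which computes $r=\rho_0(I)$, $m=\mu_0(I)$ and $k=\max(r,m-1)$ and returns the truth value of the strict inclusion $x_1\cdot E_0^{k}[I,\{x_1\}]\subsetneq E_0^{k-1}[I,\{x_1\}]$ correctly decides whether the origin is an embedded component of $I$.)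
   Context: Let $\mathfrak m=\langle x_1,\dots,x_N\rangle$ and $R_0=R_{\mathfrak m}$. For $\alpha\in(\mathbb{Z}_{\ge 0})^N$ let $\partial^\alpha$ be the functional $\partial^\alpha(g)=\left(\frac{1}{\alpha!}\frac{\partial^{|\alpha|}g}{\partial x^\alpha}\right)(0)$ on $R$ (or $R_0$), with $\alpha!=\alpha_1!\cdots\alpha_N!$, $|\alpha|=\sum_i\alpha_i$. Let $D_0=\operatorname{span}_{\mathbb{C}}\{\partial^\alpha\}$ (finite linear combinations) and $D_0[I]=\{q\in D_0 : q(f)=0\text{ for all } f\in I\}$. The action of $x_1$ on $D_0$ is $(x_1\cdot q)(f)=q(x_1f)$, i.e. $x_1\cdot\partial^\alpha=\partial^{\alpha-e_1}$ (zero if $\alpha_1=0$), and $x_1\cdot S=\{x_1\cdot q:q\in S\}$. The eliminating dual space $E_0^d[I,\{x_1\}]$ is the set of $q\in D_0[I]$ all of whose terms $\partial^\alpha$ (with nonzero coefficient) satisfy $\alpha_1\le d$; in particular $E_0^{-1}[I,\{x_1\}]=0$. The local Hilbert function is $H_I(k)=\dim_{\mathbb{C}}\left(R_0/(IR_0+\mathfrak m^{k+1}R_0)\right)-\dim_{\mathbb{C}}\left(R_0/(IR_0+\mathfrak m^{k}R_0)\right)$ for $k\ge0$ (with $\mathfrak m^0R_0=R_0$). It agrees for all large $k$ with a polynomial $\mathrm{HP}_I(k)$, and $\rho_0(I)=\min\{m\ge0 : H_I(k)=\mathrm{HP}_I(k)\text{ for all }k\ge m\}$. When $\dim R_0/IR_0=1$,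 $\mathrm{HP}_I$ is a constant, and this constant is the multiplicity $\mu_0(I)$. *)

theory Defs
  imports
    "HOL-Library.Poly_Mapping"
    "HOL-Library.Extended_Nat"
    "HOL-Algebra.Ideal_Product"
    "HOL-Algebra.Embedded_Algebras"
    "HOL-Algebra.Algebraic_Closure_Type"
begin

section \<open>The polynomial ring and its localization at the origin\<close>

text \<open>The finite type \<^typ>\<open>'n\<close> indexes the variables. Its linear order is used only for the library
  instance that makes the polynomial ring an integral domain, and to fix an order in which the
  partial derivatives are taken.\<close>

type_synonym 'n mpoly = "('n \<Rightarrow>\<^sub>0 nat) \<Rightarrow>\<^sub>0 complex"

definition mpoly_var :: "'n \<Rightarrow> 'n mpoly" where
  "mpoly_var j = Poly_Mapping.single (Poly_Mapping.single j 1) 1"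

definition mpoly_const :: "complex \<Rightarrow> 'n mpoly" where
  "mpoly_const a = Poly_Mapping.single 0 a"

definition mpoly_eval :: "('n::finite \<Rightarrow> complex) \<Rightarrow> 'n mpoly \<Rightarrow> complex" where
  "mpoly_eval a f = (\<Sum>\<alpha>\<in>Poly_Mapping.keys f.
     Poly_Mapping.lookup f \<alpha> * (\<Prod>j\<in>UNIV. a j ^ Poly_Mapping.lookup \<alpha> j))"

definition origin :: "'n \<Rightarrow> complex" where
  "origin = (\<lambda>_. 0)"

definition mpoly_ring :: "'n mpoly ring" where
  "mpoly_ring = ring_of_type_algebra"

definition max_ideal :: "'n mpoly set" where
  "max_ideal = genideal mpoly_ring (range mpoly_var)"

definition local_ring :: "'n::{finite,linorder} mpoly fract ring" where
  "local_ring = ring_of_type_algebra\<lparr>carrier := {Fract f g | f g. mpoly_eval origin g \<noteq> 0}\<rparr>"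

definition extend_ideal :: "'n::{finite,linorder} mpoly set \<Rightarrow> 'n mpoly fract set" where
  "extend_ideal J = genideal local_ring ((\<lambda>f. Fract f 1) ` J)"


section \<open>Krull dimension, components, associated primes\<close>

text \<open>The supremum of an empty set of lengths is \<open>0\<close> here, so an empty family (the spectrum of the
  zero ring) has dimension \<open>0\<close> and not \<open>-1\<close> or \<open>-\<infinity>\<close>.\<close>

definition chain_dim :: "'a set set \<Rightarrow> enat" where
  "chain_dim F = Sup {enat n | n. \<exists>c :: nat \<Rightarrow> 'a set.
     (\<forall>i\<le>n. c i \<in> F) \<and> (\<forall>i<n. c i \<subset> c (Suc i))}"

definition krull_dim :: "('a, 'b) ring_scheme \<Rightarrow> enat" where
  "krull_dim R = chain_dim {P. primeideal P R}"

definition zero_set :: "'n::finite mpoly set \<Rightarrow> ('n \<Rightarrow> complex) set" where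
  "zero_set J = {a. \<forall>f\<in>J. mpoly_eval a f = 0}"

definition algebraic_set :: "('n::finite \<Rightarrow> complex) set \<Rightarrow> bool" where
  "algebraic_set Z \<longleftrightarrow> (\<exists>J. Z = zero_set J)"

definition irreducible_set :: "('n::finite \<Rightarrow> complex) set \<Rightarrow> bool" where
  "irreducible_set Z \<longleftrightarrow> algebraic_set Z \<and> Z \<noteq> {} \<and>
     (\<forall>A B. algebraic_set A \<and> algebraic_set B \<and> Z = A \<union> B \<longrightarrow> Z = A \<or> Z = B)"

definition irreducible_component ::
    "('n::finite \<Rightarrow> complex) set \<Rightarrow> ('n \<Rightarrow> complex) set \<Rightarrow> bool" where
  "irreducible_component C Z \<longleftrightarrow> irreducible_set C \<and> C \<subseteq> Z \<and>
     (\<forall>C'. irreducible_set C' \<and> C \<subseteq> C' \<and> C' \<subseteq> Z \<longrightarrow> C' = C)"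

definition variety_dim :: "('n::finite \<Rightarrow> complex) set \<Rightarrow> enat" where
  "variety_dim Z = chain_dim {C. irreducible_set C \<and> C \<subseteq> Z}"

definition one_dimensional_at_origin :: "'n::{finite,linorder} mpoly set \<Rightarrow> bool" where
  "one_dimensional_at_origin I \<longleftrightarrow> krull_dim (local_ring Quot extend_ideal I) = 1"

definition regular_position :: "'n::finite mpoly set \<Rightarrow> 'n \<Rightarrow> bool" where
  "regular_position I v \<longleftrightarrow>
     \<not> (\<exists>C. irreducible_component C (zero_set I) \<and> variety_dim C = 1 \<and>
            origin \<in> C \<and> C \<subseteq> {a. a v = 0})"

text \<open>The second conjunct says that \<open>P\<close> is the annihilator in \<open>R\<close> of an element of the module
  \<open>R/I\<close>, on which \<open>g \<in> R\<close> acts as multiplication by its residue class.\<close>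

definition associated_prime :: "('a, 'b) ring_scheme \<Rightarrow> 'a set \<Rightarrow> 'a set \<Rightarrow> bool" where
  "associated_prime R P I \<longleftrightarrow> primeideal P R \<and>
     (\<exists>a \<in> carrier (R Quot I).
        P = {g \<in> carrier R. (I +>\<^bsub>R\<^esub> g) \<otimes>\<^bsub>R Quot I\<^esub> a = \<zero>\<^bsub>R Quot I\<^esub>})"


section \<open>The local Hilbert function\<close>

text \<open>The dimension over \<open>\<complex>\<close> of the quotient \<open>\<complex>\<close>-algebra; \<open>\<complex>\<close> is represented inside that
  quotient by the residue classes of the constants.\<close>

definition quot_dim :: "'n::{finite,linorder} mpoly fract set \<Rightarrow> nat" where
  "quot_dim J = ring.dim (local_ring Quot J)
     (range (\<lambda>a. J +>\<^bsub>local_ring\<^esub> Fract (mpoly_const a) 1)) (carrier (local_ring Quot J))"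

definition truncated_dim :: "'n::{finite,linorder} mpoly set \<Rightarrow> nat \<Rightarrow> nat" where
  "truncated_dim I k = quot_dim
     (extend_ideal I <+>\<^bsub>local_ring\<^esub> extend_ideal (max_ideal [^]\<^bsub>ideals_set mpoly_ring\<^esub> k))"

definition hilbert_fun :: "'n::{finite,linorder} mpoly set \<Rightarrow> nat \<Rightarrow> int" where
  "hilbert_fun I k = int (truncated_dim I (Suc k)) - int (truncated_dim I k)"

definition hilbert_poly :: "'n::{finite,linorder} mpoly set \<Rightarrow> rat poly" where
  "hilbert_poly I = (THE p. \<exists>k\<^sub>0. \<forall>k\<ge>k\<^sub>0. of_int (hilbert_fun I k) = poly p (of_nat k))"

definition regularity_index :: "'n::{finite,linorder} mpoly set \<Rightarrow> nat" where
  "regularity_index I =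
     (LEAST m. \<forall>k\<ge>m. of_int (hilbert_fun I k) = poly (hilbert_poly I) (of_nat k))"

text \<open>Only meaningful for ideals that are one-dimensional at the origin.\<close>

definition multiplicity_at_origin :: "'n::{finite,linorder} mpoly set \<Rightarrow> nat" where
  "multiplicity_at_origin I = (THE m. hilbert_poly I = [:of_nat m:])"


section \<open>Dual spaces\<close>

definition partial_deriv :: "'n \<Rightarrow> 'n mpoly \<Rightarrow> 'n mpoly" where
  "partial_deriv j f = (\<Sum>\<alpha>\<in>Poly_Mapping.keys f.
     Poly_Mapping.single (\<alpha> - Poly_Mapping.single j 1)
       (of_nat (Poly_Mapping.lookup \<alpha> j) * Poly_Mapping.lookup f \<alpha>))"

definition iterated_deriv ::
    "('n::{finite,linorder} \<Rightarrow>\<^sub>0 nat) \<Rightarrow> 'n mpoly \<Rightarrow> 'n mpoly" where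
  "iterated_deriv \<alpha> f =
     foldr (\<lambda>j. partial_deriv j ^^ Poly_Mapping.lookup \<alpha> j) (sorted_list_of_set UNIV) f"

definition diff_functional ::
    "('n::{finite,linorder} \<Rightarrow>\<^sub>0 nat) \<Rightarrow> 'n mpoly \<Rightarrow> complex" where
  "diff_functional \<alpha> g =
     mpoly_eval origin (iterated_deriv \<alpha> g) / (\<Prod>j\<in>UNIV. fact (Poly_Mapping.lookup \<alpha> j))"

text \<open>The finite linear combination of the \<^const>\<open>diff_functional\<close>s in which \<open>diff_functional \<alpha>\<close>
  has coefficient \<open>lookup c \<alpha>\<close>.\<close>

definition functional ::
    "(('n::{finite,linorder} \<Rightarrow>\<^sub>0 nat) \<Rightarrow>\<^sub>0 complex) \<Rightarrow> 'n mpoly \<Rightarrow> complex" where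
  "functional c = (\<lambda>f. \<Sum>\<alpha>\<in>Poly_Mapping.keys c. Poly_Mapping.lookup c \<alpha> * diff_functional \<alpha> f)"

definition D0 :: "('n::{finite,linorder} mpoly \<Rightarrow> complex) set" where
  "D0 = range functional"

definition dual_space :: "'n::{finite,linorder} mpoly set \<Rightarrow> ('n mpoly \<Rightarrow> complex) set" where
  "dual_space I = {q \<in> D0. \<forall>f\<in>I. q f = 0}"

definition var_action :: "'n \<Rightarrow> ('n mpoly \<Rightarrow> complex) \<Rightarrow> ('n mpoly \<Rightarrow> complex)" where
  "var_action v q = (\<lambda>f. q (mpoly_var v * f))"

text \<open>The degree bound is an integer so that the bound \<open>-1\<close>, which gives the zero space, is
  included.\<close>

definition elim_dual_space ::
    "int \<Rightarrow> 'n::{finite,linorder} mpoly set \<Rightarrow> 'n \<Rightarrow> ('n mpoly \<Rightarrow> complex) set" where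
  "elim_dual_space d I v = {q \<in> dual_space I.
     \<exists>c. q = functional c \<and> (\<forall>\<alpha>\<in>Poly_Mapping.keys c. int (Poly_Mapping.lookup \<alpha> v) \<le> d)}"

end

theory Submission
  imports Defs "HOL-Library.Set_Algebras" "HOL-Analysis.Continuum_Not_Denumerable"
    "HOL-Computational_Algebra.Fundamental_Theorem_Algebra"
begin

text \<open>Write \<open>A\<close> for the local ring \<open>R\<^sub>0/IR\<^sub>0\<close> and \<open>x = x\<^sub>1\<close>. By regular position, \<open>x\<close> is a parameter of the
  one-dimensional ring \<open>A\<close>, so the submodule \<open>J\<close> of elements killed by a power of \<open>x\<close> has finite
  length, and the origin is embedded iff \<open>J\<close> is nonzero, that is, iff \<open>A\<close> has a nonzero socle.

  An element \<open>q\<close> of \<open>E\<^sup>k\<^sup>-\<^sup>1\<close> is a functional on \<open>A/x\<^sup>kA\<close>, and it is \<open>x \<cdot> q'\<close> for some \<open>q'\<close> in \<open>E\<^sup>k\<close> iff it vanishes on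
  the elements \<open>f\<close> with \<open>x f \<in> x\<^sup>k\<^sup>+\<^sup>1 A\<close>. If \<open>J = 0\<close> these lie in \<open>x\<^sup>kA\<close> and equality holds. If \<open>J\<close> is nonzero,
  a socle element that is not in \<open>x\<^sup>kA\<close> is detected by some \<open>q\<close> which is not of the form \<open>x \<cdot> q'\<close>; a socle
  element in \<open>x\<^sup>kA\<close> would lie in \<open>J \<inter> \<mm>\<^sup>k\<close>, so what is needed is \<open>J \<inter> \<mm>\<^sup>k = 0\<close>.

  That holds for \<open>k \<ge> max (r, m - 1)\<close>. The ring \<open>A/J\<close> is Cohen-Macaulay of multiplicity \<open>m\<close>, so its
  Hilbert function \<open>h\<close> is bounded by \<open>m\<close>; by Eakin-Sathaye, \<open>h(i) \<le> i\<close> implies that \<open>h\<close> does not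
  increase from \<open>i\<close> on. As \<open>h\<close> is eventually \<open>m\<close>, this excludes \<open>h(i) < m\<close> for \<open>i \<ge> m - 1\<close>. From \<open>k\<close> on the
  Hilbert functions of \<open>A\<close> and \<open>A/J\<close> therefore agree, and the differences of their partial sums are
  the dimensions of the images of \<open>J\<close> in \<open>A/\<mm>\<^sup>i\<close>; these are then constant for \<open>i \<ge> k\<close>, and equal to the
  dimension of \<open>J\<close> for large \<open>i\<close>.\<close>

section \<open>Polynomials and their homomorphisms\<close>

text \<open>Regular position speaks of one-dimensional components of the affine zero set, whereas
  one-dimensionality is a property of the local ring at a single point. The bridge is that a prime
  with no further prime between it and the maximal ideal of the origin has a zero set of dimension
  one as a whole, not only near the origin. This is what the Nullstellensatz and Noether
  normalization are for. If the local ring modulo x did not have finite length, a prime over I + (x)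
  would then be a component of the forbidden kind inside the hyperplane x = 0.

  Ideals of the local ring are represented by their contractions \<open>loc Q\<close> to the
  polynomial ring. This costs little, because an element that does not vanish at the origin is
  invertible modulo every power of the maximal ideal, so that all finite lengths are complex
  dimensions of quotients of subspaces of the polynomial ring.\<close>

lemma mpoly_eq_sum_single:
  "(f :: 'n mpoly) = (\<Sum>\<alpha>\<in>Poly_Mapping.keys f. Poly_Mapping.single \<alpha> (Poly_Mapping.lookup f \<alpha>))"
  by (rule poly_mapping_eqI)
    (simp add: lookup_sum lookup_single sum.If_cases not_in_keys_iff_lookup_eq_zero when_def)

lemma mpoly_induct [case_names zero single add]:
  fixes f :: "'n mpoly"
  assumes "P 0" "\<And>\<alpha> c. P (Poly_Mapping.single \<alpha> c)" "\<And>f g. P f \<Longrightarrow> P g \<Longrightarrow> P (f + g)"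
  shows "P f"
proof -
  have "P (\<Sum>\<alpha>\<in>A. Poly_Mapping.single \<alpha> (Poly_Mapping.lookup f \<alpha>))" if "finite A" for A
    using that by induction (auto intro: assms)
  then show ?thesis by (subst mpoly_eq_sum_single) simp
qed

definition monomial_eval :: "('n::finite \<Rightarrow> 'b::comm_ring_1) \<Rightarrow> ('n \<Rightarrow>\<^sub>0 nat) \<Rightarrow> 'b" where
  "monomial_eval y \<alpha> = (\<Prod>j\<in>UNIV. y j ^ Poly_Mapping.lookup \<alpha> j)"

lemma monomial_eval_0 [simp]: "monomial_eval y 0 = 1"
  by (simp add: monomial_eval_def)

lemma monomial_eval_add: "monomial_eval y (\<alpha> + \<beta>) = monomial_eval y \<alpha> * monomial_eval y \<beta>"
  by (simp add: monomial_eval_def lookup_add power_add prod.distrib)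

lemma monomial_eval_single [simp]: "monomial_eval y (Poly_Mapping.single v n) = y v ^ n"
proof -
  have "monomial_eval y (Poly_Mapping.single v n) = (\<Prod>j\<in>UNIV. if v = j then y j ^ n else 1)"
    unfolding monomial_eval_def by (rule prod.cong) (auto simp: lookup_single when_def)
  then show ?thesis by simp
qed

text \<open>One substitution homomorphism serves twice: with the identity on coefficients it is
  evaluation at a point, with \<open>mpoly_const\<close> it substitutes polynomials for the
  variables.\<close>

locale coeff_hom =
  fixes \<phi> :: "complex \<Rightarrow> 'b::comm_ring_1"
  assumes hom_add: "\<phi> (a + b) = \<phi> a + \<phi> b"
    and hom_mult: "\<phi> (a * b) = \<phi> a * \<phi> b"
    and hom_1: "\<phi> 1 = 1"
begin

lemma hom_0: "\<phi> 0 = 0"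
  using hom_add[of 0 0] by simp

definition gsubst :: "('n::finite \<Rightarrow> 'b) \<Rightarrow> 'n mpoly \<Rightarrow> 'b" where
  "gsubst y f = (\<Sum>\<alpha>\<in>Poly_Mapping.keys f. \<phi> (Poly_Mapping.lookup f \<alpha>) * monomial_eval y \<alpha>)"

lemma gsubst_superset:
  assumes "finite A" "Poly_Mapping.keys f \<subseteq> A"
  shows "gsubst y f = (\<Sum>\<alpha>\<in>A. \<phi> (Poly_Mapping.lookup f \<alpha>) * monomial_eval y \<alpha>)"
  unfolding gsubst_def
  by (rule sum.mono_neutral_left) (use assms in \<open>auto simp: hom_0 not_in_keys_iff_lookup_eq_zero\<close>)

lemma gsubst_0 [simp]: "gsubst y 0 = 0"
  by (simp add: gsubst_def)

lemma gsubst_single [simp]: "gsubst y (Poly_Mapping.single \<alpha> c) = \<phi> c * monomial_eval y \<alpha>"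
  by (subst gsubst_superset[of "{\<alpha>}"]) auto

lemma gsubst_add: "gsubst y (f + g) = gsubst y f + gsubst y g"
proof -
  let ?A = "Poly_Mapping.keys f \<union> Poly_Mapping.keys g"
  have "gsubst y h = (\<Sum>\<alpha>\<in>?A. \<phi> (Poly_Mapping.lookup h \<alpha>) * monomial_eval y \<alpha>)"
    if "Poly_Mapping.keys h \<subseteq> ?A" for h
    by (rule gsubst_superset) (use that in auto)
  from this[of f] this[of g] this[of "f + g"] keys_add[of f g] show ?thesis
    by (auto simp: lookup_add hom_add algebra_simps sum.distrib)
qed

lemma gsubst_mult: "gsubst y (f * g) = gsubst y f * gsubst y g"
proof (induction f rule: mpoly_induct)
  case (single \<alpha> c)
  show ?case
    by (induction g rule: mpoly_induct)
      (auto simp: mult_single hom_mult monomial_eval_add gsubst_add algebra_simps)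
qed (auto simp: gsubst_add algebra_simps)

lemma gsubst_1 [simp]: "gsubst y 1 = 1"
  using gsubst_single[of y 0 1] by (simp add: hom_1 del: gsubst_single)

lemma gsubst_const [simp]: "gsubst y (mpoly_const c) = \<phi> c"
  by (simp add: mpoly_const_def)

lemma gsubst_var [simp]: "gsubst y (mpoly_var v) = y v"
  by (simp add: mpoly_var_def hom_1)

lemma gsubst_uminus: "gsubst y (- f) = - gsubst y f"
  using gsubst_add[of y f "- f"] by (simp add: add_eq_0_iff)

lemma gsubst_diff: "gsubst y (f - g) = gsubst y f - gsubst y g"
  using gsubst_add[of y "f - g" g] by simp

lemma gsubst_power: "gsubst y (f ^ n) = gsubst y f ^ n"
  by (induction n) (auto simp: gsubst_mult)

lemma gsubst_sum: "gsubst y (\<Sum>i\<in>A. f i) = (\<Sum>i\<in>A. gsubst y (f i))"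
  by (induction A rule: infinite_finite_induct) (auto simp: gsubst_add)

lemma gsubst_prod: "gsubst y (\<Prod>i\<in>A. f i) = (\<Prod>i\<in>A. gsubst y (f i))"
  by (induction A rule: infinite_finite_induct) (auto simp: gsubst_mult)

end

lemma const_add: "mpoly_const (a + b) = mpoly_const a + mpoly_const b"
  by (simp add: mpoly_const_def single_add)

lemma const_mult: "mpoly_const (a * b) = mpoly_const a * mpoly_const b"
  by (simp add: mpoly_const_def mult_single)

lemma const_0 [simp]: "mpoly_const 0 = 0"
  by (simp add: mpoly_const_def)

lemma const_1 [simp]: "mpoly_const 1 = 1"
  by (simp add: mpoly_const_def)

lemma const_uminus: "mpoly_const (- a) = - mpoly_const a"
  by (simp add: mpoly_const_def single_uminus)

lemma const_power: "mpoly_const (a ^ n) = mpoly_const a ^ n"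
  by (induction n) (auto simp: const_mult)

lemma const_sum: "mpoly_const (\<Sum>i\<in>A. f i) = (\<Sum>i\<in>A. mpoly_const (f i))"
  by (induction A rule: infinite_finite_induct) (auto simp: const_add)

lemma const_inverse: "c \<noteq> 0 \<Longrightarrow> mpoly_const (inverse c) * mpoly_const c = 1"
  by (simp flip: const_mult)

lemma lookup_const: "Poly_Mapping.lookup (mpoly_const c) \<alpha> = (if \<alpha> = 0 then c else 0)"
  by (auto simp: mpoly_const_def lookup_single when_def)

lemma lookup_const_mult:
  "Poly_Mapping.lookup (mpoly_const c * f) \<alpha> = c * Poly_Mapping.lookup f \<alpha>"
  by (simp add: mpoly_const_def flip: mult_map_scale_conv_mult) (simp add: Poly_Mapping.map.rep_eq when_def)

lemma const_eq_0_iff [simp]: "mpoly_const c = 0 \<longleftrightarrow> c = 0"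
  by (metis lookup_const lookup_zero const_0)

interpretation ev: coeff_hom "\<lambda>c. c"
  by unfold_locales auto

interpretation sb: coeff_hom "mpoly_const :: complex \<Rightarrow> 'n::finite mpoly"
  by unfold_locales (auto simp: const_add const_mult)

abbreviation subst :: "('m::finite \<Rightarrow> 'n::finite mpoly) \<Rightarrow> 'm mpoly \<Rightarrow> 'n mpoly" where
  "subst \<equiv> sb.gsubst"

lemma mpoly_eval_conv: "mpoly_eval = ev.gsubst"
  by (intro ext) (simp add: mpoly_eval_def ev.gsubst_def monomial_eval_def)

lemmas eval_simps [simp] = ev.gsubst_0[folded mpoly_eval_conv] ev.gsubst_1[folded mpoly_eval_conv]
  ev.gsubst_const[folded mpoly_eval_conv] ev.gsubst_var[folded mpoly_eval_conv]
  ev.gsubst_add[folded mpoly_eval_conv] ev.gsubst_mult[folded mpoly_eval_conv]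
  ev.gsubst_uminus[folded mpoly_eval_conv] ev.gsubst_diff[folded mpoly_eval_conv]
  ev.gsubst_power[folded mpoly_eval_conv] ev.gsubst_sum[folded mpoly_eval_conv]
  ev.gsubst_prod[folded mpoly_eval_conv] ev.gsubst_single[folded mpoly_eval_conv]

lemma monomial_eval_origin: "monomial_eval origin \<alpha> = (if \<alpha> = 0 then 1 else 0)"
proof (cases "\<alpha> = 0")
  case False
  then obtain j where "Poly_Mapping.lookup \<alpha> j \<noteq> 0"
    by (metis poly_mapping_eqI lookup_zero)
  then show ?thesis
    using False by (auto simp: monomial_eval_def origin_def intro!: prod_zero bexI[of _ j])
qed simp

lemma eval_origin: "mpoly_eval origin f = Poly_Mapping.lookup f 0"
  by (induction f rule: mpoly_induct)
    (auto simp: lookup_single lookup_add monomial_eval_origin when_def)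

lemma single_eq_const_mult:
  "Poly_Mapping.single \<alpha> c = mpoly_const c * (Poly_Mapping.single \<alpha> 1 :: 'n mpoly)"
  by (simp add: mpoly_const_def mult_single)

lemma single_1_eq_prod: "(Poly_Mapping.single \<alpha> 1 :: 'n::finite mpoly) = monomial_eval mpoly_var \<alpha>"
proof -
  have p: "mpoly_var j ^ n = (Poly_Mapping.single (Poly_Mapping.single j n) 1 :: 'n mpoly)" for j n
    by (induction n) (auto simp: mpoly_var_def mult_single single_add[symmetric])
  have "(\<Prod>j\<in>A. Poly_Mapping.single (Poly_Mapping.single j (Poly_Mapping.lookup \<alpha> j)) 1) =
     (Poly_Mapping.single (\<Sum>j\<in>A. Poly_Mapping.single j (Poly_Mapping.lookup \<alpha> j)) 1 :: 'n mpoly)"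
    if "finite A" for A
    using that by induction (auto simp: mult_single)
  moreover have "(\<Sum>j\<in>UNIV. Poly_Mapping.single j (Poly_Mapping.lookup \<alpha> j)) = \<alpha>"
    by (rule poly_mapping_eqI) (simp add: lookup_sum lookup_single when_def)
  ultimately show ?thesis by (simp add: monomial_eval_def p)
qed

lemma subst_var [simp]: "subst mpoly_var f = f"
proof (induction f rule: mpoly_induct)
  case (single \<alpha> c)
  have "subst mpoly_var (Poly_Mapping.single \<alpha> c) = mpoly_const c * monomial_eval mpoly_var \<alpha>"
    by simp
  also have "\<dots> = Poly_Mapping.single \<alpha> c"
    unfolding single_1_eq_prod[symmetric] by (rule single_eq_const_mult[symmetric])
  finally show ?case .
qed (auto simp: sb.gsubst_add)

text \<open>With a commutative ring as a module over itself, \<open>Id.subspace\<close> means ideal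
  and \<open>Id.span\<close> the ideal generated by a set. The complex vector space structure
  \<open>Vs\<close> on the same type measures lengths.\<close>

interpretation Id: Modules.module "(*) :: 'a::comm_ring_1 \<Rightarrow> 'a \<Rightarrow> 'a"
  by unfold_locales (auto simp: algebra_simps)

text \<open>As a simplification rule it would rewrite \<open>a * (b * c)\<close> to \<open>a * b * c\<close>.\<close>

declare Id.scale_scale [simp del]

definition cscale :: "complex \<Rightarrow> 'n mpoly \<Rightarrow> 'n mpoly" where
  "cscale c f = mpoly_const c * f"

lemma vector_space_cscale: "vector_space (cscale :: complex \<Rightarrow> 'n mpoly \<Rightarrow> 'n mpoly)"
proof (rule vector_space.intro)
  show "cscale a (x + y) = cscale a x + cscale a y" for a and x y :: "'n mpoly"
    unfolding cscale_def by (rule distrib_left)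
  show "cscale (a + b) x = cscale a x + cscale b x" for a b and x :: "'n mpoly"
    unfolding cscale_def const_add by (rule distrib_right)
  show "cscale a (cscale b x) = cscale (a * b) x" for a b and x :: "'n mpoly"
    unfolding cscale_def const_mult by (rule mult.assoc[symmetric])
  show "cscale 1 x = x" for x :: "'n mpoly"
    by (simp add: cscale_def)
qed

interpretation Vs: vector_space "cscale :: complex \<Rightarrow> 'n mpoly \<Rightarrow> 'n mpoly"
  by (rule vector_space_cscale)

lemma ideal_imp_subspace: "Id.subspace Q \<Longrightarrow> Vs.subspace Q"
  unfolding Vs.subspace_def Id.subspace_def cscale_def by blast

abbreviation ideal_of :: "'n mpoly set \<Rightarrow> bool" where
  "ideal_of \<equiv> Id.subspace"

section \<open>Powers of the maximal ideal\<close>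

definition mdeg :: "('n::finite \<Rightarrow>\<^sub>0 nat) \<Rightarrow> nat" where
  "mdeg \<alpha> = (\<Sum>j\<in>UNIV. Poly_Mapping.lookup \<alpha> j)"

lemma mdeg_0 [simp]: "mdeg 0 = 0"
  by (simp add: mdeg_def)

lemma mdeg_add: "mdeg (\<alpha> + \<beta>) = mdeg \<alpha> + mdeg \<beta>"
  by (simp add: mdeg_def lookup_add sum.distrib)

lemma mdeg_single [simp]: "mdeg (Poly_Mapping.single v n) = n"
  by (simp add: mdeg_def lookup_single when_def)

lemma mdeg_eq_0 [simp]: "mdeg \<alpha> = 0 \<longleftrightarrow> \<alpha> = 0"
  by (auto simp: mdeg_def intro!: poly_mapping_eqI)

lemma finite_mdeg_less: "finite {\<alpha> :: 'n::finite \<Rightarrow>\<^sub>0 nat. mdeg \<alpha> < k}"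
proof (rule inj_on_finite)
  show "inj_on Poly_Mapping.lookup {\<alpha> :: 'n \<Rightarrow>\<^sub>0 nat. mdeg \<alpha> < k}"
    by (simp add: inj_on_def)
  have "Poly_Mapping.lookup \<alpha> j \<le> mdeg \<alpha>" for j and \<alpha> :: "'n \<Rightarrow>\<^sub>0 nat"
    unfolding mdeg_def by (rule member_le_sum) auto
  then show "Poly_Mapping.lookup ` {\<alpha> :: 'n \<Rightarrow>\<^sub>0 nat. mdeg \<alpha> < k} \<subseteq> (UNIV :: 'n set) \<rightarrow> {..<k}"
    by (auto intro: le_less_trans)
  show "finite ((UNIV :: 'n set) \<rightarrow> {..<k})"
    using finite_PiE[of "UNIV :: 'n set" "\<lambda>_. {..<k}"] by (simp add: PiE_def)
qed

text \<open>The k-th power of the maximal ideal at the origin, encoded as a condition on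
  coefficients; \<open>max_ideal_power\<close> identifies it with the power in the monoid of
  ideals.\<close>

definition mpow :: "nat \<Rightarrow> 'n::finite mpoly set" where
  "mpow k = {f. \<forall>\<alpha>\<in>Poly_Mapping.keys f. k \<le> mdeg \<alpha>}"

lemma mpow_iff: "f \<in> mpow k \<longleftrightarrow> (\<forall>\<alpha>. mdeg \<alpha> < k \<longrightarrow> Poly_Mapping.lookup f \<alpha> = 0)"
  by (auto simp: mpow_def in_keys_iff not_le[symmetric])

lemma mpow_0 [simp]: "mpow 0 = UNIV"
  by (simp add: mpow_iff set_eq_iff)

lemma mpow_antimono: "i \<le> j \<Longrightarrow> mpow j \<subseteq> mpow i"
  by (auto simp: mpow_iff)

lemma mpow_add: "f \<in> mpow k \<Longrightarrow> g \<in> mpow k \<Longrightarrow> f + g \<in> mpow k"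
  by (auto simp: mpow_iff lookup_add)

lemma mpow_mult: "f \<in> mpow i \<Longrightarrow> g \<in> mpow j \<Longrightarrow> f * g \<in> mpow (i + j)"
proof -
  assume a: "f \<in> mpow i" "g \<in> mpow j"
  show "f * g \<in> mpow (i + j)"
    unfolding mpow_def
  proof clarify
    fix \<gamma> assume "\<gamma> \<in> Poly_Mapping.keys (f * g)"
    then obtain \<alpha> \<beta> where "\<gamma> = \<alpha> + \<beta>" "\<alpha> \<in> Poly_Mapping.keys f" "\<beta> \<in> Poly_Mapping.keys g"
      using keys_mult by blast
    then show "i + j \<le> mdeg \<gamma>" using a by (fastforce simp: mpow_def mdeg_add)
  qed
qed

lemma ideal_mpow [simp]: "ideal_of (mpow k)"
  unfolding Id.subspace_def using mpow_mult[of _ 0 _ k] by (auto simp: mpow_add) (auto simp: mpow_def)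

lemma mpow_1_iff: "f \<in> mpow 1 \<longleftrightarrow> mpoly_eval origin f = 0"
  by (auto simp: mpow_iff eval_origin)

lemma mpow_Suc_0_iff: "f \<in> mpow (Suc 0) \<longleftrightarrow> mpoly_eval origin f = 0"
  using mpow_1_iff by simp

lemma var_in_mpow: "mpoly_var v \<in> mpow 1"
  by (simp add: mpow_Suc_0_iff origin_def)

lemma power_in_mpow: "f \<in> mpow 1 \<Longrightarrow> f ^ n \<in> mpow n"
  by (induction n) (auto dest: mpow_mult)

lemma single_in_mpow: "k \<le> mdeg \<alpha> \<Longrightarrow> Poly_Mapping.single \<alpha> c \<in> mpow k"
  by (auto simp: mpow_def split: if_splits)

text \<open>A monomial of positive degree is divisible by some variable.\<close>

lemma mpow_Suc_eq:
  "mpow (Suc k) = Id.span {mpoly_var v * f | v f. f \<in> mpow k}" (is "_ = Id.span ?S")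
proof
  show "Id.span ?S \<subseteq> mpow (Suc k)"
    using mpow_mult[OF var_in_mpow] by (intro Id.span_minimal) auto
  have "Poly_Mapping.single \<alpha> c \<in> Id.span ?S" if deg: "Suc k \<le> mdeg \<alpha>" for \<alpha> c
  proof -
    obtain v where v: "Poly_Mapping.lookup \<alpha> v \<noteq> 0"
      using deg poly_mapping_eqI[of \<alpha> 0] by fastforce
    define \<beta> where "\<beta> = \<alpha> - Poly_Mapping.single v 1"
    have ab: "\<alpha> = Poly_Mapping.single v 1 + \<beta>"
      using v by (intro poly_mapping_eqI) (auto simp: \<beta>_def lookup_add lookup_minus lookup_single when_def)
    have "Poly_Mapping.single \<alpha> c = mpoly_var v * Poly_Mapping.single \<beta> c"
      by (simp add: ab mpoly_var_def mult_single)
    moreover have "Poly_Mapping.single \<beta> c \<in> mpow k"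
      using deg by (intro single_in_mpow) (simp add: ab mdeg_add)
    ultimately show ?thesis by (intro Id.span_base) blast
  qed
  then have "(\<Sum>\<alpha>\<in>Poly_Mapping.keys f. Poly_Mapping.single \<alpha> (Poly_Mapping.lookup f \<alpha>)) \<in> Id.span ?S"
    if "f \<in> mpow (Suc k)" for f
    using that by (intro Id.span_sum) (auto simp: mpow_def)
  then show "mpow (Suc k) \<subseteq> Id.span ?S"
    unfolding mpoly_eq_sum_single[symmetric] by blast
qed

lemma mpow_1_eq: "mpow 1 = Id.span (range (mpoly_var :: 'n::finite \<Rightarrow> _))"
proof -
  have 1: "Id.span {mpoly_var v * f | (v :: 'n) f. True} \<subseteq> Id.span (range mpoly_var)"
  proof (rule Id.span_minimal)
    have "mpoly_var v * f \<in> Id.span (range mpoly_var)" for v :: 'n and f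
      using Id.span_scale[OF Id.span_base, of "mpoly_var v" "range mpoly_var" f]
      by (simp add: mult.commute)
    then show "{mpoly_var v * f | (v :: 'n) f. True} \<subseteq> Id.span (range (mpoly_var :: 'n \<Rightarrow> _))" by auto
  qed simp
  have 2: "Id.span (range (mpoly_var :: 'n \<Rightarrow> _)) \<subseteq> mpow 1"
    using var_in_mpow by (intro Id.span_minimal) (blast, simp)
  show ?thesis using 1 2 mpow_Suc_eq[of 0] by auto
qed

text \<open>After scaling by a constant, g is 1 - u with u vanishing at the origin, and a partial
  sum of the geometric series in u inverts it up to \<open>u ^ k\<close>.\<close>

lemma eval_origin_unit_mod_mpow:
  assumes "mpoly_eval origin g \<noteq> 0"
  shows "\<exists>h. h * g - 1 \<in> mpow k"
proof -
  define c where "c = inverse (mpoly_eval origin g)"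
  define u where "u = 1 - mpoly_const c * g"
  have u: "u \<in> mpow 1" using assms by (simp add: mpow_Suc_0_iff u_def c_def)
  have "mpoly_const c * g = 1 - u" by (simp add: u_def)
  then have "(\<Sum>i<k. u ^ i) * mpoly_const c * g - 1 = (\<Sum>i<k. u ^ i) * (1 - u) - 1"
    by (simp add: mult.assoc)
  also have "\<dots> = - (u ^ k)"
    using one_diff_power_eq[of u k, symmetric] by (simp add: mult.commute)
  also have "\<dots> \<in> mpow k"
    by (rule Id.subspace_neg[OF ideal_mpow power_in_mpow[OF u]])
  finally show ?thesis by blast
qed

section \<open>The polynomial ring is Noetherian\<close>

text \<open>A decreasing sequence of naturals is constant from the place where it attains its
  minimum, so its tail is nondecreasing as well.\<close>

lemma nat_seq_mono_subseq:
  fixes s :: "nat \<Rightarrow> nat"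
  shows "\<exists>r. strict_mono r \<and> incseq (\<lambda>k. s (r k))"
proof -
  obtain r where r: "strict_mono r" "monoseq (\<lambda>k. s (r k))"
    using seq_monosub[of s] by blast
  show ?thesis
  proof (cases "incseq (\<lambda>k. s (r k))")
    case False
    then have dec: "decseq (\<lambda>k. s (r k))" using r(2) by (simp add: monoseq_iff)
    obtain k0 where k0: "\<And>k. s (r k0) \<le> s (r k)"
      using exists_least_iff[of "\<lambda>x. \<exists>k. x = s (r k)"] by (metis not_less)
    have "s (r (k + k0)) = s (r k0)" for k
      using k0[of "k + k0"] decseqD[OF dec, of k0 "k + k0"] by simp
    then have "incseq (\<lambda>k. s (r (k + k0)))" by (simp add: incseq_def)
    moreover have "strict_mono (\<lambda>k. r (k + k0))"
      using r(1) by (simp add: strict_mono_def)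
    ultimately show ?thesis by blast
  qed (use r in blast)
qed

text \<open>Dickson's lemma. Passing to subsequences one variable at a time makes all exponents
  nondecreasing along a common subsequence; its first two terms are then comparable.\<close>

lemma dickson:
  fixes \<alpha> :: "nat \<Rightarrow> ('n::finite \<Rightarrow>\<^sub>0 nat)"
  shows "\<exists>i j \<gamma>. i < j \<and> \<alpha> j = \<alpha> i + \<gamma>"
proof -
  have "\<exists>r. strict_mono r \<and> (\<forall>v\<in>A. incseq (\<lambda>k. Poly_Mapping.lookup (\<alpha> (r k)) v))"
    if "finite A" for A
    using that
  proof induction
    case empty
    show ?case by (auto intro!: exI[of _ id] simp: strict_mono_def)
  next
    case (insert v A)
    then obtain r where r: "strict_mono r" "\<And>w. w \<in> A \<Longrightarrow> incseq (\<lambda>k. Poly_Mapping.lookup (\<alpha> (r k)) w)"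
      by blast
    obtain r' where r': "strict_mono r'" "incseq (\<lambda>k. Poly_Mapping.lookup (\<alpha> (r (r' k))) v)"
      using nat_seq_mono_subseq[of "\<lambda>k. Poly_Mapping.lookup (\<alpha> (r k)) v"] by blast
    have "strict_mono (\<lambda>k. r (r' k))" using r(1) r'(1) by (simp add: strict_mono_def)
    moreover have "incseq (\<lambda>k. Poly_Mapping.lookup (\<alpha> (r (r' k))) w)" if "w \<in> A" for w
      using r(2)[OF that] r'(1) by (auto simp: incseq_def strict_mono_less_eq)
    ultimately show ?case using r'(2) by (intro exI[of _ "\<lambda>k. r (r' k)"]) auto
  qed
  from this[of UNIV] obtain r where r: "strict_mono r"
    "\<And>v. incseq (\<lambda>k. Poly_Mapping.lookup (\<alpha> (r k)) v)" by auto
  have "\<alpha> (r 1) = \<alpha> (r 0) + (\<alpha> (r 1) - \<alpha> (r 0))"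
    using r(2) by (intro poly_mapping_eqI) (simp add: lookup_add lookup_minus incseq_def)
  then show ?thesis using r(1) by (metis strict_mono_def zero_less_one)
qed

section \<open>The monomial order and division by leading monomials\<close>

lemma monom_nonneg: "0 \<le> (\<gamma> :: 'n::{finite,linorder} \<Rightarrow>\<^sub>0 nat)"
proof (cases "\<gamma> = 0")
  case False
  define k where "k = Min (Poly_Mapping.keys \<gamma>)"
  have "Poly_Mapping.keys \<gamma> \<noteq> {}" using False by simp
  then have "k \<in> Poly_Mapping.keys \<gamma>" "\<And>j. j \<in> Poly_Mapping.keys \<gamma> \<Longrightarrow> k \<le> j"
    unfolding k_def by auto
  then have "0 < Poly_Mapping.lookup \<gamma> k \<and> (\<forall>j<k. Poly_Mapping.lookup \<gamma> j = 0)"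
    by (meson in_keys_iff linorder_not_le neq0_conv)
  then have "0 < \<gamma>" by (auto simp: less_poly_mapping.rep_eq less_fun_def)
  then show ?thesis by simp
qed simp

text \<open>In an infinite descent Dickson's lemma finds a later term that is a multiple of an
  earlier one, and a multiple is never smaller because 0 is the least exponent.\<close>

lemma wf_monom_less: "wf {(\<alpha>, \<beta> :: 'n::{finite,linorder} \<Rightarrow>\<^sub>0 nat). \<alpha> < \<beta>}"
  unfolding wf_iff_no_infinite_down_chain
proof
  assume "\<exists>f :: nat \<Rightarrow> ('n \<Rightarrow>\<^sub>0 nat). \<forall>i. (f (Suc i), f i) \<in> {(\<alpha>, \<beta>). \<alpha> < \<beta>}"
  then obtain f :: "nat \<Rightarrow> ('n \<Rightarrow>\<^sub>0 nat)" where f: "\<And>i. f (Suc i) < f i" by auto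
  obtain i j \<gamma> where ij: "i < j" "f j = f i + \<gamma>" using dickson[of f] by blast
  have "f j < f i" using lift_Suc_mono_less[of "\<lambda>i. f i" j i] f ij(1)
    by (induction j) (auto simp: less_Suc_eq intro: less_trans)
  moreover have "f i + 0 \<le> f j" unfolding ij(2) by (rule add_left_mono) (rule monom_nonneg)
  ultimately show False by simp
qed

definition lead :: "'n::{finite,linorder} mpoly \<Rightarrow> ('n \<Rightarrow>\<^sub>0 nat)" where
  "lead f = Max (Poly_Mapping.keys f)"

lemma lead_in_keys: "f \<noteq> 0 \<Longrightarrow> lead f \<in> Poly_Mapping.keys f"
  unfolding lead_def by (rule Max_in) auto

lemma lead_ge: "\<alpha> \<in> Poly_Mapping.keys f \<Longrightarrow> \<alpha> \<le> lead f"
  unfolding lead_def by (rule Max_ge) auto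

text \<open>One division step: \<open>h\<close> is the monomial whose product with g cancels the
  leading term of f.\<close>

lemma lead_reduce:
  fixes f g :: "'n::{finite,linorder} mpoly"
  assumes "f \<noteq> 0" "g \<noteq> 0" "lead f = lead g + \<gamma>"
  obtains h where "f - h * g = 0 \<or> lead (f - h * g) < lead f"
proof -
  define c where "c = Poly_Mapping.lookup f (lead f) / Poly_Mapping.lookup g (lead g)"
  define h :: "'n mpoly" where "h = Poly_Mapping.single \<gamma> c"
  have hg: "Poly_Mapping.lookup (h * g) (\<gamma> + \<beta>) = c * Poly_Mapping.lookup g \<beta>" for \<beta>
  proof (induction g rule: mpoly_induct)
    case (add f g) then show ?case by (simp add: distrib_left lookup_add)
  qed (auto simp: h_def mult_single lookup_single when_def)
  have z: "Poly_Mapping.lookup (f - h * g) (lead f) = 0"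
    using hg[of "lead g"] lead_in_keys[OF assms(2)] assms(3)
    by (simp add: lookup_minus c_def in_keys_iff add.commute)
  have le: "\<alpha> \<le> lead f" if \<alpha>: "\<alpha> \<in> Poly_Mapping.keys (f - h * g)" for \<alpha>
  proof -
    from \<alpha> have "\<alpha> \<in> Poly_Mapping.keys f \<union> Poly_Mapping.keys (h * g)"
      by (auto simp: in_keys_iff lookup_minus)
    then show ?thesis
    proof
      assume "\<alpha> \<in> Poly_Mapping.keys (h * g)"
      then obtain \<beta> where "\<alpha> = \<gamma> + \<beta>" "\<beta> \<in> Poly_Mapping.keys g"
        using keys_mult[of h g] by (auto simp: h_def split: if_splits)
      then show ?thesis using add_left_mono[OF lead_ge[of \<beta> g], of \<gamma>] assms(3)
        by (simp add: add.commute)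
    qed (rule lead_ge)
  qed
  have "lead (f - h * g) < lead f" if "f - h * g \<noteq> 0"
  proof -
    have "lead (f - h * g) \<in> Poly_Mapping.keys (f - h * g)" using that by (rule lead_in_keys)
    moreover from this have "lead (f - h * g) \<noteq> lead f" using z by (auto simp: in_keys_iff)
    ultimately show ?thesis using le by (simp add: less_le)
  qed
  then show ?thesis by (intro that[of h]) blast
qed

text \<open>Hilbert's basis theorem by minimal leading monomials. If Q were not finitely generated,
  one could keep choosing an element of Q outside the ideal of the earlier choices with
  \<open>lead\<close> as small as possible. By Dickson's lemma some \<open>lead\<close> is a
  multiple of an earlier one, and a division step produces a smaller candidate.\<close>

theorem mpoly_noetherian:
  fixes Q :: "'n::{finite,linorder} mpoly set"
  assumes "ideal_of Q"
  shows "\<exists>F. finite F \<and> F \<subseteq> Q \<and> Id.span F = Q"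
proof (rule ccontr)
  assume no: "\<not> ?thesis"
  define best where "best F f \<longleftrightarrow> f \<in> Q - Id.span F \<and> (\<forall>g\<in>Q - Id.span F. \<not> lead g < lead f)" for F f
  have ex: "\<exists>f. best F f" if "finite F" "F \<subseteq> Q" for F
  proof -
    have "Id.span F \<subseteq> Q" using that(2) assms by (rule Id.span_minimal)
    moreover have "Id.span F \<noteq> Q" using no that by metis
    ultimately obtain f0 where "f0 \<in> Q - Id.span F" by fast
    then show ?thesis
      using wfE_min[OF wf_inv_image[OF wf_monom_less, of lead], of f0 "Q - Id.span F"]
      unfolding best_def by (metis (no_types, lifting) case_prodI in_inv_image mem_Collect_eq)
  qed
  define S where "S = rec_nat {} (\<lambda>_ F. insert (SOME f. best F f) F)"
  define p where "p n = (SOME f. best (S n) f)" for n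
  have S_simps: "S 0 = {}" "S (Suc n) = insert (p n) (S n)" for n
    by (simp_all add: S_def p_def)
  have S: "finite (S n) \<and> S n \<subseteq> Q \<and> best (S n) (p n)" for n
  proof (induction n)
    case 0
    then show ?case using someI_ex[OF ex[of "{}"]] by (simp add: S_simps p_def)
  next
    case (Suc n)
    then have "finite (S (Suc n))" "S (Suc n) \<subseteq> Q" by (auto simp: S_simps best_def)
    then show ?case using someI_ex[OF ex[of "S (Suc n)"]] by (simp add: p_def)
  qed
  have nz: "p n \<noteq> 0" for n using S[of n] Id.span_zero[of "S n"] by (auto simp: best_def)
  have mono: "i \<le> j \<Longrightarrow> S i \<subseteq> S j" for i j
    by (induction j) (auto simp: S_simps le_Suc_eq)
  obtain i j \<gamma> where ij: "i < j" "lead (p j) = lead (p i) + \<gamma>"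
    using dickson[of "\<lambda>n. lead (p n)"] by blast
  have pi: "p i \<in> S j" using mono[of "Suc i" j] ij(1) by (auto simp: S_simps)
  obtain h where h: "p j - h * p i = 0 \<or> lead (p j - h * p i) < lead (p j)"
    using lead_reduce[OF nz nz ij(2)] by blast
  have hp: "h * p i \<in> Id.span (S j)" using Id.span_scale[OF Id.span_base[OF pi], of h] by simp
  have "p j - h * p i \<notin> Id.span (S j)"
    using S[of j] Id.span_add[OF _ hp, of "p j - h * p i"] by (auto simp: best_def)
  moreover have "h * p i \<in> Q" using hp S[of j] Id.span_minimal[OF _ assms, of "S j"] by blast
  then have "p j - h * p i \<in> Q" using S[of j] Id.subspace_diff[OF assms] by (auto simp: best_def)
  ultimately show False using h S[of j] Id.span_zero[of "S j"] by (auto simp: best_def)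
qed

lemma ideal_chain_stabilizes:
  fixes C :: "nat \<Rightarrow> 'n::{finite,linorder} mpoly set"
  assumes "\<And>i. ideal_of (C i)" "incseq C"
  shows "\<exists>n. \<forall>k. C k \<subseteq> C n"
proof -
  have "ideal_of (\<Union>(range C))"
    unfolding Id.subspace_def
  proof (intro conjI ballI allI)
    show "0 \<in> \<Union>(range C)" using Id.subspace_0[OF assms(1)] by auto
  next
    fix a b assume "a \<in> \<Union>(range C)" "b \<in> \<Union>(range C)"
    then obtain i j where "a \<in> C i" "b \<in> C j" by auto
    then have "a \<in> C (max i j)" "b \<in> C (max i j)"
      using assms(2) by (meson incseqD max.cobounded1 max.cobounded2 subsetD)+
    then show "a + b \<in> \<Union>(range C)" using Id.subspace_add[OF assms(1)] by blast
  qed (use Id.subspace_scale[OF assms(1)] in blast)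
  then obtain F where F: "finite F" "Id.span F = \<Union>(range C)" using mpoly_noetherian by metis
  then have sub: "F \<subseteq> \<Union>(range C)" using Id.span_superset by blast
  have "\<exists>n. F \<subseteq> C n" using F(1) sub
  proof induction
    case (insert f F)
    then obtain n i where n: "F \<subseteq> C n" "f \<in> C i" by auto
    have "C n \<subseteq> C (max i n)" "C i \<subseteq> C (max i n)" using assms(2) by (auto simp: incseq_def)
    then show ?case using n by blast
  qed auto
  then obtain n where "F \<subseteq> C n" by blast
  then have "Id.span F \<subseteq> C n" using assms(1) by (rule Id.span_minimal)
  then show ?thesis using F(2) by blast
qed

lemma maximal_ideal_exists:
  fixes \<F> :: "'n::{finite,linorder} mpoly set set"
  assumes "Q0 \<in> \<F>" "\<And>Q. Q \<in> \<F> \<Longrightarrow> ideal_of Q"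
  shows "\<exists>Q\<in>\<F>. \<forall>Q'\<in>\<F>. Q \<subseteq> Q' \<longrightarrow> Q' = Q"
proof (rule ccontr)
  assume "\<not> ?thesis"
  then have "\<forall>Q. \<exists>Q'. Q \<in> \<F> \<longrightarrow> Q' \<in> \<F> \<and> Q \<subset> Q'" by blast
  then obtain s where s: "\<And>Q. Q \<in> \<F> \<Longrightarrow> s Q \<in> \<F> \<and> Q \<subset> s Q" by metis
  define C where "C n = (s ^^ n) Q0" for n
  have C: "C n \<in> \<F>" for n by (induction n) (use s assms(1) in \<open>auto simp: C_def\<close>)
  have step: "C n \<subset> C (Suc n)" for n using s[OF C[of n]] by (simp add: C_def)
  then have "incseq C" by (intro incseq_SucI) auto
  then obtain n where "\<forall>k. C k \<subseteq> C n" using ideal_chain_stabilizes[of C] assms(2) C by blast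
  then show False using step[of n] by blast
qed

section \<open>Prime ideals and multiplicative sets\<close>

definition prime_id :: "'a::comm_ring_1 set \<Rightarrow> bool" where
  "prime_id P \<longleftrightarrow> Id.subspace P \<and> 1 \<notin> P \<and> (\<forall>a b. a * b \<in> P \<longrightarrow> a \<in> P \<or> b \<in> P)"

lemma prime_id_ideal: "prime_id P \<Longrightarrow> Id.subspace P"
  by (simp add: prime_id_def)

lemma prime_id_mult: "prime_id P \<Longrightarrow> a * b \<in> P \<longleftrightarrow> a \<in> P \<or> b \<in> P"
  using Id.subspace_scale[of P a b] Id.subspace_scale[of P b a]
  unfolding prime_id_def mult.commute[of b a] by blast

lemma prime_id_1: "prime_id P \<Longrightarrow> 1 \<notin> P"
  by (simp add: prime_id_def)

lemma prime_id_power: "prime_id P \<Longrightarrow> a ^ n \<in> P \<Longrightarrow> a \<in> P"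
  by (induction n) (auto simp: prime_id_1 prime_id_mult)

lemma span_insert_ideal:
  assumes "Id.subspace P"
  shows "Id.span (insert a P) = {p + r * a | p r. p \<in> P}"
proof -
  have P: "Id.span P = P" using assms by (rule Id.span_eq_iff[THEN iffD2])
  have "x \<in> Id.span (insert a P) \<longleftrightarrow> (\<exists>r. x - r * a \<in> P)" for x
    unfolding Id.span_insert P by simp
  moreover have "(\<exists>r. x - r * a \<in> P) \<longleftrightarrow> (\<exists>p r. x = p + r * a \<and> p \<in> P)" for x
    by (metis add_diff_cancel_right' diff_add_cancel)
  ultimately show ?thesis by blast
qed

lemma prod_expand:
  fixes p :: "'a::comm_ring_1"
  shows "(p + r * a) * (p' + r' * b) = (p' + r' * b) * p + (r * a) * p' + (r * r') * (a * b)"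
  by (simp add: algebra_simps)

text \<open>An ideal maximal among those that miss a multiplicative set is prime. The maximality is
  kept in the conclusion because the Nullstellensatz uses it.\<close>

lemma prime_avoiding_exists:
  fixes Q :: "'n::{finite,linorder} mpoly set"
  assumes "ideal_of Q" "1 \<in> \<Sigma>" "\<And>a b. a \<in> \<Sigma> \<Longrightarrow> b \<in> \<Sigma> \<Longrightarrow> a * b \<in> \<Sigma>" "Q \<inter> \<Sigma> = {}"
  obtains P where "prime_id P" "Q \<subseteq> P" "P \<inter> \<Sigma> = {}"
    "\<And>P'. ideal_of P' \<Longrightarrow> P \<subseteq> P' \<Longrightarrow> P' \<inter> \<Sigma> = {} \<Longrightarrow> P' = P"
proof -
  define \<F> where "\<F> = {P. ideal_of P \<and> Q \<subseteq> P \<and> P \<inter> \<Sigma> = {}}"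
  have "\<exists>P\<in>\<F>. \<forall>P'\<in>\<F>. P \<subseteq> P' \<longrightarrow> P' = P"
    by (rule maximal_ideal_exists[of Q]) (simp_all add: \<F>_def assms(1,4))
  then obtain P where P: "P \<in> \<F>" "\<And>P'. P' \<in> \<F> \<Longrightarrow> P \<subseteq> P' \<Longrightarrow> P' = P"
    by (elim bexE) simp
  then have idP: "ideal_of P" "Q \<subseteq> P" "P \<inter> \<Sigma> = {}" by (auto simp: \<F>_def)
  have meet: "\<exists>p r. p \<in> P \<and> p + r * a \<in> \<Sigma>" if "a \<notin> P" for a
  proof (rule ccontr)
    assume no: "\<not> ?thesis"
    have sup: "insert a P \<subseteq> Id.span (insert a P)" by (rule Id.span_superset)
    have "Id.span (insert a P) \<inter> \<Sigma> = {}"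
      unfolding span_insert_ideal[OF idP(1)] using no by fast
    moreover have "Q \<subseteq> Id.span (insert a P)" using sup idP(2) by fast
    ultimately have "Id.span (insert a P) \<in> \<F>" by (simp add: \<F>_def)
    then have "Id.span (insert a P) = P" using P(2) sup by simp
    then show False using that sup by simp
  qed
  have pr: "prime_id P"
    unfolding prime_id_def
  proof (intro conjI allI impI)
    show "ideal_of P" "1 \<notin> P" using idP assms(2) by auto
  next
    fix a b assume ab: "a * b \<in> P"
    show "a \<in> P \<or> b \<in> P"
    proof (rule ccontr)
      assume "\<not> ?thesis"
      then obtain p r p' r' where pr: "p \<in> P" "p + r * a \<in> \<Sigma>" "p' \<in> P" "p' + r' * b \<in> \<Sigma>"
        using meet[of a] meet[of b] by fast
      have "(p + r * a) * (p' + r' * b) = (p' + r' * b) * p + (r * a) * p' + (r * r') * (a * b)"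
        by (rule prod_expand)
      also have "\<dots> \<in> P"
        by (rule Id.subspace_add[OF idP(1) Id.subspace_add[OF idP(1)]];
            rule Id.subspace_scale[OF idP(1)]) (fact pr ab)+
      finally show False using assms(3)[OF pr(2,4)] idP(3) by blast
    qed
  qed
  have max: "P' = P" if "ideal_of P'" "P \<subseteq> P'" "P' \<inter> \<Sigma> = {}" for P'
    using P(2)[of P'] that order_trans[OF idP(2) that(2)] by (simp add: \<F>_def)
  show ?thesis by (rule that[OF pr idP(2,3) max])
qed

section \<open>Localization at the origin\<close>

text \<open>The contraction to the polynomial ring of the ideal that \<open>Q\<close> generates in the local ring.\<close>

definition loc :: "'n::finite mpoly set \<Rightarrow> 'n mpoly set" where
  "loc Q = {f. \<exists>g. mpoly_eval origin g \<noteq> 0 \<and> g * f \<in> Q}"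

lemma locI: "mpoly_eval origin g \<noteq> 0 \<Longrightarrow> g * f \<in> Q \<Longrightarrow> f \<in> loc Q"
  by (auto simp: loc_def)

lemma loc_superset: "Q \<subseteq> loc Q"
  using locI[of 1] by force

lemma loc_mono: "Q \<subseteq> Q' \<Longrightarrow> loc Q \<subseteq> loc Q'"
  by (auto simp: loc_def)

lemma ideal_loc [simp]:
  assumes "ideal_of Q"
  shows "ideal_of (loc Q)"
  unfolding Id.subspace_def
proof (intro conjI ballI allI)
  show "0 \<in> loc Q" using Id.subspace_0[OF assms] loc_superset by blast
next
  fix a b assume "a \<in> loc Q" "b \<in> loc Q"
  then obtain g h where gh: "mpoly_eval origin g \<noteq> 0" "g * a \<in> Q" "mpoly_eval origin h \<noteq> 0" "h * b \<in> Q"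
    by (auto simp: loc_def)
  have "(g * h) * (a + b) = h * (g * a) + g * (h * b)"
    by (simp only: distrib_left mult.assoc mult.left_commute[of h])
  also have "\<dots> \<in> Q"
    using Id.subspace_add[OF assms] Id.subspace_scale[OF assms] gh(2,4) by simp
  finally show "a + b \<in> loc Q" using gh by (intro locI[of "g * h"]) auto
next
  fix c a assume "a \<in> loc Q"
  then obtain g where g: "mpoly_eval origin g \<noteq> 0" "g * a \<in> Q" by (auto simp: loc_def)
  have "g * (c * a) = c * (g * a)" by (rule mult.left_commute)
  then show "c * a \<in> loc Q" using g Id.subspace_scale[OF assms] by (metis locI)
qed

lemma loc_loc: "loc (loc Q) = loc Q"
proof
  show "loc (loc Q) \<subseteq> loc Q"
  proof
    fix f assume "f \<in> loc (loc Q)"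
    then obtain g h where "mpoly_eval origin g \<noteq> 0" "mpoly_eval origin h \<noteq> 0" "h * (g * f) \<in> Q"
      by (auto simp: loc_def)
    then show "f \<in> loc Q" by (intro locI[of "h * g"]) (auto simp: mult.assoc)
  qed
qed (rule loc_superset)

lemma loc_mult_cancel: "mpoly_eval origin g \<noteq> 0 \<Longrightarrow> g * f \<in> loc Q \<Longrightarrow> f \<in> loc Q"
  using locI[of g f "loc Q"] loc_loc by blast

text \<open>If h inverts g modulo \<open>mpow k\<close>, then f = h (g f) - f (h g - 1). In
  particular an ideal that contains a power of the maximal ideal equals its own contraction.\<close>

lemma loc_subset_plus_mpow: "ideal_of Q \<Longrightarrow> loc Q \<subseteq> Q + mpow k"
proof
  fix f assume Q: "ideal_of Q" and "f \<in> loc Q"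
  then obtain g where g: "mpoly_eval origin g \<noteq> 0" "g * f \<in> Q" by (auto simp: loc_def)
  obtain h where h: "h * g - 1 \<in> mpow k" using eval_origin_unit_mod_mpow[OF g(1)] by blast
  have "f = h * (g * f) + (- f) * (h * g - 1)"
    by (simp only: right_diff_distrib mult_1_right mult_minus_left mult.commute[of f] mult.assoc) simp
  moreover have "h * (g * f) \<in> Q" using Id.subspace_scale[OF Q g(2)] .
  moreover have "(- f) * (h * g - 1) \<in> mpow k" using Id.subspace_scale[OF ideal_mpow h] .
  ultimately show "f \<in> Q + mpow k" by (metis set_plus_intro)
qed

lemma ideal_plus [simp]:
  fixes Q Q' :: "'a::comm_ring_1 set"
  assumes "Id.subspace Q" "Id.subspace Q'"
  shows "Id.subspace (Q + Q')"
proof -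
  have "Q + Q' = Id.span (Q \<union> Q')"
    unfolding Id.span_Un set_plus_def using assms by (auto simp: Id.span_eq_iff[THEN iffD2])
  then show ?thesis by simp
qed

lemma plus_superset1: "0 \<in> Q' \<Longrightarrow> Q \<subseteq> Q + (Q' :: 'a::comm_ring_1 set)"
  by (metis add.right_neutral set_plus_intro subsetI)

lemma plus_superset2: "0 \<in> Q' \<Longrightarrow> Q \<subseteq> Q' + (Q :: 'a::comm_ring_1 set)"
  by (metis add.left_neutral set_plus_intro subsetI)

lemma plus_ideal_minimal:
  fixes A B :: "'a::comm_ring_1 set"
  shows "Id.subspace Q \<Longrightarrow> A \<subseteq> Q \<Longrightarrow> B \<subseteq> Q \<Longrightarrow> A + B \<subseteq> Q"
  using Id.subspace_add by (fastforce elim!: set_plus_elim)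

lemma loc_eq_if_mpow_subset:
  assumes "ideal_of Q" "mpow k \<subseteq> Q"
  shows "loc Q = Q"
  using loc_subset_plus_mpow[OF assms(1), of k] plus_ideal_minimal[OF assms(1) _ assms(2), of Q] loc_superset
  by blast

lemma loc_eq_plus_mpow:
  assumes "ideal_of Q" "mpow k \<subseteq> loc Q"
  shows "loc Q = Q + mpow k"
  using loc_subset_plus_mpow[OF assms(1), of k]
    plus_ideal_minimal[OF ideal_loc[OF assms(1)] loc_superset assms(2)] by blast

text \<open>The elimination in Nakayama's lemma with denominators cleared. Relations that express
  \<open>g f * f\<close> through b for the other generators f are inserted into the relation for b,
  multiplied by a common multiple \<open>G\<close> of the \<open>g f\<close>.\<close>

lemma nakayama_pivot:
  fixes b :: "'a::comm_ring_1"
  assumes "finite F" "b = q + (c * b + (\<Sum>f\<in>F. u f * f))" "\<And>f. f \<in> F \<Longrightarrow> G = G' f * g f"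
  shows "(G * (1 - c) - (\<Sum>f\<in>F. u f * G' f * r f)) * b =
    G * q + (\<Sum>f\<in>F. (u f * G' f) * (g f * f - r f * b))"
proof -
  have "(1 - c) * b = q + (\<Sum>f\<in>F. u f * f)"
    using assms(2) by (simp add: algebra_simps)
  then have "G * (1 - c) * b = G * q + (\<Sum>f\<in>F. G * (u f * f))"
    by (simp add: mult.assoc distrib_left sum_distrib_left)
  also have "(\<Sum>f\<in>F. G * (u f * f)) = (\<Sum>f\<in>F. (u f * G' f) * (g f * f - r f * b) + (u f * G' f * r f) * b)"
    by (rule sum.cong[OF refl]) (simp add: assms(3) right_diff_distrib ac_simps)
  finally show ?thesis
    by (simp add: left_diff_distrib sum.distrib sum_distrib_right)
qed

text \<open>Induction on the number of generators. With b added to Q the other generators are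
  covered by the induction hypothesis, so they are locally multiples of b modulo Q; inserting this
  into the relation for b leaves a unit at the origin times b.\<close>

lemma nakayama_finite:
  assumes "finite F" "ideal_of Q" "F \<subseteq> Q + {(\<Sum>f\<in>F. u f * f) | u. \<forall>f\<in>F. mpoly_eval origin (u f) = 0}"
  shows "F \<subseteq> loc (Q :: 'n::finite mpoly set)"
  using assms
proof (induction F arbitrary: Q rule: finite_induct)
  case (insert b F)
  have dec: "\<exists>q u. q \<in> Q \<and> (\<forall>f\<in>insert b F. mpoly_eval origin (u f) = 0) \<and> a = q + (u b * b + (\<Sum>f\<in>F. u f * f))"
    if "a \<in> insert b F" for a
  proof -
    have "a \<in> Q + {(\<Sum>f\<in>insert b F. u f * f) | u. \<forall>f\<in>insert b F. mpoly_eval origin (u f) = 0}"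
      using insert.prems(2) that by (rule subsetD)
    then obtain q u where "q \<in> Q" "\<forall>f\<in>insert b F. mpoly_eval origin (u f) = 0"
      "a = q + (\<Sum>f\<in>insert b F. u f * f)" by (auto elim!: set_plus_elim)
    then show ?thesis using insert.hyps by (intro exI[of _ q] exI[of _ u]) simp
  qed
  define Q1 where "Q1 = Id.span (insert b Q)"
  have Q1: "ideal_of Q1" "Q \<subseteq> Q1" "b \<in> Q1"
    using Id.span_superset[of "insert b Q"] by (auto simp: Q1_def)
  have F1: "F \<subseteq> loc Q1"
  proof (rule insert.IH[OF Q1(1)], rule subsetI)
    fix a assume "a \<in> F"
    then obtain q u where qu: "q \<in> Q" "\<forall>f\<in>insert b F. mpoly_eval origin (u f) = 0"
      "a = q + (u b * b + (\<Sum>f\<in>F. u f * f))" using dec by blast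
    have "q + u b * b \<in> Q1" using qu(1) Q1 Id.subspace_add[OF Q1(1)] Id.subspace_scale[OF Q1(1)] by blast
    then have "(q + u b * b) + (\<Sum>f\<in>F. u f * f) \<in> Q1 + {\<Sum>f\<in>F. u f * f |u. \<forall>f\<in>F. mpoly_eval origin (u f) = 0}"
      using qu(2) by (intro set_plus_intro) auto
    then show "a \<in> Q1 + {\<Sum>f\<in>F. u f * f |u. \<forall>f\<in>F. mpoly_eval origin (u f) = 0}"
      unfolding qu(3) by (simp add: add.assoc)
  qed
  have "\<exists>g r. mpoly_eval origin g \<noteq> 0 \<and> g * f - r * b \<in> Q" if f: "f \<in> F" for f
  proof -
    obtain g p r where "mpoly_eval origin g \<noteq> 0" "p \<in> Q" "g * f = p + r * b"
      using subsetD[OF F1 f] unfolding loc_def Q1_def span_insert_ideal[OF insert.prems(1)] by auto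
    then show ?thesis by (intro exI[of _ g] exI[of _ r]) simp
  qed
  then obtain g r where gr: "\<And>f. f \<in> F \<Longrightarrow> mpoly_eval origin (g f) \<noteq> 0 \<and> g f * f - r f * b \<in> Q"
    by metis
  obtain q u where qu: "q \<in> Q" "\<forall>f\<in>insert b F. mpoly_eval origin (u f) = 0"
    "b = q + (u b * b + (\<Sum>f\<in>F. u f * f))" using dec by blast
  define G where "G = (\<Prod>f\<in>F. g f)"
  define G' where "G' f = (\<Prod>f'\<in>F - {f}. g f')" for f
  have GG: "G = G' f * g f" if "f \<in> F" for f
    using that insert.hyps(1) by (simp add: G_def G'_def prod.remove mult.commute)
  have G0: "mpoly_eval origin G \<noteq> 0" using gr insert.hyps(1) by (simp add: G_def)
  \<comment> \<open>All the \<open>u f\<close> and \<open>u b\<close> vanish at the origin, so w has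
    there the same nonzero value as \<open>G\<close>.\<close>
  define w where "w = G * (1 - u b) - (\<Sum>f\<in>F. u f * G' f * r f)"
  have w0: "mpoly_eval origin w \<noteq> 0" using G0 qu(2) by (simp add: w_def)
  have "w * b = G * q + (\<Sum>f\<in>F. (u f * G' f) * (g f * f - r f * b))"
    unfolding w_def by (rule nakayama_pivot[OF insert.hyps(1) qu(3) GG])
  also have "\<dots> \<in> Q"
    using gr qu(1) by (intro Id.subspace_add[OF insert.prems(1)] Id.subspace_sum[OF insert.prems(1)]
        Id.subspace_scale[OF insert.prems(1)]) auto
  finally have b: "b \<in> loc Q" using w0 by (rule locI[rotated])
  have "Q1 \<subseteq> loc Q"
    unfolding Q1_def using b loc_superset by (intro Id.span_minimal) (auto simp: insert.prems(1))
  then show ?case using F1 b loc_mono[of Q1 "loc Q"] loc_loc by blast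
qed auto

text \<open>A finite generating set of B rewrites every element of the product of the maximal ideal
  with B as a combination of the generators with coefficients that vanish at the origin.\<close>

lemma nakayama:
  fixes Q :: "'n::{finite,linorder} mpoly set"
  assumes "ideal_of Q" "ideal_of B" "B \<subseteq> Q + Id.span {u * b | u b. u \<in> mpow 1 \<and> b \<in> B}"
  shows "B \<subseteq> loc Q"
proof -
  obtain F where F: "finite F" "F \<subseteq> B" "Id.span F = B" using mpoly_noetherian[OF assms(2)] by blast
  let ?M = "{(\<Sum>f\<in>F. u f * f) | u. \<forall>f\<in>F. mpoly_eval origin (u f) = 0}"
  have idM: "ideal_of ?M"
    unfolding Id.subspace_def
  proof (intro conjI ballI allI)
    show "0 \<in> ?M" by (auto intro!: exI[of _ "\<lambda>_. 0"])
  next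
    fix x y assume "x \<in> ?M" "y \<in> ?M"
    then obtain u v where "x = (\<Sum>f\<in>F. u f * f)" "\<forall>f\<in>F. mpoly_eval origin (u f) = 0"
      "y = (\<Sum>f\<in>F. v f * f)" "\<forall>f\<in>F. mpoly_eval origin (v f) = 0" by auto
    then show "x + y \<in> ?M"
      by (auto intro!: exI[of _ "\<lambda>f. u f + v f"] simp: distrib_right sum.distrib)
  next
    fix c x assume "x \<in> ?M"
    then obtain u where "x = (\<Sum>f\<in>F. u f * f)" "\<forall>f\<in>F. mpoly_eval origin (u f) = 0" by auto
    then show "c * x \<in> ?M"
      by (auto intro!: exI[of _ "\<lambda>f. c * u f"] simp: sum_distrib_left mult.assoc)
  qed
  have mem: "u * b \<in> ?M" if u: "u \<in> mpow 1" and b: "b \<in> B" for u b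
  proof -
    obtain a where "b = (\<Sum>f\<in>F. a f * f)"
      using b F(3) by (auto simp: Id.span_finite[OF F(1)])
    moreover have "mpoly_eval origin u = 0" using u unfolding mpow_1_iff .
    ultimately show ?thesis
      by (auto intro!: exI[of _ "\<lambda>f. u * a f"] simp: sum_distrib_left mult.assoc)
  qed
  have M: "Id.span {u * b | u b. u \<in> mpow 1 \<and> b \<in> B} \<subseteq> ?M"
  proof (rule Id.span_minimal[OF subsetI idM])
    fix x assume "x \<in> {u * b | u b. u \<in> mpow 1 \<and> b \<in> B}"
    then obtain u b where "x = u * b" "u \<in> mpow 1" "b \<in> B" by blast
    then show "x \<in> ?M" using mem[of u b] by (simp only:)
  qed
  have "F \<subseteq> Q + ?M"
    by (rule order_trans[OF F(2) order_trans[OF assms(3) set_plus_mono2[OF order_refl M]]])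
  then have "F \<subseteq> loc Q" by (rule nakayama_finite[OF F(1) assms(1)])
  then have "Id.span F \<subseteq> loc Q" by (rule Id.span_minimal[OF _ ideal_loc[OF assms(1)]])
  then show ?thesis unfolding F(3) .
qed

section \<open>Dimensions of quotients of subspaces\<close>

text \<open>An upper bound n for the dimension of W modulo U; \<open>qdim\<close> is the least such
  bound. As \<open>qdim\<close> carries no information when there is no bound, the lemmas about it
  take a \<open>qgen\<close> hypothesis as proof of finiteness.\<close>

definition qgen :: "'n mpoly set \<Rightarrow> nat \<Rightarrow> 'n mpoly set \<Rightarrow> bool" where
  "qgen U n W \<longleftrightarrow> (\<exists>B. finite B \<and> card B \<le> n \<and> B \<subseteq> W \<and> W \<subseteq> Vs.span (U \<union> B))"

definition qdim :: "'n mpoly set \<Rightarrow> 'n mpoly set \<Rightarrow> nat" where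
  "qdim U W = (LEAST n. qgen U n W)"

lemma qgen_mono: "qgen U n W \<Longrightarrow> n \<le> m \<Longrightarrow> qgen U m W"
  unfolding qgen_def by (meson order_trans)

lemma qgen_qdim: "qgen U n W \<Longrightarrow> qgen U (qdim U W) W"
  unfolding qdim_def by (rule LeastI)

lemma qdim_le: "qgen U n W \<Longrightarrow> qdim U W \<le> n"
  unfolding qdim_def by (rule Least_le)

lemma qgen_antimono: "qgen U n W \<Longrightarrow> U \<subseteq> U' \<Longrightarrow> qgen U' n W"
  unfolding qgen_def using Vs.span_mono[of "U \<union> _" "U' \<union> _"] by (meson Un_mono order_refl order_trans)

lemma qdim_antimono: "qgen U n W \<Longrightarrow> U \<subseteq> U' \<Longrightarrow> qdim U' W \<le> qdim U W"
  using qgen_antimono[OF qgen_qdim] qdim_le by blast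

lemma qgen_0_iff:
  assumes "Vs.subspace U"
  shows "qgen U 0 W \<longleftrightarrow> W \<subseteq> U"
proof
  assume "qgen U 0 W"
  then have "W \<subseteq> Vs.span U" by (auto simp: qgen_def)
  then show "W \<subseteq> U" using Vs.span_minimal[OF order_refl assms] by (rule order_trans)
next
  assume "W \<subseteq> U"
  then show "qgen U 0 W" using Vs.span_superset[of U] by (auto simp: qgen_def intro!: exI[of _ "{}"])
qed

lemma qgen_trans:
  assumes "qgen U a V" "qgen V b W" "V \<subseteq> W"
  shows "qgen U (a + b) W"
proof -
  obtain A where A: "finite A" "card A \<le> a" "A \<subseteq> V" "V \<subseteq> Vs.span (U \<union> A)"
    using assms(1) by (auto simp: qgen_def)
  obtain B where B: "finite B" "card B \<le> b" "B \<subseteq> W" "W \<subseteq> Vs.span (V \<union> B)"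
    using assms(2) by (auto simp: qgen_def)
  have "V \<union> B \<subseteq> Vs.span (U \<union> (A \<union> B))"
    using A(4) Vs.span_mono[of "U \<union> A" "U \<union> (A \<union> B)"] Vs.span_superset[of "U \<union> (A \<union> B)"] by blast
  then have "Vs.span (V \<union> B) \<subseteq> Vs.span (U \<union> (A \<union> B))"
    by (intro Vs.span_minimal) auto
  moreover have "card (A \<union> B) \<le> a + b"
    using card_Un_le[of A B] A(2) B(2) by linarith
  ultimately show ?thesis
    unfolding qgen_def using A(1,3) B(1,3,4) assms(3)
    by (intro exI[of _ "A \<union> B"]) (auto intro: subset_trans)
qed

text \<open>An exchange argument, going through B one element x at a time. Either V gains nothing
  from x, and x goes to C, or some v in V involves x, and v replaces x and goes to A. So A and C
  together never have more elements than B.\<close>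

lemma span_split_exists:
  assumes "finite B" "Vs.subspace U" "Vs.subspace V" "U \<subseteq> V" "V \<subseteq> Vs.span (U \<union> B)"
  shows "\<exists>A C. finite A \<and> finite C \<and> card A + card C \<le> card B \<and> A \<subseteq> V \<and>
    V \<subseteq> Vs.span (U \<union> A) \<and> C \<subseteq> B \<and> Vs.span (U \<union> B) \<subseteq> Vs.span (V \<union> C)"
  using assms(1,3-)
proof (induction B arbitrary: V rule: finite_induct)
  case empty
  then show ?case by (intro exI[of _ "{}"]) (auto intro: Vs.span_mono[THEN subsetD])
next
  case (insert x B)
  let ?W = "Vs.span (U \<union> B)"
  have sub: "Vs.subspace (V \<inter> ?W)" using insert.prems(1) by (intro Vs.subspace_inter) auto
  have UW: "U \<subseteq> V \<inter> ?W" using insert.prems(2) Vs.span_superset[of "U \<union> B"] by blast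
  obtain A C where AC: "finite A" "finite C" "card A + card C \<le> card B" "A \<subseteq> V \<inter> ?W"
    "V \<inter> ?W \<subseteq> Vs.span (U \<union> A)" "C \<subseteq> B" "?W \<subseteq> Vs.span ((V \<inter> ?W) \<union> C)"
    using insert.IH[OF sub UW] by auto
  have WVC: "?W \<subseteq> Vs.span (V \<union> C)"
    using AC(7) Vs.span_mono[of "V \<inter> ?W \<union> C" "V \<union> C"] by blast
  have card_insert: "card (insert x B) = Suc (card B)" using insert.hyps by simp
  have eqx: "Vs.span (U \<union> insert x B) = Vs.span (insert x (U \<union> B))" by simp
  show ?case
  proof (cases "V \<subseteq> ?W")
    case True
    then have VA: "V \<subseteq> Vs.span (U \<union> A)" using AC(5) by blast
    have "Vs.span (insert x (U \<union> B)) \<subseteq> Vs.span (V \<union> insert x C)"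
    proof (rule Vs.span_minimal)
      have "U \<union> B \<subseteq> ?W" by (rule Vs.span_superset)
      moreover have "Vs.span (V \<union> C) \<subseteq> Vs.span (V \<union> insert x C)" by (intro Vs.span_mono) auto
      ultimately show "insert x (U \<union> B) \<subseteq> Vs.span (V \<union> insert x C)"
        using WVC Vs.span_base[of x "V \<union> insert x C"] by auto
    qed simp
    moreover have "card A + card (insert x C) \<le> card (insert x B)"
      using AC(3) card_insert card_insert_le_m1[of "Suc (card C)" C x] by simp
    ultimately show ?thesis using AC VA by (intro exI[of _ A] exI[of _ "insert x C"]) auto
  next
    case False
    then obtain v where v: "v \<in> V" "v \<notin> ?W" by blast
    have vin: "v \<in> Vs.span (insert x (U \<union> B))" using insert.prems(3) v(1) by auto
    obtain c where c: "v - cscale c x \<in> ?W" using vin by (auto simp: Vs.span_insert)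
    have c0: "c \<noteq> 0" using c v(2) by (auto simp: cscale_def)
    have VA: "V \<subseteq> Vs.span (U \<union> insert v A)"
    proof
      fix w assume w: "w \<in> V"
      then have "w \<in> Vs.span (insert x (U \<union> B))" using insert.prems(3) by auto
      then obtain d where d: "w - cscale d x \<in> ?W" by (auto simp: Vs.span_insert)
      have eq: "w - cscale (d / c) v = (w - cscale d x) - cscale (d / c) (v - cscale c x)"
        using c0 by (simp add: Vs.scale_right_diff_distrib)
      have "w - cscale (d / c) v \<in> ?W"
        unfolding eq by (rule Vs.span_diff[OF d Vs.span_scale[OF c]])
      moreover have "w - cscale (d / c) v \<in> V"
        by (rule Vs.subspace_diff[OF insert.prems(1) w Vs.subspace_scale[OF insert.prems(1) v(1)]])
      ultimately have "w - cscale (d / c) v \<in> Vs.span (U \<union> A)" using AC(5) by blast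
      then show "w \<in> Vs.span (U \<union> insert v A)" by (auto simp: Vs.span_insert)
    qed
    have xin: "x \<in> Vs.span (V \<union> C)"
    proof -
      have "cscale (1 / c) (v - (v - cscale c x)) \<in> Vs.span (V \<union> C)"
        by (rule Vs.span_scale[OF Vs.span_diff[OF Vs.span_base[OF UnI1[OF v(1)]] subsetD[OF WVC c]]])
      moreover have "cscale (1 / c) (v - (v - cscale c x)) = x" using c0 by (simp del: Vs.scale_right_diff_distrib)
      ultimately show ?thesis by simp
    qed
    have "Vs.span (insert x (U \<union> B)) \<subseteq> Vs.span (V \<union> C)"
      using xin WVC Vs.span_superset[of "U \<union> B"] by (intro Vs.span_minimal) auto
    moreover have "card (insert v A) + card C \<le> card (insert x B)"
      using AC(1,3) card_insert card_insert_le_m1[of "Suc (card A)" A v] by simp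
    ultimately show ?thesis using AC VA v(1) by (intro exI[of _ "insert v A"] exI[of _ C]) auto
  qed
qed

lemma qgen_split:
  assumes "qgen U n W" "Vs.subspace U" "Vs.subspace V" "Vs.subspace W" "U \<subseteq> V" "V \<subseteq> W"
  shows "\<exists>a b. a + b \<le> n \<and> qgen U a V \<and> qgen V b W"
proof -
  obtain B where B: "finite B" "card B \<le> n" "B \<subseteq> W" "W \<subseteq> Vs.span (U \<union> B)"
    using assms(1) by (auto simp: qgen_def)
  obtain A C where "finite A" "finite C" "card A + card C \<le> card B" "A \<subseteq> V"
     "V \<subseteq> Vs.span (U \<union> A)" "C \<subseteq> B" "Vs.span (U \<union> B) \<subseteq> Vs.span (V \<union> C)"
    using span_split_exists[OF B(1) assms(2,3,5) order_trans[OF assms(6) B(4)]] by blast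
  note AC = this
  have "qgen U (card A) V" "qgen V (card C) W"
    unfolding qgen_def using AC(1,2,4,5,6,7) B(3,4) by (meson order_refl order_trans)+
  then show ?thesis using AC(3) B(2) order_trans by blast
qed

text \<open>The exchange argument splits a smallest spanning set of W/U into parts for V/U and W/V,
  which gives one inequality; joining spanning sets of the two gives the other.\<close>

lemma
  assumes "qgen U n W" "Vs.subspace U" "Vs.subspace V" "Vs.subspace W" "U \<subseteq> V" "V \<subseteq> W"
  shows qgen_lower: "qgen U n V" and qgen_upper: "qgen V n W"
    and qdim_add: "qdim U W = qdim U V + qdim V W"
proof -
  obtain a b where ab: "a + b \<le> qdim U W" "qgen U a V" "qgen V b W"
    using qgen_split[OF qgen_qdim[OF assms(1)] assms(2-)] by blast
  show "qgen V n W" using qgen_antimono[OF assms(1,5)] .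
  have "a \<le> n" using ab(1) qdim_le[OF assms(1)] by simp
  then show "qgen U n V" using qgen_mono[OF ab(2)] by simp
  have "qdim U W \<le> qdim U V + qdim V W"
    by (rule qdim_le[OF qgen_trans[OF qgen_qdim[OF ab(2)] qgen_qdim[OF ab(3)] assms(6)]])
  then show "qdim U W = qdim U V + qdim V W"
    using ab(1) qdim_le[OF ab(2)] qdim_le[OF ab(3)] by linarith
qed

section \<open>Multiplication as a map between quotients\<close>

lemma mult_span_subset: "(*) a ` Vs.span S \<subseteq> Vs.span ((*) a ` S)"
proof
  fix y assume "y \<in> (*) a ` Vs.span S"
  then obtain f where f: "f \<in> Vs.span S" "y = a * f" by blast
  have "a * f \<in> Vs.span ((*) a ` S)" using f(1)
  proof (induction rule: Vs.span_induct_alt)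
    case base show ?case by (simp add: Vs.span_zero)
  next
    case (step c x y)
    have "a * (cscale c x + y) = cscale c (a * x) + a * y"
      by (simp add: cscale_def distrib_left mult.left_commute)
    then show ?case using step by (simp add: Vs.span_add Vs.span_scale Vs.span_base)
  qed
  then show "y \<in> Vs.span ((*) a ` S)" using f(2) by simp
qed

lemma span_Un_subspace:
  assumes "Vs.subspace U" "y \<in> Vs.span (U \<union> B)"
  obtains u s where "u \<in> U" "s \<in> Vs.span B" "y = u + s"
  using assms unfolding Vs.span_Un Vs.span_eq_iff[THEN iffD2, OF assms(1)] by blast

text \<open>Multiplication by \<open>a\<close> induces a map from W/U to W'/U', which is onto by the
  last assumption.\<close>

lemma qgen_mult_surj:
  assumes "qgen U n W" "(*) a ` U \<subseteq> U'" "(*) a ` W \<subseteq> W'" "W' \<subseteq> U' + (*) a ` W"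
  shows "qgen U' n W'"
proof -
  obtain B where B: "finite B" "card B \<le> n" "B \<subseteq> W" "W \<subseteq> Vs.span (U \<union> B)"
    using assms(1) by (auto simp: qgen_def)
  have "(*) a ` W \<subseteq> Vs.span ((*) a ` (U \<union> B))"
    using B(4) mult_span_subset[of a "U \<union> B"] by blast
  also have "\<dots> \<subseteq> Vs.span (U' \<union> (*) a ` B)" using assms(2) by (intro Vs.span_mono) auto
  finally have 1: "(*) a ` W \<subseteq> Vs.span (U' \<union> (*) a ` B)" .
  have "W' \<subseteq> Vs.span (U' \<union> (*) a ` B)"
  proof
    fix y assume "y \<in> W'"
    then obtain u w where "u \<in> U'" "w \<in> (*) a ` W" "y = u + w"
      using assms(4) by (meson set_plus_elim subsetD)
    then show "y \<in> Vs.span (U' \<union> (*) a ` B)"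
      using 1 by (auto intro!: Vs.span_add intro: Vs.span_base)
  qed
  moreover have "card ((*) a ` B) \<le> n" using card_image_le[OF B(1)] B(2) by (rule order_trans)
  ultimately show ?thesis
    unfolding qgen_def using B(1,3) assms(3) by (intro exI[of _ "(*) a ` B"]) auto
qed

lemma qgen_surj:
  assumes "qgen U n W" "U \<subseteq> U'" "W \<subseteq> W'" "W' \<subseteq> U' + W"
  shows "qgen U' n W'"
  using qgen_mult_surj[of U n W 1 U' W'] assms by simp

text \<open>The last assumption makes the map W/U to W'/U' induced by multiplication with
  \<open>a\<close> injective. A spanning set of its image is lifted to W.\<close>

lemma qgen_mult_inj:
  assumes "qgen U' n W'" "Vs.subspace U" "Vs.subspace W" "Vs.subspace U'" "Vs.subspace W'" "U' \<subseteq> W'"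
    "(*) a ` W \<subseteq> W'" "\<And>w. w \<in> W \<Longrightarrow> a * w \<in> U' \<Longrightarrow> w \<in> U"
  shows "qgen U n W"
proof -
  have subim: "Vs.subspace ((*) a ` W)"
    unfolding Vs.subspace_def
  proof (intro conjI ballI allI)
    show "0 \<in> (*) a ` W" using Vs.subspace_0[OF assms(3)] by force
  next
    fix x y assume "x \<in> (*) a ` W" "y \<in> (*) a ` W"
    then obtain f g where fg: "f \<in> W" "g \<in> W" "x = a * f" "y = a * g" by blast
    have "x + y = a * (f + g)" by (simp add: fg distrib_left)
    then show "x + y \<in> (*) a ` W" using Vs.subspace_add[OF assms(3) fg(1,2)] by blast
  next
    fix c x assume "x \<in> (*) a ` W"
    then obtain f where f: "f \<in> W" "x = a * f" by blast
    have "cscale c x = a * cscale c f" by (simp add: f cscale_def mult.left_commute)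
    then show "cscale c x \<in> (*) a ` W" using Vs.subspace_scale[OF assms(3) f(1)] by blast
  qed
  define V' where "V' = U' + (*) a ` W"
  have V': "Vs.subspace V'" "U' \<subseteq> V'" "V' \<subseteq> W'"
  proof -
    show "Vs.subspace V'" unfolding V'_def set_plus_def
    proof -
      have "{c. \<exists>a'\<in>U'. \<exists>b\<in>(*) a ` W. c = a' + b} = {x + y | x y. x \<in> U' \<and> y \<in> (*) a ` W}" by blast
      then show "Vs.subspace {c. \<exists>a'\<in>U'. \<exists>b\<in>(*) a ` W. c = a' + b}"
        using Vs.subspace_sums[OF assms(4) subim] by simp
    qed
    show "U' \<subseteq> V'" unfolding V'_def by (rule plus_superset1) (use Vs.subspace_0[OF subim] in simp)
    show "V' \<subseteq> W'" unfolding V'_def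
    proof
      fix y assume "y \<in> U' + (*) a ` W"
      then obtain u w where "u \<in> U'" "w \<in> (*) a ` W" "y = u + w" by (rule set_plus_elim)
      then show "y \<in> W'" using assms(6,7) Vs.subspace_add[OF assms(5), of u w] by auto
    qed
  qed
  obtain B where B: "finite B" "card B \<le> n" "B \<subseteq> V'" "V' \<subseteq> Vs.span (U' \<union> B)"
    using qgen_lower[OF assms(1,4) V'(1) assms(5) V'(2,3)] by (auto simp: qgen_def)
  have "\<forall>b\<in>B. \<exists>w. w \<in> W \<and> b - a * w \<in> U'"
    using B(3) unfolding V'_def by (fastforce elim!: set_plus_elim)
  then obtain w where w: "\<And>b. b \<in> B \<Longrightarrow> w b \<in> W" "\<And>b. b \<in> B \<Longrightarrow> b - a * w b \<in> U'" by metis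
  have B2: "Vs.span (U' \<union> B) \<subseteq> Vs.span (U' \<union> (*) a ` (w ` B))"
  proof (rule Vs.span_minimal)
    have "b \<in> Vs.span (U' \<union> (*) a ` (w ` B))" if "b \<in> B" for b
    proof -
      have "(b - a * w b) + a * w b \<in> Vs.span (U' \<union> (*) a ` (w ` B))"
        using w(2)[OF that] that by (intro Vs.span_add Vs.span_base) auto
      then show ?thesis by simp
    qed
    then show "U' \<union> B \<subseteq> Vs.span (U' \<union> (*) a ` (w ` B))" by (auto intro: Vs.span_base)
  qed simp
  have wB: "w ` B \<subseteq> W" using w(1) by blast
  have "W \<subseteq> Vs.span (U \<union> w ` B)"
  proof
    fix f assume f: "f \<in> W"
    have "a * f \<in> V'"
      unfolding V'_def using set_plus_intro[OF Vs.subspace_0[OF assms(4)], of "a * f" "(*) a ` W"] f by simp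
    then have "a * f \<in> Vs.span (U' \<union> (*) a ` (w ` B))" using B(4) B2 by blast
    then obtain u s where us: "u \<in> U'" "s \<in> Vs.span ((*) a ` (w ` B))" "a * f = u + s"
      by (rule span_Un_subspace[OF assms(4)])
    have "(*) a ` Vs.span (w ` B) = Vs.span ((*) a ` (w ` B))"
    proof -
      have "module_hom cscale cscale ((*) a)"
        by (unfold_locales) (simp_all add: cscale_def distrib_left mult.left_commute)
      then show ?thesis by (rule module_hom.span_image[symmetric])
    qed
    then obtain g where g: "g \<in> Vs.span (w ` B)" "s = a * g" using us(2) by blast
    have gW: "g \<in> W" using g(1) Vs.span_minimal[OF wB assms(3)] by blast
    have "a * (f - g) \<in> U'" using us g by (simp add: right_diff_distrib)
    then have "f - g \<in> U" using assms(8) Vs.subspace_diff[OF assms(3) f gW] by blast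
    then have "(f - g) + g \<in> Vs.span (U \<union> w ` B)"
      using g(1) Vs.span_mono[of "w ` B" "U \<union> w ` B"] by (intro Vs.span_add) (auto intro: Vs.span_base)
    then show "f \<in> Vs.span (U \<union> w ` B)" by simp
  qed
  moreover have "card (w ` B) \<le> n" using card_image_le[OF B(1), of w] B(2) by linarith
  ultimately show ?thesis unfolding qgen_def using B(1) wB by (intro exI[of _ "w ` B"]) auto
qed

text \<open>The finitely many monomials of degree below k span the quotient.\<close>

lemma qgen_mpow: "\<exists>n. qgen (mpow k) n (UNIV :: 'n::finite mpoly set)"
proof -
  let ?B = "(\<lambda>\<alpha>. Poly_Mapping.single \<alpha> (1::complex)) ` {\<alpha> :: 'n \<Rightarrow>\<^sub>0 nat. mdeg \<alpha> < k}"
  have "Poly_Mapping.single \<alpha> c \<in> Vs.span (mpow k \<union> ?B)" for \<alpha> c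
  proof (cases "mdeg \<alpha> < k")
    case True
    then have "Poly_Mapping.single \<alpha> 1 \<in> Vs.span (mpow k \<union> ?B)" by (intro Vs.span_base) auto
    then have "cscale c (Poly_Mapping.single \<alpha> 1) \<in> Vs.span (mpow k \<union> ?B)" by (rule Vs.span_scale)
    then show ?thesis by (simp add: cscale_def mpoly_const_def mult_single)
  next
    case False
    then show ?thesis by (intro Vs.span_base UnI1 single_in_mpow) simp
  qed
  then have "(\<Sum>\<alpha>\<in>Poly_Mapping.keys f. Poly_Mapping.single \<alpha> (Poly_Mapping.lookup f \<alpha>)) \<in> Vs.span (mpow k \<union> ?B)" for f
    by (intro Vs.span_sum)
  then have "UNIV \<subseteq> Vs.span (mpow k \<union> ?B)" unfolding mpoly_eq_sum_single[symmetric] by blast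
  then have "qgen (mpow k) (card ?B) (UNIV :: 'n mpoly set)"
    unfolding qgen_def by (intro exI[of _ ?B]) (simp add: finite_mdeg_less)
  then show ?thesis ..
qed

lemma qgen_above_mpow:
  fixes U W :: "'n::finite mpoly set"
  assumes "mpow k \<subseteq> U" "Vs.subspace U" "Vs.subspace W" "U \<subseteq> W"
  shows "\<exists>n. qgen U n W"
proof -
  obtain n where "qgen (mpow k) n (UNIV :: 'n mpoly set)" using qgen_mpow by blast
  then have "qgen U n UNIV" using assms(1) by (rule qgen_antimono)
  then have "qgen U n W" by (rule qgen_lower[OF _ assms(2,3) Vs.subspace_UNIV assms(4) subset_UNIV])
  then show ?thesis ..
qed

section \<open>Linear functionals\<close>

definition lin_functional :: "('n mpoly \<Rightarrow> complex) \<Rightarrow> bool" where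
  "lin_functional q \<longleftrightarrow> Vector_Spaces.linear cscale (*) q"

lemma vector_space_complex: "vector_space ((*) :: complex \<Rightarrow> complex \<Rightarrow> complex)"
  by (rule vector_space.intro) (simp_all add: algebra_simps)

lemma lin_functional_iff:
  "lin_functional q \<longleftrightarrow> (\<forall>f g. q (f + g) = q f + q g) \<and> (\<forall>c f. q (mpoly_const c * f) = c * q f)"
  unfolding lin_functional_def
  by (subst Vector_Spaces.linear_iff) (auto simp: vector_space_cscale vector_space_complex cscale_def)

interpretation VC: vector_space_pair "cscale :: complex \<Rightarrow> 'n mpoly \<Rightarrow> 'n mpoly" "(*) :: complex \<Rightarrow> _"
  by (rule vector_space_pair.intro[OF vector_space_cscale vector_space_complex])

lemma separating_functional:
  assumes "Vs.subspace U" "a \<notin> U"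
  obtains q where "lin_functional q" "\<And>u. u \<in> U \<Longrightarrow> q u = 0" "q a = 1"
proof -
  obtain B where B: "B \<subseteq> U" "Vs.independent B" "U \<subseteq> Vs.span B" by (metis Vs.basis_exists)
  then have span: "Vs.span B = U" using Vs.span_minimal[OF B(1) assms(1)] by blast
  have "Vs.independent (insert a B)" using Vs.independent_insertI[of a B] B(2) span assms(2) by simp
  then obtain g where g: "Vector_Spaces.linear cscale (*) g" "\<forall>x\<in>insert a B. g x = (if x = a then 1 else 0)"
    using VC.linear_independent_extend[of "insert a B" "\<lambda>x. if x = a then 1 else 0"] by metis
  have "g x = 0" if "x \<in> B" for x using g(2) that B(1) assms(2) by auto
  then have "g u = 0" if "u \<in> U" for u
    using VC.linear_eq_0_on_span[OF g(1)] that span by auto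
  then show ?thesis using that[of g] g by (auto simp: lin_functional_def)
qed

section \<open>The theorem of Eakin and Sathaye in dimension one\<close>

text \<open>Numbers the variables, so that the coefficients of \<open>lform t\<close> are distinct
  powers of t.\<close>

definition var_index :: "'n::{finite,linorder} \<Rightarrow> nat" where
  "var_index v = card {w. w < v}"

lemma inj_var_index: "inj var_index"
proof -
  have "var_index v < var_index w" if "v < w" for v w :: "'n::{finite,linorder}"
    unfolding var_index_def by (rule psubset_card_mono) (use that in auto)
  then show ?thesis by (metis (no_types, lifting) injI less_irrefl linorder_neqE)
qed

text \<open>Linear forms on a moment curve, so that any infinite set of them spans all linear forms.\<close>

definition lform :: "complex \<Rightarrow> 'n::{finite,linorder} mpoly" where
  "lform t = (\<Sum>v\<in>UNIV. mpoly_const (t ^ var_index v) * mpoly_var v)"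

lemma lform_in_mpow: "lform t \<in> mpow 1"
  unfolding mpow_1_iff by (simp add: lform_def origin_def)

text \<open>A functional that kills \<open>lform t\<close> for infinitely many t gives a polynomial
  in t with infinitely many roots. Its coefficients are the values of the functional at the
  variables, which therefore vanish.\<close>

lemma lform_span:
  assumes "infinite S"
  obtains F where "finite F" "F \<subseteq> S" "\<And>v :: 'n::{finite,linorder}. mpoly_var v \<in> Id.span (lform ` F)"
proof -
  have vS: "mpoly_var v \<in> Vs.span (lform ` S)" for v :: 'n
  proof (rule ccontr)
    assume "mpoly_var v \<notin> Vs.span (lform ` S)"
    then obtain q where q: "lin_functional q" "\<And>u. u \<in> Vs.span (lform ` S) \<Longrightarrow> q u = 0"
      "q (mpoly_var v) = 1" using separating_functional[OF Vs.subspace_span] by metis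
    have q0: "q 0 = 0" using q(2) Vs.span_zero by blast
    define p where "p = (\<Sum>w\<in>(UNIV :: 'n set). Polynomial.monom (q (mpoly_var w)) (var_index w))"
    have qsum: "q (\<Sum>w\<in>A. f w) = (\<Sum>w\<in>A. q (f w))" if "finite A" for A :: "'n set" and f
      using that q(1) by induction (auto simp: q0 lin_functional_iff)
    have "q (lform t) = poly p t" for t
    proof -
      have "q (lform t) = (\<Sum>w\<in>UNIV. q (mpoly_const (t ^ var_index w) * mpoly_var w))"
        unfolding lform_def by (rule qsum) simp
      also have "\<dots> = poly p t"
        unfolding p_def poly_sum
        by (rule sum.cong[OF refl]) (use q(1) in \<open>simp add: lin_functional_iff poly_monom mult.commute\<close>)
      finally show ?thesis .
    qed
    then have "poly p t = 0" if "t \<in> S" for t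
      using q(2)[OF Vs.span_base[OF imageI[OF that, of lform]]] by simp
    then have "S \<subseteq> {t. poly p t = 0}" by blast
    then have "p = 0" using assms poly_roots_finite[of p] finite_subset by blast
    moreover have "Polynomial.coeff p (var_index v) = q (mpoly_var v)"
      by (simp add: p_def coeff_sum inj_eq[OF inj_var_index])
    ultimately show False using q(3) by simp
  qed
  have "\<exists>T. finite T \<and> T \<subseteq> lform ` S \<and> mpoly_var v \<in> Vs.span T" for v :: 'n
  proof -
    obtain T r where "finite T" "T \<subseteq> lform ` S" "mpoly_var v = (\<Sum>a\<in>T. cscale (r a) a)"
      using vS[of v] unfolding Vs.span_explicit by auto
    moreover from this have "mpoly_var v \<in> Vs.span T"
      by (simp add: Vs.span_sum Vs.span_scale Vs.span_base)
    ultimately show ?thesis by blast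
  qed
  then obtain T where T: "\<And>v::'n. finite (T v) \<and> T v \<subseteq> lform ` S \<and> mpoly_var v \<in> Vs.span (T v)" by metis
  have "finite (\<Union>(range T))" "\<Union>(range T) \<subseteq> lform ` S" using T by auto
  then obtain F where F: "finite F" "F \<subseteq> S" "\<Union>(range T) = lform ` F"
    using finite_subset_image by metis
  have "Vs.span (T v) \<subseteq> Id.span (lform ` F)" for v
    using F(3) Id.span_superset[of "lform ` F"] by (intro Vs.span_minimal) (auto simp: ideal_imp_subspace)
  then show ?thesis using that[OF F(1,2)] T by blast
qed

lemma ideal_mult_image:
  fixes Q :: "'a::comm_ring_1 set"
  assumes "Id.subspace Q"
  shows "Id.subspace ((*) a ` Q)"
  unfolding Id.subspace_def
proof (intro conjI ballI allI)
  show "0 \<in> (*) a ` Q" using Id.subspace_0[OF assms] by force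
next
  fix x y assume "x \<in> (*) a ` Q" "y \<in> (*) a ` Q"
  then show "x + y \<in> (*) a ` Q" using Id.subspace_add[OF assms] by (auto simp flip: distrib_left)
next
  fix c x assume "x \<in> (*) a ` Q"
  then show "c * x \<in> (*) a ` Q" using Id.subspace_scale[OF assms] by (auto simp: mult.left_commute)
qed

text \<open>Induction on j, where the multiplier \<open>u\<close> is there so that the induction
  hypothesis applies to \<open>lform t' * u\<close>. If infinitely many t fail, then for each
  failing t' the submodule obtained from \<open>lform t' * u\<close> is proper, hence of length at
  most j over N, and almost every t is good for it. Finitely many failing t' already span all linear
  forms; a failing t that is good for all of these captures the whole left-hand side, contradicting
  its failure.\<close>

lemma eakin_sathaye:
  fixes N :: "'n::{finite,linorder} mpoly set"
  assumes N: "ideal_of N" and "qgen N (Suc j) ((*) u ` mpow (Suc j) + N)"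
  shows "finite {t. \<not> (*) u ` mpow (Suc j) + N \<subseteq> (*) (lform t * u) ` mpow j + N}"
proof -
  define M where "M u j = (*) u ` mpow j + N" for u j
  have idM [simp]: "ideal_of (M u j)" for u j
    unfolding M_def by (intro ideal_plus ideal_mult_image ideal_mpow N)
  have NM: "N \<subseteq> M u j" for u j
    unfolding M_def by (rule plus_superset2) (use Id.subspace_0[OF ideal_mult_image[OF ideal_mpow]] in simp)
  have inM: "u * f \<in> M u j" if "f \<in> mpow j" for u f j
    unfolding M_def using set_plus_intro[OF imageI[OF that, of "(*) u"] Id.subspace_0[OF N]] by simp
  have M_min: "M u j \<subseteq> Q" if "ideal_of Q" "N \<subseteq> Q" "\<And>f. f \<in> mpow j \<Longrightarrow> u * f \<in> Q" for u j Q
    unfolding M_def by (rule plus_ideal_minimal[OF that(1)]) (use that in auto)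
  have Mlf: "M (lform t * u) j \<subseteq> M u (Suc j)" for t u j
  proof (rule M_min[OF idM NM])
    fix f :: "'n mpoly" assume "f \<in> mpow j"
    then have "lform t * f \<in> mpow (Suc j)" using mpow_mult[OF lform_in_mpow] by force
    then show "lform t * u * f \<in> M u (Suc j)" using inM[of "lform t * f" "Suc j" u] by (simp add: ac_simps)
  qed
  have main: "finite {t. \<not> M u (Suc j) \<subseteq> M (lform t * u) j}"
    if gen: "qgen N (Suc j) (M u (Suc j))"
      and step: "\<And>t'. qgen N j (M (lform t' * u) j) \<Longrightarrow> finite {t. \<not> M (lform t' * u) j \<subseteq> M (lform t * u) j}"
    for u j
  proof (rule ccontr)
    define S where "S = {t. \<not> M u (Suc j) \<subseteq> M (lform t * u) j}"
    assume "infinite {t. \<not> M u (Suc j) \<subseteq> M (lform t * u) j}"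
    then have inf: "infinite S" by (simp add: S_def)
    have fin: "finite {t. \<not> M (lform t' * u) j \<subseteq> M (lform t * u) j}" if t': "t' \<in> S" for t'
    proof (rule step)
      note sub = ideal_imp_subspace[OF N] ideal_imp_subspace[OF idM] ideal_imp_subspace[OF idM] NM Mlf[of t' u j]
      have "\<not> qgen (M (lform t' * u) j) 0 (M u (Suc j))"
        using t' by (simp add: S_def qgen_0_iff ideal_imp_subspace)
      then have "qdim (M (lform t' * u) j) (M u (Suc j)) \<noteq> 0"
        using qgen_qdim[OF qgen_upper[OF gen sub]] by metis
      then have "qdim N (M (lform t' * u) j) \<le> j"
        using qdim_add[OF gen sub] qdim_le[OF gen] by simp
      then show "qgen N j (M (lform t' * u) j)"
        using qgen_mono[OF qgen_qdim[OF qgen_lower[OF gen sub]]] by blast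
    qed
    obtain F where F: "finite F" "F \<subseteq> S" "\<And>v :: 'n. mpoly_var v \<in> Id.span (lform ` F)"
      using lform_span[OF inf] by metis
    have "finite (\<Union>t'\<in>F. {t. \<not> M (lform t' * u) j \<subseteq> M (lform t * u) j})"
      using F(1,2) fin by (intro finite_UN_I) auto
    then obtain t where t: "t \<in> S" "\<And>t'. t' \<in> F \<Longrightarrow> M (lform t' * u) j \<subseteq> M (lform t * u) j"
      using inf by (metis (mono_tags, lifting) UN_I finite_subset mem_Collect_eq subsetI)
    \<comment> \<open>These multipliers form an ideal. It contains \<open>lform t'\<close> for all
      t' in F and therefore every variable.\<close>
    let ?A = "{p. \<forall>g\<in>mpow j. u * (p * g) \<in> M (lform t * u) j}"
    have idA: "ideal_of ?A"
      unfolding Id.subspace_def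
    proof (intro conjI ballI allI; clarsimp)
      show "0 \<in> M (lform t * u) j" by (rule Id.subspace_0[OF idM])
    next
      fix a b g :: "'n mpoly" assume "\<forall>g\<in>mpow j. u * (a * g) \<in> M (lform t * u) j" "\<forall>g\<in>mpow j. u * (b * g) \<in> M (lform t * u) j"
        "g \<in> mpow j"
      then have "u * (a * g) + u * (b * g) \<in> M (lform t * u) j" by (intro Id.subspace_add[OF idM]) auto
      then show "u * ((a + b) * g) \<in> M (lform t * u) j" by (simp add: distrib_left distrib_right)
    next
      fix c a g :: "'n mpoly" assume "\<forall>g\<in>mpow j. u * (a * g) \<in> M (lform t * u) j" "g \<in> mpow j"
      then have "c * (u * (a * g)) \<in> M (lform t * u) j" by (simp add: Id.subspace_scale[OF idM])
      then show "u * (c * a * g) \<in> M (lform t * u) j" by (simp add: ac_simps)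
    qed
    have "lform t' \<in> ?A" if "t' \<in> F" for t'
    proof clarify
      fix g :: "'n mpoly" assume "g \<in> mpow j"
      then have "lform t' * u * g \<in> M (lform t' * u) j" by (rule inM)
      then show "u * (lform t' * g) \<in> M (lform t * u) j" using t(2)[OF that] by (auto simp: ac_simps)
    qed
    then have "Id.span (lform ` F) \<subseteq> ?A" by (intro Id.span_minimal[OF _ idA]) auto
    then have vA: "mpoly_var v \<in> ?A" for v using F(3)[of v] by (rule subsetD)
    let ?B = "{f. u * f \<in> M (lform t * u) j}"
    have "ideal_of ?B"
      unfolding Id.subspace_def
    proof (intro conjI ballI allI; clarsimp)
      show "0 \<in> M (lform t * u) j" by (rule Id.subspace_0[OF idM])
    next
      fix a b :: "'n mpoly" assume "u * a \<in> M (lform t * u) j" "u * b \<in> M (lform t * u) j"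
      then show "u * (a + b) \<in> M (lform t * u) j" by (simp add: distrib_left Id.subspace_add[OF idM])
    next
      fix c a :: "'n mpoly" assume "u * a \<in> M (lform t * u) j"
      then show "u * (c * a) \<in> M (lform t * u) j"
        using Id.subspace_scale[OF idM, of "u * a" _ _ c] by (simp add: mult.left_commute)
    qed
    moreover have "{mpoly_var v * f | v f. f \<in> mpow j} \<subseteq> ?B" using vA by auto
    ultimately have "mpow (Suc j) \<subseteq> ?B" unfolding mpow_Suc_eq by (intro Id.span_minimal)
    then have "M u (Suc j) \<subseteq> M (lform t * u) j" by (intro M_min[OF idM NM]) auto
    then show False using t(1) by (simp add: S_def)
  qed
  show ?thesis using assms(2)
  proof (induction j arbitrary: u)
    case (0 u)
    have "M (lform t' * u) 0 \<subseteq> M (lform t * u) 0" if "qgen N 0 (M (lform t' * u) 0)" for t t'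
      using that NM[of "lform t * u" 0] by (auto simp: qgen_0_iff ideal_imp_subspace[OF N])
    then show ?case using main[of 0 u] 0 by (simp add: M_def)
  next
    case (Suc j u)
    have "finite {t. \<not> M (lform t' * u) (Suc j) \<subseteq> M (lform t * u) (Suc j)}"
      if gen: "qgen N (Suc j) (M (lform t' * u) (Suc j))" for t'
    proof (rule finite_subset)
      show "finite {t. \<not> M (lform t' * u) (Suc j) \<subseteq> M (lform t * (lform t' * u)) j}"
        using Suc.IH[of "lform t' * u"] gen unfolding M_def by blast
      \<comment> \<open>The induction hypothesis ends in a multiple of both forms; the extra factor
        \<open>lform t'\<close> raises the order by one and is absorbed in the power of the maximal
        ideal.\<close>
      have "M (lform t * (lform t' * u)) j \<subseteq> M (lform t * u) (Suc j)" for t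
        using Mlf[of t' "lform t * u" j] by (simp add: mult.left_commute)
      then show "{t. \<not> M (lform t' * u) (Suc j) \<subseteq> M (lform t * u) (Suc j)} \<subseteq>
        {t. \<not> M (lform t' * u) (Suc j) \<subseteq> M (lform t * (lform t' * u)) j}" by blast
    qed
    then show ?case using main[of "Suc j" u] Suc.prems unfolding M_def by blast
  qed
qed

section \<open>The local Hilbert function\<close>

text \<open>Computed inside the polynomial ring: modulo a power of the maximal ideal localization
  changes nothing. \<open>hilbert_fun_eq\<close> makes the connection with the local ring.\<close>

definition hilb :: "'n::finite mpoly set \<Rightarrow> nat \<Rightarrow> nat" where
  "hilb Q k = qdim (Q + mpow (Suc k)) (Q + mpow k)"

definition hilb_sum :: "'n::finite mpoly set \<Rightarrow> nat \<Rightarrow> nat" where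
  "hilb_sum Q k = qdim (Q + mpow k) UNIV"

lemma zero_in_ideal: "Id.subspace Q \<Longrightarrow> 0 \<in> Q"
  by (rule Id.subspace_0)

lemma mpow_subset_plus: "ideal_of Q \<Longrightarrow> mpow k \<subseteq> Q + mpow k"
  by (rule plus_superset2[OF zero_in_ideal])

lemma subset_plus_mpow: "Q \<subseteq> Q + mpow k"
  by (rule plus_superset1[OF zero_in_ideal[OF ideal_mpow]])

lemma sub_plus_mpow: "ideal_of Q \<Longrightarrow> Vs.subspace (Q + mpow k)"
  by (intro ideal_imp_subspace ideal_plus ideal_mpow)

lemma plus_mpow_antimono: "i \<le> j \<Longrightarrow> Q + mpow j \<subseteq> Q + mpow i"
  by (intro set_plus_mono2 order_refl mpow_antimono)

lemma qgen_plus_mpow: "ideal_of Q \<Longrightarrow> \<exists>n. qgen (Q + mpow k) n (UNIV :: 'n::finite mpoly set)"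
  by (rule qgen_above_mpow[OF mpow_subset_plus sub_plus_mpow]) auto

lemma qgen_fin:
  fixes U W :: "'n::finite mpoly set"
  assumes "ideal_of Q" "Q + mpow k \<subseteq> U" "Vs.subspace U" "Vs.subspace W" "U \<subseteq> W"
  shows "\<exists>n. qgen U n W"
  by (rule qgen_above_mpow[OF order_trans[OF mpow_subset_plus[OF assms(1)] assms(2)] assms(3-5)])

lemma hilb_sum_Suc:
  assumes "ideal_of Q"
  shows "hilb_sum Q (Suc k) = hilb_sum Q k + hilb Q k"
proof -
  obtain n where "qgen (Q + mpow (Suc k)) n UNIV" using qgen_plus_mpow[OF assms] by blast
  from qdim_add[OF this sub_plus_mpow[OF assms] sub_plus_mpow[OF assms] Vs.subspace_UNIV plus_mpow_antimono, of k]
  show ?thesis by (simp add: hilb_sum_def hilb_def)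
qed

lemma hilb_sum_0 [simp]: "hilb_sum Q 0 = 0" if "ideal_of Q"
proof -
  have "Q + mpow 0 = UNIV" using mpow_subset_plus[OF that, of 0] by auto
  then have "qgen (Q + mpow 0) 0 UNIV" unfolding qgen_0_iff[OF sub_plus_mpow[OF that]] by simp
  then show ?thesis using qdim_le by (fastforce simp: hilb_sum_def)
qed

lemma hilb_sum_eq: "ideal_of Q \<Longrightarrow> hilb_sum Q k = (\<Sum>i<k. hilb Q i)"
  by (induction k) (auto simp: hilb_sum_Suc)

lemma qgen_hilb: "ideal_of Q \<Longrightarrow> qgen (Q + mpow (Suc k)) (hilb Q k) (Q + mpow (k :: nat))"
  unfolding hilb_def
  using qgen_fin[OF _ order_refl sub_plus_mpow sub_plus_mpow plus_mpow_antimono] qgen_qdim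
  by (metis le_Suc_eq order_refl)

text \<open>For l in the maximal ideal: in the associated graded ring of R/Q, multiplication by the
  degree one class of l maps degree i onto degree i + 1.\<close>

definition surj_at :: "'n::finite mpoly set \<Rightarrow> 'n mpoly \<Rightarrow> nat \<Rightarrow> bool" where
  "surj_at Q l i \<longleftrightarrow> mpow (Suc i) \<subseteq> (Q + mpow (Suc (Suc i))) + (*) l ` mpow i"

text \<open>The associated graded ring is generated in degree one, so surjectivity propagates
  upwards.\<close>

lemma surj_at_Suc:
  fixes Q :: "'n::finite mpoly set"
  assumes Q: "ideal_of Q" and "surj_at Q l i"
  shows "surj_at Q l (Suc i)"
  unfolding surj_at_def mpow_Suc_eq[of "Suc i"]
proof (rule Id.span_minimal)
  show "ideal_of (Q + mpow (Suc (Suc (Suc i))) + (*) l ` mpow (Suc i))"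
    by (intro ideal_plus ideal_mult_image ideal_mpow Q)
  show "{mpoly_var v * f | v f. f \<in> mpow (Suc i)} \<subseteq> Q + mpow (Suc (Suc (Suc i))) + (*) l ` mpow (Suc i)"
  proof clarify
    fix v :: 'n and f :: "'n mpoly" assume "f \<in> mpow (Suc i)"
    then obtain a y where "a \<in> Q + mpow (Suc (Suc i))" "y \<in> (*) l ` mpow i" "f = a + y"
      using assms(2) unfolding surj_at_def by (meson set_plus_elim subsetD)
    then obtain q b c where qbc: "q \<in> Q" "b \<in> mpow (Suc (Suc i))" "c \<in> mpow i" "f = (q + b) + l * c"
      by (auto elim!: set_plus_elim)
    have "mpoly_var v * f = (mpoly_var v * q + mpoly_var v * b) + l * (mpoly_var v * c)"
      by (simp add: qbc(4) distrib_left mult.left_commute)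
    moreover have "mpoly_var v * q \<in> Q" using Id.subspace_scale[OF Q qbc(1)] .
    moreover have "mpoly_var v * b \<in> mpow (Suc (Suc (Suc i)))" using mpow_mult[OF var_in_mpow qbc(2)] by simp
    moreover have "mpoly_var v * c \<in> mpow (Suc i)" using mpow_mult[OF var_in_mpow qbc(3)] by simp
    ultimately show "mpoly_var v * f \<in> Q + mpow (Suc (Suc (Suc i))) + (*) l ` mpow (Suc i)"
      by (metis imageI set_plus_intro)
  qed
qed

lemma surj_at_mono: "ideal_of Q \<Longrightarrow> surj_at Q l i \<Longrightarrow> i \<le> j \<Longrightarrow> surj_at Q l j"
  by (induction j) (auto simp: le_Suc_eq surj_at_Suc)

lemma surj_at_hilb_le:
  fixes Q :: "'n::finite mpoly set"
  assumes Q: "ideal_of Q" and l: "l \<in> mpow 1" and "surj_at Q l i"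
  shows "hilb Q (Suc i) \<le> hilb Q i"
  unfolding hilb_def[of Q "Suc i"]
proof (rule qdim_le, rule qgen_mult_surj[OF qgen_hilb[OF Q]])
  have mult: "(*) l ` (Q + mpow k) \<subseteq> Q + mpow (Suc k)" for k
  proof clarify
    fix y assume "y \<in> Q + mpow k"
    then obtain q b where "q \<in> Q" "b \<in> mpow k" "y = q + b" by (rule set_plus_elim)
    then show "l * y \<in> Q + mpow (Suc k)"
      using Id.subspace_scale[OF Q, of q l] mpow_mult[OF l, of b k] by (auto simp: distrib_left)
  qed
  show "(*) l ` (Q + mpow (Suc i)) \<subseteq> Q + mpow (Suc (Suc i))"
    "(*) l ` (Q + mpow i) \<subseteq> Q + mpow (Suc i)" by (rule mult)+
  have id: "ideal_of ((Q + mpow (Suc (Suc i))) + (*) l ` (Q + mpow i))"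
    by (intro ideal_plus ideal_mult_image ideal_mpow Q)
  have le: "(Q + mpow (Suc (Suc i))) + (*) l ` mpow i \<subseteq> (Q + mpow (Suc (Suc i))) + (*) l ` (Q + mpow i)"
    by (intro set_plus_mono2 order_refl image_mono mpow_subset_plus Q)
  have "Q \<subseteq> (Q + mpow (Suc (Suc i))) + (*) l ` (Q + mpow i)"
    by (rule order_trans[OF subset_plus_mpow plus_superset1])
      (intro zero_in_ideal ideal_mult_image ideal_plus ideal_mpow Q)
  then show "Q + mpow (Suc i) \<subseteq> (Q + mpow (Suc (Suc i))) + (*) l ` (Q + mpow i)"
    using assms(3) le unfolding surj_at_def by (intro plus_ideal_minimal[OF id]) auto
qed

text \<open>Eakin-Sathaye with u = 1 and N = Q + m^(j+1) gives surjectivity already out of degree j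
  - 1; moving up one degree makes the statement uniform, as there is nothing below j = 0. For j = 0
  the ideal Q is locally the unit ideal and l = 0 works.\<close>

lemma small_hilb_surj:
  fixes Q :: "'n::{finite,linorder} mpoly set"
  assumes Q: "ideal_of Q" and small: "hilb Q j \<le> j"
  obtains l where "l \<in> mpow 1" "surj_at Q l j"
proof (cases j)
  case 0
  have "qgen (Q + mpow (Suc 0)) 0 (Q + mpow 0)" using qgen_hilb[OF Q, of 0] small 0 by simp
  then have "Q + mpow 0 \<subseteq> Q + mpow (Suc 0)" using qgen_0_iff[OF sub_plus_mpow[OF Q]] by blast
  then have "mpow 0 \<subseteq> Q + mpow (Suc 0)" using mpow_subset_plus[OF Q, of 0] by blast
  then obtain q b where qb: "q \<in> Q" "b \<in> mpow 1" "1 = q + b"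
  proof -
    have "1 \<in> Q + mpow (Suc 0)" using \<open>mpow 0 \<subseteq> Q + mpow (Suc 0)\<close> by auto
    then show ?thesis using that by (elim set_plus_elim) simp
  qed
  have "surj_at Q 0 0"
    unfolding surj_at_def
  proof
    fix f :: "'n mpoly" assume f: "f \<in> mpow (Suc 0)"
    have "f = (f * q + f * b) + 0 * 1" by (simp flip: distrib_left qb(3))
    moreover have "f * q \<in> Q" using Id.subspace_scale[OF Q qb(1)] .
    moreover have "f * b \<in> mpow (Suc (Suc 0))" using mpow_mult[OF f qb(2)] by simp
    ultimately show "f \<in> Q + mpow (Suc (Suc 0)) + (*) 0 ` mpow 0"
      by (metis UNIV_I imageI mpow_0 set_plus_intro)
  qed
  then show ?thesis using that[of 0] 0 by (simp add: mpow_iff)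
next
  case (Suc i)
  let ?N = "Q + mpow (Suc j)"
  have N: "ideal_of ?N" by (intro ideal_plus Q ideal_mpow)
  have "(*) 1 ` mpow (Suc i) + ?N = Q + mpow j"
  proof
    have "(*) (1 :: 'n mpoly) ` mpow (Suc i) = mpow j" using Suc by simp
    moreover have "?N \<subseteq> Q + mpow j" by (rule plus_mpow_antimono) simp
    ultimately show "(*) 1 ` mpow (Suc i) + ?N \<subseteq> Q + mpow j"
      using plus_ideal_minimal[of "Q + mpow j" "mpow j" ?N] mpow_subset_plus[OF Q, of j]
      by (simp add: Q)
    have "Q + mpow j \<subseteq> mpow j + ?N"
      by (subst add.commute) (intro set_plus_mono2 order_refl subset_plus_mpow)
    then show "Q + mpow j \<subseteq> (*) 1 ` mpow (Suc i) + ?N" using Suc by simp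
  qed
  then have "qgen ?N (Suc i) ((*) 1 ` mpow (Suc i) + ?N)"
    using qgen_mono[OF qgen_hilb[OF Q] small] Suc by simp
  from eakin_sathaye[OF N this]
  have "finite {t. \<not> (*) 1 ` mpow (Suc i) + ?N \<subseteq> (*) (lform t * 1) ` mpow i + ?N}" .
  then obtain t where t: "(*) 1 ` mpow (Suc i) + ?N \<subseteq> (*) (lform t * 1) ` mpow i + ?N"
    using infinite_UNIV_char_0[where 'a = complex] by (metis (mono_tags, lifting) UNIV_eq_I mem_Collect_eq)
  have "mpow (Suc i) \<subseteq> (*) 1 ` mpow (Suc i) + ?N"
    using plus_superset1[OF zero_in_ideal[OF N], of "mpow (Suc i)"] by simp
  then have "surj_at Q (lform t) i"
    using t Suc by (simp add: surj_at_def add.commute)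
  then have "surj_at Q (lform t) j" using surj_at_Suc[OF Q] Suc by simp
  then show ?thesis using that lform_in_mpow by blast
qed

lemma small_hilb_antimono:
  fixes Q :: "'n::{finite,linorder} mpoly set"
  assumes Q: "ideal_of Q" and small: "hilb Q j \<le> j" and "j \<le> i" "i \<le> i'"
  shows "hilb Q i' \<le> hilb Q i"
proof -
  obtain l where l: "l \<in> mpow 1" "surj_at Q l j" using small_hilb_surj[OF Q small] .
  have "hilb Q (Suc k) \<le> hilb Q k" if "j \<le> k" for k
    using surj_at_hilb_le[OF Q l(1)] surj_at_mono[OF Q l(2) that] by blast
  then show ?thesis using assms(4)
  proof (induction i')
    case (Suc i')
    show ?case
    proof (cases "i = Suc i'")
      case False
      then have "i \<le> i'" using Suc.prems(2) by simp
      then show ?thesis using Suc.IH[OF Suc.prems(1)] Suc.prems(1)[of i'] assms(3) by linarith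
    qed simp
  qed simp
qed

lemma antimono_nat_eventually_const:
  fixes h :: "nat \<Rightarrow> nat"
  assumes "\<And>i i'. j \<le> i \<Longrightarrow> i \<le> i' \<Longrightarrow> h i' \<le> h i"
  shows "\<exists>n e. \<forall>k\<ge>n. h k = e"
proof -
  obtain n where n: "n \<ge> j" "\<And>k. k \<ge> j \<Longrightarrow> h n \<le> h k"
    using ex_has_least_nat[of "\<lambda>k. k \<ge> j" j h] by auto
  then have "\<forall>k\<ge>n. h k = h n" using assms by (meson dual_order.antisym order_trans)
  then show ?thesis by blast
qed

lemma mono_bounded_nat_eventually_const:
  fixes h :: "nat \<Rightarrow> nat"
  assumes "incseq h" "\<And>k. h k \<le> C"
  shows "\<exists>n. \<forall>k\<ge>n. h k = h n"
proof -
  have "\<exists>n e. \<forall>k\<ge>n. C - h k = e"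
    by (rule antimono_nat_eventually_const[of 0]) (use assms(1) in \<open>auto simp: incseq_def diff_le_mono2\<close>)
  then obtain n e where "\<forall>k\<ge>n. C - h k = e" by blast
  then have "\<forall>k\<ge>n. h k = h n" using assms(2) by (metis diff_diff_cancel order_refl)
  then show ?thesis ..
qed

section \<open>Powers of a parameter and the growth of the Hilbert function\<close>

definition principal :: "'a::comm_ring_1 \<Rightarrow> 'a set" where
  "principal a = range ((*) a)"

lemma ideal_principal [simp]: "Id.subspace (principal a)"
  unfolding principal_def by (rule ideal_mult_image) simp

lemma in_plus_principal: "f \<in> Q + principal a \<longleftrightarrow> (\<exists>q r. q \<in> Q \<and> f = q + a * r)"
  unfolding principal_def by (auto elim!: set_plus_elim)

lemma in_loc_plus_principal:
  "f \<in> loc (Q + principal a) \<longleftrightarrow> (\<exists>g q r. mpoly_eval origin g \<noteq> 0 \<and> q \<in> Q \<and> g * f = q + a * r)"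
  by (auto simp: loc_def in_plus_principal)

lemma mpow_add_eq:
  "mpow (i + j) = Id.span {a * b | a b. a \<in> mpow i \<and> b \<in> (mpow j :: 'n::finite mpoly set)}" (is "_ = Id.span (?S i)")
proof
  show "Id.span (?S i) \<subseteq> mpow (i + j)"
    using mpow_mult by (intro Id.span_minimal) auto
  show "mpow (i + j) \<subseteq> Id.span (?S i)"
  proof (induction i)
    case 0
    have "b \<in> ?S 0" if "b \<in> mpow j" for b :: "'n mpoly"
      by (rule CollectI, rule exI[of _ 1], rule exI[of _ b]) (simp add: that)
    then show ?case using Id.span_superset[of "?S 0"] by auto
  next
    case (Suc i)
    have "mpoly_var v * f \<in> Id.span (?S (Suc i))" if "f \<in> Id.span (?S i)" for v :: 'n and f
      using that
    proof (induction rule: Id.span_induct_alt)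
      case base show ?case by (simp add: Id.span_zero)
    next
      case (step c x y)
      then obtain a b where ab: "x = a * b" "a \<in> mpow i" "b \<in> mpow j" by blast
      have "mpoly_var v * x \<in> ?S (Suc i)"
        using ab mpow_mult[OF var_in_mpow[of v] ab(2)] by (auto simp flip: mult.assoc)
      then have "c * (mpoly_var v * x) + mpoly_var v * y \<in> Id.span (?S (Suc i))"
        using step(2) by (intro Id.span_add[OF Id.span_scale[OF Id.span_base]])
      then show ?case by (simp add: distrib_left mult.left_commute)
    qed
    then show ?case unfolding add_Suc mpow_Suc_eq[of "i + j"]
      using Suc by (intro Id.span_minimal) auto
  qed
qed

text \<open>A parameter \<open>x\<close> for the local ring of \<open>I\<close>: modulo \<open>x\<close> that ring has finite length.\<close>

locale local_param =
  fixes I :: "'n::{finite,linorder} mpoly set" and x :: "'n mpoly" and n :: nat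
  assumes I: "ideal_of I" and x: "x \<in> mpow 1" and param: "mpow n \<subseteq> loc (I + principal x)"
begin

text \<open>The relations for m^n and m^(n k) are multiplied; the powers of x add up.\<close>

lemma mpow_loc_power: "mpow (n * k) \<subseteq> loc (I + principal (x ^ k))"
proof (induction k)
  case 0
  have "f \<in> loc (I + principal (x ^ 0))" for f :: "'n mpoly"
    unfolding in_loc_plus_principal
    by (intro exI[of _ 1] exI[of _ 0] exI[of _ f]) (simp add: zero_in_ideal[OF I])
  then show ?case by blast
next
  case (Suc k)
  have "a * b \<in> loc (I + principal (x ^ Suc k))" if ab: "a \<in> mpow n" "b \<in> mpow (n * k)" for a b
  proof -
    obtain g q r where g: "mpoly_eval origin g \<noteq> 0" "q \<in> I" "g * a = q + x * r"
      using subsetD[OF param ab(1)] unfolding in_loc_plus_principal by blast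
    obtain h p s where h: "mpoly_eval origin h \<noteq> 0" "p \<in> I" "h * b = p + x ^ k * s"
      using subsetD[OF Suc ab(2)] unfolding in_loc_plus_principal by blast
    have "(g * h) * (a * b) = (g * a) * (h * b)" by (simp add: ac_simps)
    also have "\<dots> = ((h * b) * q + (x * r) * p) + x ^ Suc k * (r * s)"
      unfolding g(3) h(3) by (simp add: distrib_left distrib_right ac_simps)
    finally have "(g * h) * (a * b) = ((h * b) * q + (x * r) * p) + x ^ Suc k * (r * s)" .
    moreover have "(h * b) * q + (x * r) * p \<in> I"
      by (rule Id.subspace_add[OF I Id.subspace_scale[OF I g(2)] Id.subspace_scale[OF I h(2)]])
    moreover have "mpoly_eval origin (g * h) \<noteq> 0" using g(1) h(1) by simp
    ultimately show ?thesis unfolding in_loc_plus_principal by blast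
  qed
  then have "{a * b | a b. a \<in> mpow n \<and> b \<in> mpow (n * k)} \<subseteq> loc (I + principal (x ^ Suc k))" by blast
  then show ?case unfolding mult_Suc_right mpow_add_eq[of n "n * k"]
    by (intro Id.span_minimal ideal_loc ideal_plus I ideal_principal)
qed

text \<open>The length of the local ring modulo x, finite because a power of the maximal ideal
  vanishes there.\<close>

definition c :: nat where "c = qdim (loc (I + principal x)) UNIV"

lemma id_loc_power: "ideal_of (loc (I + principal (x ^ k)))"
  by (intro ideal_loc ideal_plus I ideal_principal)

lemma qgen_loc: "qgen (loc (I + principal x)) c UNIV"
proof -
  have "\<exists>m. qgen (loc (I + principal x)) m UNIV"
    using id_loc_power[of 1] by (intro qgen_above_mpow[OF param]) (auto simp: ideal_imp_subspace)
  then show ?thesis unfolding c_def using qgen_qdim by blast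
qed

text \<open>Filtration by powers of x: multiplication by x maps the quotient modulo x^k onto the
  ideal of x modulo x^(k+1), and what remains is the quotient modulo x, of length
  \<open>c\<close>.\<close>

lemma qgen_loc_power: "qgen (loc (I + principal (x ^ k))) (k * c) UNIV"
proof (induction k)
  case 0
  have "UNIV \<subseteq> loc (I + principal (x ^ 0))" using mpow_loc_power[of 0] by simp
  then show ?case by (simp add: qgen_0_iff ideal_imp_subspace[OF id_loc_power[of 0], simplified])
next
  case (Suc k)
  define A where "A = loc (I + principal (x ^ Suc k))"
  have idA: "ideal_of A" unfolding A_def by (rule id_loc_power)
  have 1: "qgen A (k * c) (A + principal x)"
  proof (rule qgen_mult_surj[OF Suc])
    show "(*) x ` loc (I + principal (x ^ k)) \<subseteq> A"
    proof clarify
      fix f assume "f \<in> loc (I + principal (x ^ k))"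
      then obtain g q r where g: "mpoly_eval origin g \<noteq> 0" "q \<in> I" "g * f = q + x ^ k * r"
        unfolding in_loc_plus_principal by blast
      have "g * (x * f) = x * (g * f)" by (rule mult.left_commute)
      also have "\<dots> = x * q + x ^ Suc k * r" unfolding g(3) by (simp add: distrib_left mult.assoc)
      finally show "x * f \<in> A"
        unfolding A_def in_loc_plus_principal using g(1) Id.subspace_scale[OF I g(2)] by blast
    qed
    show "(*) x ` UNIV \<subseteq> A + principal x"
      unfolding principal_def by (rule plus_superset2[OF zero_in_ideal[OF idA]])
    show "A + principal x \<subseteq> A + (*) x ` UNIV" by (simp add: principal_def)
  qed
  \<comment> \<open>\<open>A\<close> contains a power of the maximal ideal, so the sum with (x) is
    already its own contraction.\<close>
  have "loc (A + principal x) = A + principal x"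
  proof (rule loc_eq_if_mpow_subset)
    show "ideal_of (A + principal x)" by (intro ideal_plus idA ideal_principal)
    show "mpow (n * Suc k) \<subseteq> A + principal x"
      using mpow_loc_power[of "Suc k"] plus_superset1[OF zero_in_ideal[OF ideal_principal], of A x]
      unfolding A_def by (rule order_trans)
  qed
  moreover have "I \<subseteq> A"
    unfolding A_def using loc_superset plus_superset1[OF zero_in_ideal[OF ideal_principal], of I] by (rule order_trans[rotated])
  then have "loc (I + principal x) \<subseteq> loc (A + principal x)"
    by (intro loc_mono set_plus_mono2 order_refl)
  ultimately have "qgen (A + principal x) c UNIV" using qgen_antimono[OF qgen_loc] by simp
  from qgen_trans[OF 1 this] show ?case by (simp add: A_def add.commute)
qed

text \<open>Since x^k lies in m^k, the length modulo m^k is at most the length modulo x^k, which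
  grows at most linearly.\<close>

lemma hilb_sum_le: "hilb_sum I k \<le> k * c"
proof -
  have "loc (I + principal (x ^ k)) \<subseteq> I + mpow k"
  proof -
    have "I + principal (x ^ k) \<subseteq> I + mpow k"
      unfolding principal_def using Id.subspace_scale[OF ideal_mpow power_in_mpow[OF x]]
      by (intro set_plus_mono2 order_refl) (auto simp: mult.commute)
    then have "loc (I + principal (x ^ k)) \<subseteq> loc (I + mpow k)" by (rule loc_mono)
    also have "\<dots> = I + mpow k"
      by (rule loc_eq_if_mpow_subset[OF _ mpow_subset_plus[OF I]]) (intro ideal_plus I ideal_mpow)
    finally show ?thesis .
  qed
  then show ?thesis unfolding hilb_sum_def by (rule qdim_le[OF qgen_antimono[OF qgen_loc_power]])
qed

text \<open>Values that always stay above the diagonal would make the partial sums grow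
  quadratically, against the linear bound. Once on or below the diagonal, the Hilbert function no
  longer increases.\<close>

theorem hilb_eventually_const: "\<exists>k0 e. \<forall>k\<ge>k0. hilb I k = e"
proof -
  have "\<exists>j. hilb I j \<le> j"
  proof (rule ccontr)
    assume "\<not> ?thesis"
    then have "Suc j \<le> hilb I j" for j by (simp add: not_le Suc_le_eq)
    then have "(\<Sum>j<k. Suc j) \<le> hilb_sum I k" for k unfolding hilb_sum_eq[OF I] by (intro sum_mono)
    moreover have "2 * (\<Sum>j<k. Suc j) = k * Suc k" for k by (induction k) auto
    ultimately have "k * Suc k \<le> 2 * (k * c)" for k using hilb_sum_le[of k] by (metis mult_le_mono2 order_trans)
    from this[of "2 * c + 1"] show False by (simp add: algebra_simps)
  qed
  then obtain j where "hilb I j \<le> j" ..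
  from small_hilb_antimono[OF I this] show ?thesis by (rule antimono_nat_eventually_const)
qed

end

text \<open>Over an ideal \<open>J\<close> modulo which \<open>x\<close> is not a zero divisor the Hilbert function never exceeds
  its final value: a form \<open>l\<close> as in \<open>surj_at\<close> is then not a zero divisor modulo \<open>J\<close> either, and the
  final value equals the length modulo \<open>l\<close>.\<close>

lemma hilb_le_final_value:
  fixes J :: "'n::{finite,linorder} mpoly set"
  assumes J: "ideal_of J" and loc: "loc J = J" and x: "x \<in> mpow 1"
    and nzd: "\<And>f. x * f \<in> J \<Longrightarrow> f \<in> J" and e: "\<And>k. k \<ge> k0 \<Longrightarrow> hilb J k = e"
  shows "hilb J i \<le> e"
proof -
  \<comment> \<open>Past \<open>k0\<close> the value is e, and j is at least e, so the Hilbert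
    function is on or below the diagonal at j.\<close>
  define j where "j = max k0 e"
  have "hilb J j \<le> j" using e[of j] by (simp add: j_def)
  then obtain l where l: "l \<in> mpow 1" "surj_at J l j" using small_hilb_surj[OF J] by metis
  have idl: "ideal_of (J + (*) l ` mpow k)" for k by (intro ideal_plus ideal_mult_image J ideal_mpow)
  \<comment> \<open>Nakayama's lemma turns surjectivity in the graded ring into the local statement
    that m^(k+1) lies in l m^k + J.\<close>
  have step: "mpow (Suc k) \<subseteq> loc (J + (*) l ` mpow k)" if "j \<le> k" for k
  proof (rule nakayama[OF idl ideal_mpow])
    have sub: "mpow (Suc (Suc k)) \<subseteq> Id.span {u * b | u b. u \<in> mpow 1 \<and> b \<in> (mpow (Suc k) :: 'n mpoly set)}"
      unfolding mpow_Suc_eq[of "Suc k"]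
      by (rule Id.span_mono) (use var_in_mpow in blast)
    have "mpow (Suc k) \<subseteq> (J + mpow (Suc (Suc k))) + (*) l ` mpow k"
      using surj_at_mono[OF J l(2) that] unfolding surj_at_def .
    also have "\<dots> = (J + (*) l ` mpow k) + mpow (Suc (Suc k))" by (simp add: ac_simps)
    also have "\<dots> \<subseteq> (J + (*) l ` mpow k) + Id.span {u * b | u b. u \<in> mpow 1 \<and> b \<in> mpow (Suc k)}"
      by (intro set_plus_mono2 order_refl sub)
    finally show "mpow (Suc k) \<subseteq> (J + (*) l ` mpow k) +
      Id.span {u * b | u b. u \<in> mpow 1 \<and> b \<in> mpow (Suc k)}" .
  qed
  have stepE: "\<exists>g q b. mpoly_eval origin g \<noteq> 0 \<and> q \<in> J \<and> b \<in> mpow k \<and> g * f = q + l * b"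
    if jk: "j \<le> k" and fk: "f \<in> mpow (Suc k)" for k f
  proof -
    obtain g where g: "mpoly_eval origin g \<noteq> 0" "g * f \<in> J + (*) l ` mpow k"
      using subsetD[OF step[OF jk] fk] unfolding loc_def by blast
    from g(2) obtain q y where "q \<in> J" "y \<in> (*) l ` mpow k" "g * f = q + y" by (rule set_plus_elim)
    then show ?thesis using g(1) by blast
  qed
  have unit: "f \<in> J" if "mpoly_eval origin g \<noteq> 0" "g * f \<in> J" for g f
    using locI[OF that] loc by simp
  have xpow: "f \<in> J" if "x ^ k * f \<in> J" for k f
    using that by (induction k) (auto simp: mult.assoc intro: nzd)
  \<comment> \<open>Up to a unit a power of x is a multiple of l modulo J. What l sends into J is
    therefore sent into J by a power of x and lies in J.\<close>
  have l_nzd: "a \<in> J" if a: "l * a \<in> J" for a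
  proof -
    obtain g q b where g: "mpoly_eval origin g \<noteq> 0" "q \<in> J" "g * x ^ Suc j = q + l * b"
      using stepE[OF order_refl power_in_mpow[OF x, of "Suc j"]] by blast
    have "g * (x ^ Suc j * a) = (g * x ^ Suc j) * a" by (rule mult.assoc[symmetric])
    also have "\<dots> = a * q + b * (l * a)" unfolding g(3) by (simp add: algebra_simps)
    also have "\<dots> \<in> J" by (rule Id.subspace_add[OF J Id.subspace_scale[OF J g(2)] Id.subspace_scale[OF J a]])
    finally show ?thesis using unit[OF g(1)] xpow by blast
  qed
  define Q where "Q k = loc (J + principal (l ^ k))" for k
  have idQ: "ideal_of (Q k)" for k unfolding Q_def by (intro ideal_loc ideal_plus J ideal_principal)
  have mQ: "mpow (j + k) \<subseteq> Q k" for k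
  proof (induction k)
    case 0
    have "f \<in> Q 0" for f
      unfolding Q_def in_loc_plus_principal
      by (intro exI[of _ 1] exI[of _ 0] exI[of _ f]) (simp add: zero_in_ideal[OF J])
    then show ?case by blast
  next
    case (Suc k)
    show ?case
    proof
      fix f :: "'n mpoly" assume "f \<in> mpow (j + Suc k)"
      then obtain g q b where g: "mpoly_eval origin g \<noteq> 0" "q \<in> J" "b \<in> mpow (j + k)" "g * f = q + l * b"
        using stepE[of "j + k" f] by auto
      obtain h p r where h: "mpoly_eval origin h \<noteq> 0" "p \<in> J" "h * b = p + l ^ k * r"
        using subsetD[OF Suc g(3)] unfolding Q_def in_loc_plus_principal by blast
      have "(h * g) * f = h * (g * f)" by (rule mult.assoc)
      also have "\<dots> = h * q + l * (h * b)" unfolding g(4) by (simp add: distrib_left mult.left_commute)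
      also have "\<dots> = (h * q + l * p) + l ^ Suc k * r" unfolding h(3) by (simp add: distrib_left ac_simps)
      finally have "(h * g) * f = (h * q + l * p) + l ^ Suc k * r" .
      moreover have "h * q + l * p \<in> J"
        by (rule Id.subspace_add[OF J Id.subspace_scale[OF J g(2)] Id.subspace_scale[OF J h(2)]])
      moreover have "mpoly_eval origin (h * g) \<noteq> 0" using g(1) h(1) by simp
      ultimately show "f \<in> Q (Suc k)" unfolding Q_def in_loc_plus_principal by blast
    qed
  qed
  have subQ: "Vs.subspace (Q k)" for k using idQ by (rule ideal_imp_subspace)
  have finQ: "\<exists>n. qgen (Q k) n W" if "Vs.subspace W" "Q k \<subseteq> W" for k W
    using qgen_above_mpow[OF mQ subQ that] .
  define L where "L = qdim (Q 1) UNIV"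
  \<comment> \<open>Because l is a nonzerodivisor modulo J, each further power of l contributes
    another copy of the length \<open>L\<close> modulo l.\<close>
  have kL: "k * L \<le> qdim (Q k) UNIV" for k
  proof (induction k)
    case (Suc k)
    have le: "Q (Suc k) \<subseteq> Q 1"
      unfolding Q_def
    proof (intro loc_mono set_plus_mono2 order_refl)
      show "principal (l ^ Suc k) \<subseteq> principal (l ^ 1)"
        by (auto simp: principal_def mult.assoc)
    qed
    obtain m where m: "qgen (Q (Suc k)) m UNIV" using finQ[of UNIV "Suc k"] by auto
    have "qgen (Q (Suc k)) m (Q 1)" by (rule qgen_lower[OF m subQ subQ Vs.subspace_UNIV le]) simp
    then have "qgen (Q k) (qdim (Q (Suc k)) (Q 1)) UNIV"
    proof (rule qgen_mult_inj[OF qgen_qdim])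
      show "(*) l ` UNIV \<subseteq> Q 1"
        unfolding Q_def using plus_superset2[OF zero_in_ideal[OF J], of "principal (l ^ 1)"] loc_superset
        by (force simp: principal_def)
      fix w assume "l * w \<in> Q (Suc k)"
      then obtain g q r where g: "mpoly_eval origin g \<noteq> 0" "q \<in> J" "g * (l * w) = q + l ^ Suc k * r"
        unfolding Q_def in_loc_plus_principal by blast
      have "l * (g * w - l ^ k * r) = g * (l * w) - l ^ Suc k * r"
        by (simp add: right_diff_distrib ac_simps)
      also have "\<dots> = q" unfolding g(3) by simp
      finally have "g * w - l ^ k * r \<in> J" using g(2) l_nzd by simp
      then have "\<exists>q r. q \<in> J \<and> g * w = q + l ^ k * r" by (metis diff_add_cancel)
      then show "w \<in> Q k" unfolding Q_def in_loc_plus_principal using g(1) by blast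
    qed (use subQ le in auto)
    then have "qdim (Q k) UNIV \<le> qdim (Q (Suc k)) (Q 1)" by (rule qdim_le)
    moreover have "qdim (Q (Suc k)) UNIV = qdim (Q (Suc k)) (Q 1) + L"
      unfolding L_def by (rule qdim_add[OF m subQ subQ Vs.subspace_UNIV le]) simp
    ultimately show ?case using Suc by simp
  qed simp
  \<comment> \<open>Locally m^(j+k) lies in J + (l^k), so k L is at most the sum of the first j + k
    values of the Hilbert function, which is k e plus a constant. A large k gives the bound.\<close>
  have "L \<le> e"
  proof (rule ccontr)
    assume "\<not> L \<le> e"
    have sum: "hilb_sum J (j + k) = hilb_sum J j + k * e" for k
      by (induction k) (auto simp: hilb_sum_Suc[OF J] e j_def)
    have "k * L \<le> hilb_sum J j + k * e" for k
    proof -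
      have "J \<subseteq> Q k" unfolding Q_def
        using loc_superset plus_superset1[OF zero_in_ideal[OF ideal_principal]] by blast
      then have "J + mpow (j + k) \<subseteq> Q k" using plus_ideal_minimal[OF idQ] mQ by blast
      moreover obtain m where "qgen (J + mpow (j + k)) m UNIV" using qgen_plus_mpow[OF J] by blast
      ultimately have "qdim (Q k) UNIV \<le> hilb_sum J (j + k)"
        unfolding hilb_sum_def by (intro qdim_antimono)
      then show ?thesis using kL[of k] sum[of k] by linarith
    qed
    from this[of "Suc (hilb_sum J j)"] have "Suc (hilb_sum J j) * L \<le> hilb_sum J j + Suc (hilb_sum J j) * e" .
    moreover have "Suc (hilb_sum J j) * Suc e \<le> Suc (hilb_sum J j) * L"
      using \<open>\<not> L \<le> e\<close> by (intro mult_le_mono2) simp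
    ultimately show False by simp
  qed
  moreover have "hilb J i \<le> L"
  proof -
    define K where "K = max (Suc i) (Suc j)"
    \<comment> \<open>The length of R/Y is computed through J + m^i and through \<open>Q 1\<close>.
      Multiplication by l maps R/(J + m^i) onto \<open>Q 1\<close> modulo Y, so the part of J + m^i
      over Y has length at most \<open>L\<close>; as Y lies in J + m^(i+1), this part bounds the
      Hilbert function at i. The summand \<open>mpow K\<close> keeps the lengths finite and absorbs
      the localization in \<open>Q 1\<close>.\<close>
    define Y where "Y = (J + (*) l ` mpow i) + mpow K"
    have idY: "ideal_of Y" unfolding Y_def by (intro ideal_plus idl ideal_mpow)
    have mK: "mpow K \<subseteq> Q 1" by (rule order_trans[OF mpow_antimono mQ]) (simp add: K_def)
    have mY: "mpow K \<subseteq> Y" unfolding Y_def by (rule plus_superset2[OF zero_in_ideal[OF idl]])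
    have JY: "J \<subseteq> Y"
      unfolding Y_def by (rule order_trans[OF plus_superset1 plus_superset1])
        (intro zero_in_ideal ideal_mult_image ideal_mpow)+
    have lY: "(*) l ` mpow i \<subseteq> Y"
      unfolding Y_def by (rule order_trans[OF plus_superset2 plus_superset1])
        (intro zero_in_ideal J ideal_mpow)+
    have Q1: "Q 1 = (J + principal l) + mpow K"
      unfolding Q_def using loc_eq_plus_mpow[of "J + principal (l ^ 1)" K] mK
      by (simp add: Q_def J)
    have YQ: "Y \<subseteq> Q 1"
      unfolding Q1 Y_def principal_def by (intro set_plus_mono2 order_refl image_mono) simp
    obtain m where m: "qgen Y m UNIV"
      using qgen_above_mpow[OF mY ideal_imp_subspace[OF idY] Vs.subspace_UNIV] by auto
    have YJ: "Y \<subseteq> J + mpow (Suc i)"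
      unfolding Y_def
    proof (intro plus_ideal_minimal ideal_plus J ideal_mpow subset_plus_mpow)
      show "(*) l ` mpow i \<subseteq> J + mpow (Suc i)"
        using mpow_mult[OF l(1), of _ i] mpow_subset_plus[OF J, of "Suc i"] by auto
      show "mpow K \<subseteq> J + mpow (Suc i)"
        by (rule order_trans[OF mpow_antimono mpow_subset_plus[OF J]]) (simp add: K_def)
    qed
    have YJ': "Y \<subseteq> J + mpow i" using YJ plus_mpow_antimono[of i "Suc i" J] by simp
    note sub = ideal_imp_subspace[OF idY] sub_plus_mpow[OF J, of i] Vs.subspace_UNIV
    have "qdim Y (J + mpow i) + hilb_sum J i = qdim Y UNIV"
      unfolding hilb_sum_def using qdim_add[OF m sub YJ'] by simp
    moreover have "hilb J i \<le> qdim Y (J + mpow i)"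
      unfolding hilb_def by (rule qdim_antimono[OF qgen_lower[OF m sub YJ'] YJ]) simp
    moreover have "qdim Y UNIV = qdim Y (Q 1) + L"
      unfolding L_def by (rule qdim_add[OF m sub(1) subQ Vs.subspace_UNIV YQ]) simp
    moreover have "qdim Y (Q 1) \<le> hilb_sum J i"
      unfolding hilb_sum_def
    proof (rule qdim_le)
      obtain m' where m': "qgen (J + mpow i) m' UNIV" using qgen_plus_mpow[OF J] by blast
      show "qgen Y (qdim (J + mpow i) UNIV) (Q 1)"
      proof (rule qgen_mult_surj[OF qgen_qdim[OF m']])
        have "l * (a + b) \<in> Y" if "a \<in> J" "b \<in> mpow i" for a b
        proof -
          have "l * a \<in> Y" by (rule subsetD[OF JY Id.subspace_scale[OF J that(1)]])
          moreover have "l * b \<in> Y" by (rule subsetD[OF lY imageI[OF that(2)]])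
          ultimately show ?thesis unfolding distrib_left by (rule Id.subspace_add[OF idY])
        qed
        then show "(*) l ` (J + mpow i) \<subseteq> Y" by (auto elim!: set_plus_elim)
        show "(*) l ` UNIV \<subseteq> Q 1"
          unfolding Q1 principal_def[symmetric]
          by (rule order_trans[OF plus_superset2 plus_superset1]) (intro zero_in_ideal J ideal_mpow)+
        have "(J + mpow K) + principal l \<subseteq> Y + principal l"
          using plus_ideal_minimal[OF idY JY mY] by (intro set_plus_mono2 order_refl)
        then show "Q 1 \<subseteq> Y + (*) l ` UNIV"
          unfolding Q1 principal_def[symmetric] by (simp add: ac_simps)
      qed
    qed
    ultimately show ?thesis by linarith
  qed
  ultimately show ?thesis by simp
qed

context local_param
begin

text \<open>The contraction of the ideal that \<open>I\<close> generates in the localization inverting \<open>x\<close> as well;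
  \<open>J\<close> modulo \<open>loc I\<close> is the finite length part of the local ring.\<close>

definition J :: "'n mpoly set" where
  "J = {f. \<exists>s. x ^ s * f \<in> loc I}"

lemma idJ: "ideal_of J"
  unfolding Id.subspace_def
proof (intro conjI ballI allI)
  show "0 \<in> J" unfolding J_def using zero_in_ideal[OF ideal_loc[OF I]] by simp
next
  fix a b assume "a \<in> J" "b \<in> J"
  then obtain s t where st: "x ^ s * a \<in> loc I" "x ^ t * b \<in> loc I" by (auto simp: J_def)
  have "x ^ (s + t) * (a + b) = x ^ t * (x ^ s * a) + x ^ s * (x ^ t * b)"
    by (simp add: power_add algebra_simps)
  also have "\<dots> \<in> loc I"
    by (rule Id.subspace_add[OF ideal_loc[OF I]]; rule Id.subspace_scale[OF ideal_loc[OF I]]) (fact st)+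
  finally show "a + b \<in> J" by (auto simp: J_def)
next
  fix c a assume "a \<in> J"
  then obtain s where s: "x ^ s * a \<in> loc I" by (auto simp: J_def)
  have "x ^ s * (c * a) \<in> loc I"
    by (subst mult.left_commute) (rule Id.subspace_scale[OF ideal_loc[OF I] s])
  then show "c * a \<in> J" by (auto simp: J_def)
qed

lemma loc_I_subset_J: "loc I \<subseteq> J"
  by (auto simp: J_def intro!: exI[of _ 0])

lemma J_x: "x ^ k * f \<in> J \<Longrightarrow> f \<in> J"
  unfolding J_def by (auto simp flip: mult.assoc power_add)

lemma loc_J: "loc J = J"
proof
  show "loc J \<subseteq> J"
  proof
    fix f assume "f \<in> loc J"
    then obtain g where g1: "mpoly_eval origin g \<noteq> 0" "g * f \<in> J" unfolding loc_def[of J] by blast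
    then obtain s where g: "mpoly_eval origin g \<noteq> 0" "x ^ s * (g * f) \<in> loc I" by (auto simp: J_def)
    then have "g * (x ^ s * f) \<in> loc I" by (simp add: mult.left_commute)
    then have "x ^ s * f \<in> loc I" by (rule loc_mult_cancel[OF g(1)])
    then show "f \<in> J" by (auto simp: J_def)
  qed
qed (rule loc_superset)

text \<open>Finitely many generators of J are killed by a common power of x.\<close>

lemma J_uniform: "\<exists>s. \<forall>f\<in>J. x ^ s * f \<in> loc I"
proof -
  obtain F where F: "finite F" "F \<subseteq> J" "Id.span F = J" using mpoly_noetherian[OF idJ] by blast
  have "\<exists>s. \<forall>f\<in>F. x ^ s * f \<in> loc I" using F(1,2)
  proof induction
    case (insert a F)
    then obtain s t where st: "\<forall>f\<in>F. x ^ s * f \<in> loc I" "x ^ t * a \<in> loc I"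
      by (auto simp: J_def)
    have "x ^ (s + t) * f \<in> loc I" if "x ^ s * f \<in> loc I \<or> x ^ t * f \<in> loc I" for f
      using that Id.subspace_scale[OF ideal_loc[OF I], of "x ^ s * f" "x ^ t"]
        Id.subspace_scale[OF ideal_loc[OF I], of "x ^ t * f" "x ^ s"]
      by (auto simp: power_add ac_simps)
    then show ?case using st by (intro exI[of _ "s + t"]) auto
  qed simp
  then obtain s where s: "\<forall>f\<in>F. x ^ s * f \<in> loc I" ..
  have "ideal_of {f. x ^ s * f \<in> loc I}"
    unfolding Id.subspace_def
  proof (intro conjI ballI allI; clarsimp)
    show "0 \<in> loc I" by (rule zero_in_ideal[OF ideal_loc[OF I]])
  next
    fix a b assume "x ^ s * a \<in> loc I" "x ^ s * b \<in> loc I"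
    then show "x ^ s * (a + b) \<in> loc I" by (simp add: distrib_left Id.subspace_add[OF ideal_loc[OF I]])
  next
    fix c a assume "x ^ s * a \<in> loc I"
    then show "x ^ s * (c * a) \<in> loc I"
      by (subst mult.left_commute) (rule Id.subspace_scale[OF ideal_loc[OF I]])
  qed
  then have "Id.span F \<subseteq> {f. x ^ s * f \<in> loc I}" using s by (intro Id.span_minimal) auto
  then show ?thesis using F(3) by (intro exI[of _ s]) auto
qed

theorem finite_part_avoids_mpow:
  assumes r: "\<And>k. k \<ge> r \<Longrightarrow> hilb I k = e" and K: "r \<le> K" "e \<le> Suc K"
  shows "J \<inter> (I + mpow K) \<subseteq> loc I"
proof -
  obtain s where s: "\<And>f. f \<in> J \<Longrightarrow> x ^ s * f \<in> loc I" using J_uniform by blast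
  define P where "P = loc (I + principal (x ^ s))"
  have subP: "Vs.subspace P" unfolding P_def by (rule ideal_imp_subspace[OF id_loc_power])
  have IJ: "I \<subseteq> J" using loc_superset loc_I_subset_J by (rule order_trans)
  \<comment> \<open>J meets the multiples of x^s trivially: if x^s b lies in J then so does b, and
    x^s kills J. So J embeds into the quotient modulo x^s and has finite length.\<close>
  have JP: "f \<in> loc I" if f: "f \<in> J" "f \<in> P" for f
  proof -
    obtain g q b where g: "mpoly_eval origin g \<noteq> 0" "q \<in> I" "g * f = q + x ^ s * b"
      using f(2) unfolding P_def in_loc_plus_principal by blast
    have "x ^ s * b = g * f - q" using g(3) by simp
    also have "\<dots> \<in> J"
      by (rule Id.subspace_diff[OF idJ Id.subspace_scale[OF idJ f(1)] subsetD[OF IJ g(2)]])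
    finally have "x ^ s * b \<in> loc I" using J_x s by blast
    then have "g * f \<in> loc I"
      unfolding g(3) using Id.subspace_add[OF ideal_loc[OF I] subsetD[OF loc_superset g(2)]] by blast
    then show ?thesis by (rule loc_mult_cancel[OF g(1)])
  qed
  note subs = ideal_imp_subspace[OF ideal_loc[OF I]] ideal_imp_subspace[OF idJ]
  have C: "qgen (loc I) (s * c) J"
  proof (rule qgen_mult_inj[of P _ UNIV _ _ 1])
    show "qgen P (s * c) UNIV" unfolding P_def by (rule qgen_loc_power)
  qed (use subs subP JP in auto)
  \<comment> \<open>The dimension of the image of J in R/(I + m^k). It is the gap between the two
    partial sums of Hilbert functions, and also the dimension of J modulo \<open>A k\<close>
    below.\<close>
  define \<tau> where "\<tau> k = qdim (I + mpow k) (J + mpow k)" for k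
  have IJk: "I + mpow k \<subseteq> J + mpow k" for k by (intro set_plus_mono2 IJ order_refl)
  have fin\<tau>: "\<exists>m. qgen (I + mpow k) m (J + mpow k)" for k
    by (rule qgen_fin[OF I order_refl sub_plus_mpow[OF I] sub_plus_mpow[OF idJ] IJk])
  have sum: "hilb_sum I k = \<tau> k + hilb_sum J k" for k
  proof -
    obtain m where "qgen (I + mpow k) m UNIV" using qgen_plus_mpow[OF I] by blast
    from qdim_add[OF this sub_plus_mpow[OF I] sub_plus_mpow[OF idJ] Vs.subspace_UNIV IJk]
    show ?thesis by (simp add: \<tau>_def hilb_sum_def)
  qed
  have \<tau>_mono: "incseq \<tau>"
  proof (rule incseq_SucI)
    fix k
    obtain m where m: "qgen (I + mpow (Suc k)) m (J + mpow (Suc k))" using fin\<tau> by blast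
    have "qgen (I + mpow k) (\<tau> (Suc k)) (J + mpow k)"
      unfolding \<tau>_def
    proof (rule qgen_surj[OF qgen_qdim[OF m]])
      show "I + mpow (Suc k) \<subseteq> I + mpow k" "J + mpow (Suc k) \<subseteq> J + mpow k"
        by (rule plus_mpow_antimono; simp)+
      have "J + mpow k \<subseteq> (J + mpow (Suc k)) + (I + mpow k)"
        by (intro set_plus_mono2 subset_plus_mpow mpow_subset_plus I)
      then show "J + mpow k \<subseteq> I + mpow k + (J + mpow (Suc k))" by (simp add: add.commute)
    qed
    then show "\<tau> k \<le> \<tau> (Suc k)" unfolding \<tau>_def[of k] by (rule qdim_le)
  qed
  define A where "A k = J \<inter> (I + mpow k)" for k
  have subA: "Vs.subspace (A k)" for k
    unfolding A_def by (rule Vs.subspace_inter[OF subs(2) sub_plus_mpow[OF I]])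
  have locA: "loc I \<subseteq> A k" for k
    unfolding A_def using loc_I_subset_J loc_subset_plus_mpow[OF I] by blast
  have finA: "qgen (A k) (s * c) J" for k by (rule qgen_antimono[OF C locA])
  have tau_A: "\<tau> k = qdim (A k) J" for k
  proof (rule antisym)
    have "qgen (I + mpow k) (qdim (A k) J) (J + mpow k)"
    proof (rule qgen_surj[OF qgen_qdim[OF finA]])
      show "A k \<subseteq> I + mpow k" by (simp add: A_def)
      show "J \<subseteq> J + mpow k" by (rule subset_plus_mpow)
      show "J + mpow k \<subseteq> I + mpow k + J"
        by (subst add.commute) (intro set_plus_mono2 order_refl mpow_subset_plus I)
    qed
    then show "\<tau> k \<le> qdim (A k) J" unfolding \<tau>_def by (rule qdim_le)
    obtain m where m: "qgen (I + mpow k) m (J + mpow k)" using fin\<tau> by blast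
    have "qgen (A k) (\<tau> k) J"
      unfolding \<tau>_def
    proof (rule qgen_mult_inj[OF qgen_qdim[OF m], where a = 1])
      show "(*) 1 ` J \<subseteq> J + mpow k" using subset_plus_mpow[of J k] by simp
    qed (use subA subs(2) sub_plus_mpow[OF I] sub_plus_mpow[OF idJ] IJk in \<open>auto simp: A_def\<close>)
    then show "qdim (A k) J \<le> \<tau> k" by (rule qdim_le)
  qed
  have "\<tau> k \<le> s * c" for k unfolding tau_A by (rule qdim_le[OF finA])
  then obtain k1 where k1: "\<And>k. k \<ge> k1 \<Longrightarrow> \<tau> k = \<tau> k1"
    using mono_bounded_nat_eventually_const[OF \<tau>_mono] by blast
  have rel: "\<tau> k + hilb I k = \<tau> (Suc k) + hilb J k" for k
    using sum[of k] sum[of "Suc k"] hilb_sum_Suc[OF I, of k] hilb_sum_Suc[OF idJ, of k] by linarith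
  have HJ: "hilb J k = e" if "k \<ge> max r k1" for k
    using rel[of k] k1[of k] k1[of "Suc k"] r[of k] that by simp
  have HJ_le: "hilb J k \<le> e" for k
  proof (rule hilb_le_final_value[OF idJ loc_J x])
    show "f \<in> J" if "x * f \<in> J" for f using J_x[of 1 f] that by simp
  qed (rule HJ)
  \<comment> \<open>A value below e at k, with k at least K, is at most k because e is at most K +
    1. From there on the Hilbert function could not rise again to its final value e.\<close>
  have HJK: "hilb J k = e" if "k \<ge> K" for k
  proof (rule ccontr)
    assume "hilb J k \<noteq> e"
    then have less: "hilb J k < e" using HJ_le[of k] by simp
    then have "hilb J k \<le> k" using K(2) that by simp
    from small_hilb_antimono[OF idJ this, of k "max k (max r k1)"] show False
      using less HJ[of "max k (max r k1)"] by simp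
  qed
  have A_step: "A k \<subseteq> A (Suc k)" if "k \<ge> K" for k
  proof -
    have "\<tau> (Suc k) = \<tau> k" using rel[of k] HJK[OF that] r[of k] that K(1) by simp
    moreover have AA: "A (Suc k) \<subseteq> A k" unfolding A_def using plus_mpow_antimono[of k "Suc k" I] by auto
    moreover have AJ: "A k \<subseteq> J" by (simp add: A_def)
    note X = finA[of "Suc k"] subA subA subs(2) AA AJ
    have "qdim (A (Suc k)) J = qdim (A (Suc k)) (A k) + qdim (A k) J"
      by (rule qdim_add[OF X])
    ultimately have "qdim (A (Suc k)) (A k) = 0" using tau_A by simp
    then have "qgen (A (Suc k)) 0 (A k)" using qgen_qdim[OF qgen_lower[OF X]] by simp
    then show ?thesis unfolding qgen_0_iff[OF subA] .
  qed
  have A_le: "A K \<subseteq> A k" if "k \<ge> K" for k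
    using that by (induction k rule: dec_induct) (use A_step in auto)
  show ?thesis
  proof
    fix f assume "f \<in> J \<inter> (I + mpow K)"
    \<comment> \<open>The exponent n s makes m^(n s) lie locally in I + (x^s), which meets J
      trivially.\<close>
    then have f: "f \<in> A (max K (n * s))" using A_le[of "max K (n * s)"] by (auto simp: A_def)
    have "mpow (max K (n * s)) \<subseteq> P"
      using mpow_loc_power[of s] mpow_antimono[of "n * s" "max K (n * s)"] unfolding P_def by auto
    moreover have "I \<subseteq> P"
      unfolding P_def using loc_superset plus_superset1[OF zero_in_ideal[OF ideal_principal]] by blast
    ultimately have "I + mpow (max K (n * s)) \<subseteq> P"
      unfolding P_def by (intro plus_ideal_minimal id_loc_power)
    then show "f \<in> loc I" using f JP by (auto simp: A_def)
  qed
qed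

end

section \<open>Elimination and congruences\<close>

text \<open>Subrings are sets because the coefficient rings of Noether normalization are images of
  substitutions inside the polynomial ring.\<close>

definition subring_set :: "'a::comm_ring_1 set \<Rightarrow> bool" where
  "subring_set S \<longleftrightarrow> 0 \<in> S \<and> 1 \<in> S \<and> (\<forall>a\<in>S. \<forall>b\<in>S. a + b \<in> S \<and> a * b \<in> S \<and> - a \<in> S)"

lemma subring_setD:
  assumes "subring_set S"
  shows "0 \<in> S" "1 \<in> S" "a \<in> S \<Longrightarrow> b \<in> S \<Longrightarrow> a + b \<in> S" "a \<in> S \<Longrightarrow> b \<in> S \<Longrightarrow> a * b \<in> S"
    "a \<in> S \<Longrightarrow> - a \<in> S" "a \<in> S \<Longrightarrow> b \<in> S \<Longrightarrow> a - b \<in> S" "a \<in> S \<Longrightarrow> a ^ n \<in> S"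
proof -
  show "0 \<in> S" "1 \<in> S" "a \<in> S \<Longrightarrow> b \<in> S \<Longrightarrow> a + b \<in> S" "a \<in> S \<Longrightarrow> b \<in> S \<Longrightarrow> a * b \<in> S"
    "a \<in> S \<Longrightarrow> - a \<in> S" using assms by (auto simp: subring_set_def)
  show "a - b \<in> S" if "a \<in> S" "b \<in> S"
  proof -
    have "a + - b \<in> S" using that assms unfolding subring_set_def by blast
    then show ?thesis by simp
  qed
  show "a ^ n \<in> S" if "a \<in> S" using that assms by (induction n) (auto simp: subring_set_def)
qed

lemma subring_set_sum: "subring_set S \<Longrightarrow> (\<And>i. i \<in> A \<Longrightarrow> f i \<in> S) \<Longrightarrow> sum f A \<in> S"
  by (induction A rule: infinite_finite_induct) (auto simp: subring_setD)

lemma subring_set_prod: "subring_set S \<Longrightarrow> (\<And>i. i \<in> A \<Longrightarrow> f i \<in> S) \<Longrightarrow> prod f A \<in> S"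
  by (induction A rule: infinite_finite_induct) (auto simp: subring_setD)

text \<open>Fraction-free Gaussian elimination: it needs no division, so the relation among the rows
  has its coefficients in the subring that contains the entries.\<close>

lemma dependent_rows:
  fixes c :: "'k \<Rightarrow> 'w \<Rightarrow> 'a::idom"
  assumes "finite W" "finite K" "card W < card K" "subring_set S" "\<And>k w. c k w \<in> S"
  shows "\<exists>b. (\<forall>k. b k \<in> S) \<and> (\<exists>k\<in>K. b k \<noteq> 0) \<and> (\<forall>w\<in>W. (\<Sum>k\<in>K. b k * c k w) = 0)"
  using assms(1-3,5)
proof (induction W arbitrary: K c rule: finite_induct)
  case empty
  then have "K \<noteq> {}" by auto
  then show ?case using assms(4) by (intro exI[of _ "\<lambda>_. 1"]) (auto simp: subring_setD)
next
  case (insert w W)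
  show ?case
  proof (cases "\<forall>k\<in>K. c k w = 0")
    case True
    have "card W < card K" using insert by simp
    from insert.IH[OF insert.prems(1) this insert.prems(3)] True show ?thesis by auto
  next
    case False
    then obtain k0 where k0: "k0 \<in> K" "c k0 w \<noteq> 0" by blast
    \<comment> \<open>Cross-multiplication with the pivot row k0 clears the column w.\<close>
    define c' where "c' k w' = c k0 w * c k w' - c k w * c k0 w'" for k w'
    have "card W < card (K - {k0})" using insert k0(1) by simp
    moreover have "c' k w' \<in> S" for k w'
      unfolding c'_def using assms(4) insert.prems(3) by (intro subring_setD(4,6))
    ultimately have "\<exists>b. (\<forall>k. b k \<in> S) \<and> (\<exists>k\<in>K - {k0}. b k \<noteq> 0) \<and>
        (\<forall>w'\<in>W. (\<Sum>k\<in>K - {k0}. b k * c' k w') = 0)"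
      using insert.prems(1) by (intro insert.IH) simp_all
    then obtain b where b: "\<And>k. b k \<in> S" "\<exists>k\<in>K - {k0}. b k \<noteq> 0"
      "\<And>w'. w' \<in> W \<Longrightarrow> (\<Sum>k\<in>K - {k0}. b k * c' k w') = 0"
      by blast
    \<comment> \<open>The coefficient at k0 collects the multiples of the pivot row that were
      subtracted in \<open>c'\<close>.\<close>
    define b' where "b' k = (if k = k0 then - (\<Sum>k\<in>K - {k0}. b k * c k w) else c k0 w * b k)" for k
    have split: "(\<Sum>k\<in>K. b' k * c k w') = (\<Sum>k\<in>K - {k0}. c k0 w * b k * c k w') - (\<Sum>k\<in>K - {k0}. b k * c k w) * c k0 w'" for w'
    proof -
      have "(\<Sum>k\<in>K. b' k * c k w') = b' k0 * c k0 w' + (\<Sum>k\<in>K - {k0}. b' k * c k w')"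
        by (rule sum.remove[OF insert.prems(1) k0(1)])
      also have "(\<Sum>k\<in>K - {k0}. b' k * c k w') = (\<Sum>k\<in>K - {k0}. c k0 w * b k * c k w')"
        by (rule sum.cong) (auto simp: b'_def)
      finally show ?thesis by (simp add: b'_def)
    qed
    have eq: "(\<Sum>k\<in>K. b' k * c k w') = (\<Sum>k\<in>K - {k0}. b k * c' k w')" for w'
      unfolding split sum_distrib_right sum_subtractf[symmetric] c'_def
      by (rule sum.cong) (simp_all add: algebra_simps)
    have "(\<Sum>k\<in>K. b' k * c k w) = 0"
      unfolding eq by (simp add: c'_def mult.commute)
    then have "\<forall>w'\<in>insert w W. (\<Sum>k\<in>K. b' k * c k w') = 0" using b(3) eq by simp
    moreover have "\<exists>k\<in>K. b' k \<noteq> 0" using b(2) k0 by (auto simp: b'_def)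
    moreover have "\<forall>k. b' k \<in> S"
      unfolding b'_def using b(1) insert.prems(3) assms(4)
      by (auto intro!: subring_setD(4,5) subring_set_sum)
    ultimately show ?thesis by blast
  qed
qed

section \<open>Congruences modulo an ideal\<close>

definition eqmod :: "'a::comm_ring_1 set \<Rightarrow> 'a \<Rightarrow> 'a \<Rightarrow> bool" where
  "eqmod P a b \<longleftrightarrow> a - b \<in> P"

lemma eqmod_refl: "Id.subspace P \<Longrightarrow> eqmod P a a"
  by (simp add: eqmod_def Id.subspace_0)

lemma eqmod_sym: "Id.subspace P \<Longrightarrow> eqmod P a b \<Longrightarrow> eqmod P b a"
  unfolding eqmod_def by (metis Id.subspace_neg minus_diff_eq)

lemma eqmod_trans: "Id.subspace P \<Longrightarrow> eqmod P a b \<Longrightarrow> eqmod P b c \<Longrightarrow> eqmod P a c"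
  unfolding eqmod_def by (metis Id.subspace_add diff_add_cancel add_diff_eq)

lemma eqmod_add: "Id.subspace P \<Longrightarrow> eqmod P a b \<Longrightarrow> eqmod P c d \<Longrightarrow> eqmod P (a + c) (b + d)"
  unfolding eqmod_def by (metis Id.subspace_add add_diff_add)

lemma eqmod_diff: "Id.subspace P \<Longrightarrow> eqmod P a b \<Longrightarrow> eqmod P c d \<Longrightarrow> eqmod P (a - c) (b - d)"
  unfolding eqmod_def using Id.subspace_diff[of P "a - b" "c - d"] by (simp add: algebra_simps)

lemma eqmod_mult:
  assumes "Id.subspace P" "eqmod P a b" "eqmod P c d"
  shows "eqmod P (a * c) (b * d)"
proof -
  have "a * c - b * d = c * (a - b) + b * (c - d)" by (simp add: algebra_simps)
  then show ?thesis
    using assms Id.subspace_add[OF assms(1) Id.subspace_scale[OF assms(1)] Id.subspace_scale[OF assms(1)]]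
    unfolding eqmod_def by metis
qed

lemma eqmod_power: "Id.subspace P \<Longrightarrow> eqmod P a b \<Longrightarrow> eqmod P (a ^ n) (b ^ n)"
  by (induction n) (auto simp: eqmod_refl eqmod_mult)

lemma eqmod_sum: "Id.subspace P \<Longrightarrow> (\<And>i. i \<in> A \<Longrightarrow> eqmod P (f i) (g i)) \<Longrightarrow> eqmod P (sum f A) (sum g A)"
  by (induction A rule: infinite_finite_induct) (auto simp: eqmod_refl eqmod_add)

lemma eqmod_0_iff: "eqmod P a 0 \<longleftrightarrow> a \<in> P"
  by (simp add: eqmod_def)

lemma eqmod_mem: "Id.subspace P \<Longrightarrow> eqmod P a b \<Longrightarrow> b \<in> P \<Longrightarrow> a \<in> P"
  unfolding eqmod_def by (metis Id.subspace_add diff_add_cancel)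

lemma eqmod_cancel:
  assumes "prime_id P" "a \<notin> P" "eqmod P (a * b) (a * c)"
  shows "eqmod P b c"
  using assms prime_id_mult[OF assms(1), of a "b - c"] by (simp add: eqmod_def right_diff_distrib)

section \<open>Univariate polynomials evaluated modulo a prime ideal\<close>

definition pev :: "complex poly \<Rightarrow> 'n mpoly \<Rightarrow> 'n mpoly" where
  "pev P a = poly (map_poly mpoly_const P) a"

lemma pev_0 [simp]: "pev 0 a = 0"
  by (simp add: pev_def)

lemma pev_pCons [simp]: "pev (pCons c P) a = mpoly_const c + a * pev P a"
  by (cases "c = 0 \<and> P = 0") (auto simp: pev_def map_poly_pCons)

lemma pev_add: "pev (P + Q) a = pev P a + pev Q a"
  by (induction P Q rule: poly_induct2) (simp_all add: const_add algebra_simps)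

lemma pev_smult: "pev (smult c P) a = mpoly_const c * pev P a"
  by (induction P) (simp_all add: const_mult algebra_simps)

lemma pev_mult: "pev (P * Q) a = pev P a * pev Q a"
  by (induction P) (simp_all add: pev_add pev_smult algebra_simps)

lemma pev_sum: "pev (\<Sum>i\<in>A. f i) a = (\<Sum>i\<in>A. pev (f i) a)"
  by (induction A rule: infinite_finite_induct) (auto simp: pev_add)

lemma pev_1 [simp]: "pev 1 a = 1"
  by (simp add: one_pCons)

lemma pev_prod: "pev (\<Prod>i\<in>A. f i) a = (\<Prod>i\<in>A. pev (f i) a)"
  by (induction A rule: infinite_finite_induct) (auto simp: pev_mult)

lemma pev_monom: "pev (Polynomial.monom c n) a = mpoly_const c * a ^ n"
  by (induction n) (simp_all add: monom_0 monom_Suc mult.left_commute)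

text \<open>P splits into linear factors over the complex numbers, and a prime that contains the
  product contains one of them.\<close>

lemma prime_linear_factor:
  assumes q: "prime_id q" and "P \<noteq> 0" "pev P a \<in> q"
  shows "\<exists>c. a - mpoly_const c \<in> q"
  using assms(2,3)
proof (induction "Polynomial.degree P" arbitrary: P rule: less_induct)
  case less
  show ?case
  proof (cases "Polynomial.degree P = 0")
    case True
    then obtain c where c: "P = [:c:]" by (rule degree_eq_zeroE)
    then have "mpoly_const (inverse c) * mpoly_const c \<in> q"
      using less.prems Id.subspace_scale[OF prime_id_ideal[OF q]] by simp
    then show ?thesis using prime_id_1[OF q] const_inverse[of c] c less.prems(1) by (metis pCons_0_0)
  next
    case False
    then have "\<not> constant (poly P)" by (simp add: constant_degree)
    then obtain z where "poly P z = 0" using fundamental_theorem_of_algebra by blast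
    then obtain Q where Q: "P = [:- z, 1:] * Q" by (metis dvdE poly_eq_0_iff_dvd)
    then have "Q \<noteq> 0" using less.prems by auto
    then have "Polynomial.degree Q < Polynomial.degree P" using degree_mult_eq[of "[:- z, 1:]" Q] by (simp add: Q del: mult_pCons_left)
    moreover have "pev P a = (a - mpoly_const z) * pev Q a"
      unfolding Q pev_mult by (simp add: const_uminus)
    ultimately show ?thesis using less \<open>Q \<noteq> 0\<close> prime_id_mult[OF q] by metis
  qed
qed

lemma prime_algebraic_element:
  assumes q: "prime_id q" and K: "finite K" "k0 \<in> K" "b k0 \<noteq> 0"
    and "(\<Sum>k\<in>K. mpoly_const (b k) * a ^ k) \<in> q"
  shows "\<exists>c. a - mpoly_const c \<in> q"
proof (rule prime_linear_factor[OF q])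
  let ?P = "\<Sum>k\<in>K. Polynomial.monom (b k) k"
  have "Polynomial.coeff ?P k0 = b k0" using K by (simp add: coeff_sum)
  then show "?P \<noteq> 0" using K(3) by auto
  show "pev ?P a \<in> q" using assms(5) by (simp add: pev_sum pev_monom)
qed

section \<open>Hilbert's Nullstellensatz for prime ideals\<close>

lemma mpoly_alg_induct [case_names const var add mult]:
  fixes f :: "'n::finite mpoly"
  assumes "\<And>c. P (mpoly_const c)" "\<And>v. P (mpoly_var v)"
    "\<And>f g. P f \<Longrightarrow> P g \<Longrightarrow> P (f + g)" "\<And>f g. P f \<Longrightarrow> P g \<Longrightarrow> P (f * g)"
  shows "P f"
proof (induction f rule: mpoly_induct)
  case zero
  show ?case using assms(1)[of 0] by simp
next
  case (single \<alpha> c)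
  have one: "P 1" using assms(1)[of 1] by simp
  have pow: "P (f ^ n)" if "P f" for f n by (induction n) (auto simp: one that assms(4))
  have "P (\<Prod>j\<in>A. mpoly_var j ^ Poly_Mapping.lookup \<alpha> j)" if "finite A" for A
    using that by induction (auto simp: one assms(2,4) pow)
  then have "P (monomial_eval mpoly_var \<alpha>)" by (simp add: monomial_eval_def)
  then show ?case
    unfolding single_eq_const_mult[of \<alpha> c] single_1_eq_prod using assms(1,4) by blast
qed (rule assms(3))

text \<open>The argument rests on the uncountability of the complex numbers. Let Q be maximal among
  the ideals over p that miss all powers of f, and suppose that no x_v - a lies in Q. Then every a
  gives a congruence between some f^n and h_a (x_v - a). Infinitely many a share n and a degree
  bound for h_a, so these h_a are linearly dependent; this makes x_v algebraic, hence constant,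
  modulo Q. The constants for all v are the coordinates of the point.\<close>

theorem nullstellensatz_prime:
  fixes p :: "'n::{finite,linorder} mpoly set"
  assumes p: "prime_id p" and f: "f \<notin> p"
  obtains a where "\<And>g. g \<in> p \<Longrightarrow> mpoly_eval a g = 0" "mpoly_eval a f \<noteq> 0"
proof -
  let ?\<Sigma> = "range (\<lambda>n. f ^ n)"
  have "p \<inter> ?\<Sigma> = {}" using prime_id_power[OF p] f by auto
  moreover have "1 \<in> ?\<Sigma>" by (metis power_0 rangeI)
  moreover have "a * b \<in> ?\<Sigma>" if "a \<in> ?\<Sigma>" "b \<in> ?\<Sigma>" for a b
    using that by (auto simp flip: power_add)
  ultimately obtain Q where Q: "prime_id Q" "p \<subseteq> Q" "Q \<inter> ?\<Sigma> = {}"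
    "\<And>P'. ideal_of P' \<Longrightarrow> Q \<subseteq> P' \<Longrightarrow> P' \<inter> ?\<Sigma> = {} \<Longrightarrow> P' = Q"
    using prime_avoiding_exists[OF prime_id_ideal[OF p], of ?\<Sigma>] by metis
  note idQ = prime_id_ideal[OF Q(1)]
  have fQ: "f ^ n \<notin> Q" for n using Q(3) by blast
  have "\<exists>a. mpoly_var v - mpoly_const a \<in> Q" for v
  proof (rule ccontr)
    assume no: "\<not> ?thesis"
    have "\<exists>n h. f ^ n - h * (mpoly_var v - mpoly_const a) \<in> Q" for a
    proof -
      let ?t = "mpoly_var v - mpoly_const a"
      have "Id.span (insert ?t Q) \<noteq> Q" using no Id.span_base[of ?t "insert ?t Q"] by blast
      moreover have "Q \<subseteq> Id.span (insert ?t Q)" using Id.span_superset by blast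
      ultimately have "Id.span (insert ?t Q) \<inter> ?\<Sigma> \<noteq> {}" using Q(4)[OF Id.subspace_span] by metis
      then obtain n where "f ^ n \<in> Id.span (insert ?t Q)" by blast
      then show ?thesis unfolding Id.span_breakdown_eq Id.span_eq_iff[THEN iffD2, OF idQ] by blast
    qed
    then obtain n h where nh: "\<And>a. f ^ n a - h a * (mpoly_var v - mpoly_const a) \<in> Q" by metis
    have "\<exists>d. \<forall>\<alpha>\<in>Poly_Mapping.keys (h a). mdeg \<alpha> < d" for a
      using finite_nat_set_iff_bounded[of "mdeg ` Poly_Mapping.keys (h a)"] by simp
    then obtain d where d: "\<And>a \<alpha>. \<alpha> \<in> Poly_Mapping.keys (h a) \<Longrightarrow> mdeg \<alpha> < d a" by metis
    \<comment> \<open>There are uncountably many a, but only countably many pairs of an exponent and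
      a degree bound.\<close>
    obtain nd where inf: "infinite {a. (n a, d a) = nd}"
    proof (rule ccontr)
      assume "\<not> thesis"
      then have "finite {a. (n a, d a) = nd}" for nd using that by blast
      then have "countable (\<Union>nd. {a. (n a, d a) = nd})"
        by (intro countable_UN countableI_type uncountable_infinite) (auto intro: countable_finite)
      then have "countable (UNIV :: complex set)" by (rule countable_subset[rotated]) auto
      moreover have "range complex_of_real \<subseteq> UNIV" "inj complex_of_real" by (auto simp: inj_on_def)
      ultimately have "countable (UNIV :: real set)"
        by (metis countable_image_inj_on countable_subset)
      then show False using uncountable_UNIV_real by blast
    qed
    let ?W = "{\<alpha> :: 'n \<Rightarrow>\<^sub>0 nat. mdeg \<alpha> < snd nd}"
    obtain K where K: "finite K" "card K = Suc (card ?W)" "K \<subseteq> {a. (n a, d a) = nd}"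
      using infinite_arbitrarily_large[OF inf] by blast
    have "subring_set (UNIV :: complex set)" by (simp add: subring_set_def)
    then obtain b where b: "\<exists>k\<in>K. b k \<noteq> 0" "\<forall>\<alpha>\<in>?W. (\<Sum>a\<in>K. b a * Poly_Mapping.lookup (h a) \<alpha>) = 0"
      using dependent_rows[of ?W K UNIV "\<lambda>a \<alpha>. Poly_Mapping.lookup (h a) \<alpha>"] K(1,2) finite_mdeg_less by auto
    have hsum: "(\<Sum>a\<in>K. mpoly_const (b a) * h a) = 0"
    proof (rule poly_mapping_eqI)
      fix \<alpha>
      show "Poly_Mapping.lookup (\<Sum>a\<in>K. mpoly_const (b a) * h a) \<alpha> = Poly_Mapping.lookup 0 \<alpha>"
      proof (cases "\<alpha> \<in> ?W")
        case False
        have "Poly_Mapping.lookup (h a) \<alpha> = 0" if "a \<in> K" for a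
        proof -
          have "d a = snd nd" using that K(3) by auto
          then show ?thesis using d[of \<alpha> a] False by (auto simp: in_keys_iff)
        qed
        then show ?thesis by (simp add: lookup_sum lookup_const_mult)
      qed (use b(2) in \<open>simp add: lookup_sum lookup_const_mult\<close>)
    qed
    \<comment> \<open>The numerators of the fractions 1/(T - a) over their common denominator. The
      combination \<open>g\<close> is nonzero because at a0 only the summand of a0 survives.\<close>
    define G where "G a = (\<Prod>a'\<in>K - {a}. [:- a', 1:])" for a
    define g where "g = (\<Sum>a\<in>K. smult (b a) (G a))"
    obtain a0 where a0: "a0 \<in> K" "b a0 \<noteq> 0" using b(1) by blast
    have "poly (G a) a0 = 0" if "a \<in> K - {a0}" for a
      using that a0(1) K(1) by (auto simp: G_def poly_prod intro!: prod_zero bexI[of _ a0])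
    then have "poly g a0 = b a0 * poly (G a0) a0"
      using a0(1) K(1) by (simp add: g_def poly_sum sum.remove)
    moreover have "poly (G a0) a0 \<noteq> 0" using K(1) by (auto simp: G_def poly_prod)
    ultimately have "g \<noteq> 0" using a0(2) by auto
    have lin: "pev [:- a, 1:] (mpoly_var v) = mpoly_var v - mpoly_const a" for a
      by (simp add: const_uminus)
    let ?\<Pi> = "\<Prod>a\<in>K. mpoly_var v - mpoly_const a"
    have \<Pi>: "?\<Pi> = (mpoly_var v - mpoly_const a) * pev (G a) (mpoly_var v)" if "a \<in> K" for a
      unfolding G_def pev_prod lin by (rule prod.remove[OF K(1) that])
    \<comment> \<open>Each f^n is replaced by h_a (x_v - a), which completes the numerator to the
      full product and leaves the vanishing combination of the h_a.\<close>
    have "eqmod Q (f ^ fst nd * pev g (mpoly_var v)) (?\<Pi> * (\<Sum>a\<in>K. mpoly_const (b a) * h a))"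
    proof -
      have "eqmod Q (\<Sum>a\<in>K. (mpoly_const (b a) * pev (G a) (mpoly_var v)) * f ^ fst nd)
        (\<Sum>a\<in>K. (mpoly_const (b a) * pev (G a) (mpoly_var v)) * (h a * (mpoly_var v - mpoly_const a)))"
      proof (intro eqmod_sum eqmod_mult eqmod_refl idQ)
        fix a assume "a \<in> K"
        then have "n a = fst nd" using K(3) by auto
        then show "eqmod Q (f ^ fst nd) (h a * (mpoly_var v - mpoly_const a))"
          using nh[of a] by (simp add: eqmod_def)
      qed
      also have "(\<Sum>a\<in>K. (mpoly_const (b a) * pev (G a) (mpoly_var v)) * f ^ fst nd) = f ^ fst nd * pev g (mpoly_var v)"
        by (simp add: g_def pev_sum pev_smult sum_distrib_left ac_simps)
      also have "(\<Sum>a\<in>K. (mpoly_const (b a) * pev (G a) (mpoly_var v)) * (h a * (mpoly_var v - mpoly_const a)))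
        = ?\<Pi> * (\<Sum>a\<in>K. mpoly_const (b a) * h a)"
        unfolding sum_distrib_left by (rule sum.cong[OF refl]) (simp add: \<Pi> ac_simps)
      finally show ?thesis .
    qed
    then have "f ^ fst nd * pev g (mpoly_var v) \<in> Q" unfolding hsum by (simp add: eqmod_0_iff)
    then have "pev g (mpoly_var v) \<in> Q" using fQ prime_id_mult[OF Q(1)] by blast
    then show False using prime_linear_factor[OF Q(1) \<open>g \<noteq> 0\<close>] no by blast
  qed
  then obtain a where a: "\<And>v. mpoly_var v - mpoly_const (a v) \<in> Q" by metis
  have ev: "eqmod Q h (mpoly_const (mpoly_eval a h))" for h
  proof (induction h rule: mpoly_alg_induct)
    case (const c) show ?case by (simp add: eqmod_refl idQ)
  next
    case (var v) show ?case using a by (simp add: eqmod_def)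
  next
    case (add f g) then show ?case by (simp add: const_add eqmod_add idQ)
  next
    case (mult f g) then show ?case by (simp add: const_mult eqmod_mult idQ)
  qed
  have const_Q: "c = 0" if "mpoly_const c \<in> Q" for c
    using Id.subspace_scale[OF idQ that, of "mpoly_const (inverse c)"] const_inverse[of c] prime_id_1[OF Q(1)]
    by metis
  show thesis
  proof (rule that)
    show "mpoly_eval a g = 0" if "g \<in> p" for g
      using that Q(2) eqmod_mem[OF idQ eqmod_sym[OF idQ ev[of g]]] const_Q by blast
    show "mpoly_eval a f \<noteq> 0" using ev[of f] fQ[of 1] by (auto simp: eqmod_0_iff)
  qed
qed

text \<open>The Nullstellensatz for the zero ideal, which is prime.\<close>

lemma nonzero_mpoly_nonvanishing:
  fixes f :: "'n::{finite,linorder} mpoly"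
  assumes "f \<noteq> 0"
  obtains a where "mpoly_eval a f \<noteq> 0"
proof -
  have "prime_id {0 :: 'n mpoly}" by (auto simp: prime_id_def)
  then show ?thesis using nullstellensatz_prime[of "{0}" f] assms that by blast
qed

section \<open>Noether normalization\<close>

definition mpoly_on :: "'n set \<Rightarrow> 'n mpoly set" where
  "mpoly_on V = {F. \<forall>\<alpha>\<in>Poly_Mapping.keys F. Poly_Mapping.keys \<alpha> \<subseteq> V}"

lemma keys_const_subset: "Poly_Mapping.keys (mpoly_const c) \<subseteq> {0}"
  by (simp add: mpoly_const_def)

lemma mpoly_on_const: "mpoly_const c \<in> mpoly_on V"
  using keys_const_subset[of c] by (auto simp: mpoly_on_def)

lemma mpoly_on_var: "v \<in> V \<Longrightarrow> mpoly_var v \<in> mpoly_on V"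
  by (auto simp: mpoly_on_def mpoly_var_def)

lemma mpoly_on_add: "F \<in> mpoly_on V \<Longrightarrow> G \<in> mpoly_on V \<Longrightarrow> F + G \<in> mpoly_on V"
  using keys_add[of F G] by (auto simp: mpoly_on_def)

lemma mpoly_on_mult:
  assumes "F \<in> mpoly_on V" "G \<in> mpoly_on V"
  shows "F * G \<in> mpoly_on V"
  unfolding mpoly_on_def
proof clarify
  fix \<gamma> v assume "\<gamma> \<in> Poly_Mapping.keys (F * G)" and v: "v \<in> Poly_Mapping.keys \<gamma>"
  then obtain \<alpha> \<beta> where "\<gamma> = \<alpha> + \<beta>" "\<alpha> \<in> Poly_Mapping.keys F" "\<beta> \<in> Poly_Mapping.keys G"
    using keys_mult by blast
  then show "v \<in> V" using v keys_add[of \<alpha> \<beta>] assms by (auto simp: mpoly_on_def)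
qed

lemma subring_mpoly_on: "subring_set (mpoly_on V)"
  unfolding subring_set_def
proof (intro conjI ballI)
  show "0 \<in> mpoly_on V" using mpoly_on_const[of 0] by simp
  show "1 \<in> mpoly_on V" using mpoly_on_const[of 1] by simp
  fix F G assume FG: "F \<in> mpoly_on V" "G \<in> mpoly_on V"
  show "F + G \<in> mpoly_on V" "F * G \<in> mpoly_on V" using FG by (auto intro: mpoly_on_add mpoly_on_mult)
  have "mpoly_const (- 1) * F \<in> mpoly_on V" using FG(1) mpoly_on_const by (intro mpoly_on_mult)
  then show "- F \<in> mpoly_on V" by (simp add: const_uminus)
qed

text \<open>Comparing exponents of v on both sides shows that each monomial of U is divisible by the
  power of v. This is the regular sequence property of two coordinates used in
  \<open>height_one_dimension\<close>.\<close>

lemma mpoly_on_mult_cancel: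
  fixes U U' :: "'n::{finite,linorder} mpoly"
  assumes "v \<noteq> w" "mpoly_var w ^ a * U = mpoly_var v ^ b * U'" "U \<in> mpoly_on V"
  obtains U2 where "U2 \<in> mpoly_on V" "U = mpoly_var v ^ b * U2"
proof -
  have shift: "mpoly_var w ^ a * F = Poly_Mapping.single (Poly_Mapping.single w a) 1 * F" for w a and F :: "'n mpoly"
    unfolding single_1_eq_prod by simp
  have lk: "Poly_Mapping.lookup (mpoly_var w ^ a * F) (Poly_Mapping.single w a + \<beta>) = Poly_Mapping.lookup F \<beta>" for w a \<beta> and F :: "'n mpoly"
    unfolding shift
  proof (induction F rule: mpoly_induct)
    case (add f g) then show ?case by (simp add: distrib_left lookup_add)
  qed (auto simp: mult_single lookup_single when_def)
  have ge: "b \<le> Poly_Mapping.lookup \<alpha> v" if "\<alpha> \<in> Poly_Mapping.keys U" for \<alpha>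
  proof -
    have "Poly_Mapping.single w a + \<alpha> \<in> Poly_Mapping.keys (mpoly_var v ^ b * U')"
      using that lk[of w a U \<alpha>] assms(2) by (simp add: in_keys_iff)
    then obtain \<beta> where "Poly_Mapping.single w a + \<alpha> = Poly_Mapping.single v b + \<beta>"
      using keys_mult[of "Poly_Mapping.single (Poly_Mapping.single v b) 1" U'] unfolding shift
      by (auto split: if_splits)
    then have "Poly_Mapping.lookup (Poly_Mapping.single w a + \<alpha>) v = Poly_Mapping.lookup (Poly_Mapping.single v b + \<beta>) v" by simp
    then show ?thesis using assms(1) by (simp add: lookup_add lookup_single when_def)
  qed
  define U2 where "U2 = (\<Sum>\<alpha>\<in>Poly_Mapping.keys U. Poly_Mapping.single (\<alpha> - Poly_Mapping.single v b) (Poly_Mapping.lookup U \<alpha>))"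
  have "mpoly_var v ^ b * U2 = (\<Sum>\<alpha>\<in>Poly_Mapping.keys U. Poly_Mapping.single \<alpha> (Poly_Mapping.lookup U \<alpha>))"
    unfolding U2_def shift sum_distrib_left
  proof (rule sum.cong[OF refl])
    fix \<alpha> assume "\<alpha> \<in> Poly_Mapping.keys U"
    then have "Poly_Mapping.single v b + (\<alpha> - Poly_Mapping.single v b) = \<alpha>"
      using ge[of \<alpha>] by (intro poly_mapping_eqI) (auto simp: lookup_add lookup_minus lookup_single when_def)
    then show "Poly_Mapping.single (Poly_Mapping.single v b) 1 * Poly_Mapping.single (\<alpha> - Poly_Mapping.single v b) (Poly_Mapping.lookup U \<alpha>)
      = Poly_Mapping.single \<alpha> (Poly_Mapping.lookup U \<alpha>)" by (simp add: mult_single)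
  qed
  then have "U = mpoly_var v ^ b * U2" using mpoly_eq_sum_single[of U] by simp
  moreover have "U2 \<in> mpoly_on V"
    unfolding U2_def
  proof (rule subring_set_sum[OF subring_mpoly_on])
    fix \<alpha> assume "\<alpha> \<in> Poly_Mapping.keys U"
    then have "Poly_Mapping.keys \<alpha> \<subseteq> V" using assms(3) by (auto simp: mpoly_on_def)
    moreover have "Poly_Mapping.keys (\<alpha> - Poly_Mapping.single v b) \<subseteq> Poly_Mapping.keys \<alpha>"
      by (auto simp: in_keys_iff lookup_minus)
    ultimately show "Poly_Mapping.single (\<alpha> - Poly_Mapping.single v b) (Poly_Mapping.lookup U \<alpha>) \<in> mpoly_on V"
      by (auto simp: mpoly_on_def split: if_splits)
  qed
  ultimately show ?thesis using that by blast
qed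

section \<open>Subrings generated by chosen elements, and finite modules over them\<close>

lemma subring_subst_image: "subring_set (subst y ` mpoly_on V)"
  unfolding subring_set_def
proof (intro conjI ballI)
  note S = subring_setD[OF subring_mpoly_on[of V]]
  show "0 \<in> subst y ` mpoly_on V" using S(1) by (force intro: image_eqI[of _ _ 0])
  show "1 \<in> subst y ` mpoly_on V" using S(2) by (force intro: image_eqI[of _ _ 1])
  fix a b assume "a \<in> subst y ` mpoly_on V" "b \<in> subst y ` mpoly_on V"
  then obtain F G where FG: "F \<in> mpoly_on V" "G \<in> mpoly_on V" "a = subst y F" "b = subst y G" by blast
  show "a + b \<in> subst y ` mpoly_on V" using FG S(3) by (auto simp flip: sb.gsubst_add)
  show "a * b \<in> subst y ` mpoly_on V" using FG S(4) by (auto simp flip: sb.gsubst_mult)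
  show "- a \<in> subst y ` mpoly_on V" using FG S(5) by (auto simp flip: sb.gsubst_uminus)
qed

lemma const_in_subst_image: "mpoly_const c \<in> subst y ` mpoly_on V"
  by (rule image_eqI[of _ _ "mpoly_const c"]) (simp_all add: mpoly_on_const)

lemma var_in_subst_image: "v \<in> V \<Longrightarrow> y v \<in> subst y ` mpoly_on V"
  by (rule image_eqI[of _ _ "mpoly_var v"]) (simp_all add: mpoly_on_var)

text \<open>The preimage of the A-submodule that W generates in the quotient by P.\<close>

definition gen_mod :: "'a::comm_ring_1 set \<Rightarrow> 'a set \<Rightarrow> 'a set \<Rightarrow> 'a set" where
  "gen_mod P A W = {f. \<exists>b. (\<forall>w. b w \<in> A) \<and> eqmod P f (\<Sum>w\<in>W. b w * w)}"

context
  fixes P A :: "'a::comm_ring_1 set"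
  assumes P: "Id.subspace P" and A: "subring_set A"
begin

lemma gen_mod_add: "f \<in> gen_mod P A W \<Longrightarrow> g \<in> gen_mod P A W \<Longrightarrow> f + g \<in> gen_mod P A W"
proof -
  assume "f \<in> gen_mod P A W" "g \<in> gen_mod P A W"
  then obtain b c where bc: "\<forall>w. b w \<in> A" "\<forall>w. c w \<in> A" "eqmod P f (\<Sum>w\<in>W. b w * w)" "eqmod P g (\<Sum>w\<in>W. c w * w)"
    by (auto simp: gen_mod_def)
  have "eqmod P (f + g) (\<Sum>w\<in>W. (b w + c w) * w)"
    using eqmod_add[OF P bc(3,4)] by (simp add: distrib_right sum.distrib)
  moreover have "\<forall>w. b w + c w \<in> A" using bc(1,2) subring_setD(3)[OF A] by blast
  ultimately show ?thesis unfolding gen_mod_def by (intro CollectI exI[of _ "\<lambda>w. b w + c w"]) simp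
qed

lemma gen_mod_mult: "a \<in> A \<Longrightarrow> f \<in> gen_mod P A W \<Longrightarrow> a * f \<in> gen_mod P A W"
proof -
  assume a: "a \<in> A" and "f \<in> gen_mod P A W"
  then obtain b where b: "\<forall>w. b w \<in> A" "eqmod P f (\<Sum>w\<in>W. b w * w)" by (auto simp: gen_mod_def)
  have "eqmod P (a * f) (\<Sum>w\<in>W. (a * b w) * w)"
    using eqmod_mult[OF P eqmod_refl[OF P] b(2), of a] by (simp add: sum_distrib_left mult.assoc)
  moreover have "\<forall>w. a * b w \<in> A" using b(1) a subring_setD(4)[OF A] by blast
  ultimately show ?thesis unfolding gen_mod_def by (intro CollectI exI[of _ "\<lambda>w. a * b w"]) simp
qed

lemma gen_mod_base: "finite W \<Longrightarrow> w \<in> W \<Longrightarrow> w \<in> gen_mod P A W"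
proof -
  assume w: "finite W" "w \<in> W"
  have "(\<Sum>w'\<in>W. (if w' = w then 1 else 0) * w') = (\<Sum>w'\<in>W. if w = w' then w' else 0)"
    by (rule sum.cong) auto
  also have "\<dots> = w" using w by simp
  finally have "(\<Sum>w'\<in>W. (if w' = w then 1 else 0) * w') = w" .
  then show ?thesis unfolding gen_mod_def using subring_setD(1,2)[OF A]
    by (intro CollectI exI[of _ "\<lambda>w'. if w' = w then 1 else 0"]) (simp add: eqmod_refl[OF P])
qed

lemma gen_mod_eqmod: "eqmod P f g \<Longrightarrow> g \<in> gen_mod P A W \<Longrightarrow> f \<in> gen_mod P A W"
  unfolding gen_mod_def using eqmod_trans[OF P] by blast

lemma gen_mod_0: "0 \<in> gen_mod P A W"
  unfolding gen_mod_def using subring_setD(1)[OF A]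
  by (intro CollectI exI[of _ "\<lambda>_. 0"]) (simp add: eqmod_refl[OF P])

lemma gen_mod_sum: "(\<And>i. i \<in> S \<Longrightarrow> f i \<in> gen_mod P A W) \<Longrightarrow> sum f S \<in> gen_mod P A W"
  by (induction S rule: infinite_finite_induct) (auto simp: gen_mod_0 gen_mod_add)

end

text \<open>R/p is a finite module, generated by W, over the subring generated by the
  \<open>y v\<close> with v in V. The \<open>y v\<close> are made to vanish at the origin because
  \<open>height_one_dimension\<close> compares them with the maximal ideal there.\<close>

definition noether :: "'n::{finite,linorder} mpoly set \<Rightarrow> 'n set \<Rightarrow> ('n \<Rightarrow> 'n mpoly) \<Rightarrow> 'n mpoly set \<Rightarrow> bool" where
  "noether p V y W \<longleftrightarrow> finite W \<and> (\<forall>v. y v \<in> mpow 1) \<and> gen_mod p (subst y ` mpoly_on V) W = UNIV"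

text \<open>An algebraic relation \<open>F\<close> of degree \<open>e\<close> becomes monic in \<open>y v\<close> after subtracting multiples
  of \<open>y v\<close> from the other \<open>y w\<close>; the multiples are read off a point at which the leading form of
  \<open>F\<close> does not vanish.\<close>

lemma noether_step:
  fixes p :: "'n::{finite,linorder} mpoly set"
  assumes p: "prime_id p" and N: "noether p V y W" and F: "F \<in> mpoly_on V" "F \<noteq> 0" "subst y F \<in> p"
  shows "\<exists>v\<in>V. \<exists>y' W'. noether p (V - {v}) y' W'"
proof -
  note idp = prime_id_ideal[OF p]
  define e where "e = Max (mdeg ` Poly_Mapping.keys F)"
  have keysF: "Poly_Mapping.keys F \<noteq> {}" using F(2) by simp
  have e_ge: "mdeg \<alpha> \<le> e" if "\<alpha> \<in> Poly_Mapping.keys F" for \<alpha>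
    unfolding e_def using that by (intro Max_ge) auto
  have "e \<in> mdeg ` Poly_Mapping.keys F" unfolding e_def using keysF by (intro Max_in) auto
  then obtain \<alpha>0 where \<alpha>0: "\<alpha>0 \<in> Poly_Mapping.keys F" "mdeg \<alpha>0 = e" by auto
  define T where "T = {\<alpha> \<in> Poly_Mapping.keys F. mdeg \<alpha> = e}"
  have finT: "finite T" by (simp add: T_def)
  define Fe where "Fe = (\<Sum>\<alpha>\<in>T. Poly_Mapping.single \<alpha> (Poly_Mapping.lookup F \<alpha>))"
  have evFe: "mpoly_eval a Fe = (\<Sum>\<alpha>\<in>T. Poly_Mapping.lookup F \<alpha> * monomial_eval a \<alpha>)" for a
    by (simp add: Fe_def)
  have "Poly_Mapping.lookup Fe \<alpha>0 = Poly_Mapping.lookup F \<alpha>0"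
    using \<alpha>0 finT by (simp add: Fe_def lookup_sum lookup_single when_def T_def)
  then have "Fe \<noteq> 0" using \<alpha>0(1) by (auto simp: in_keys_iff)
  then obtain a where a: "mpoly_eval a Fe \<noteq> 0" by (rule nonzero_mpoly_nonvanishing)
  have const_p: "c = 0" if "mpoly_const c \<in> p" for c
    using Id.subspace_scale[OF idp that, of "mpoly_const (inverse c)"] const_inverse[of c] prime_id_1[OF p]
    by metis
  have e_pos: "e > 0"
  proof (rule ccontr)
    assume "\<not> e > 0"
    then have "Poly_Mapping.keys F \<subseteq> {0}" using e_ge by fastforce
    then have "F = mpoly_const (Poly_Mapping.lookup F 0)"
      by (intro poly_mapping_eqI) (auto simp: lookup_const in_keys_iff)
    then have "mpoly_const (Poly_Mapping.lookup F 0) \<in> p" using F(3) sb.gsubst_const by metis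
    then show False using const_p F(2) \<open>F = _\<close> by (metis const_0)
  qed
  obtain v where v: "v \<in> V" "a v \<noteq> 0"
  proof (rule ccontr)
    assume "\<not> thesis"
    then have av: "a v = 0" if "v \<in> V" for v using that \<open>\<And>v. v \<in> V \<Longrightarrow> a v \<noteq> 0 \<Longrightarrow> thesis\<close> by blast
    have "monomial_eval a \<alpha> = 0" if "\<alpha> \<in> T" for \<alpha>
    proof -
      have "\<alpha> \<noteq> 0" using that e_pos by (auto simp: T_def)
      then obtain w where w: "w \<in> Poly_Mapping.keys \<alpha>" by (metis all_not_in_conv keys_eq_empty)
      then have "a w = 0" using that F(1) av by (auto simp: T_def mpoly_on_def)
      then show ?thesis using w unfolding monomial_eval_def
        by (intro prod_zero bexI[of _ w]) (auto simp: in_keys_iff)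
    qed
    then show False using a by (simp add: evFe)
  qed
  \<comment> \<open>Dividing by \<open>a v\<close> gives c the value 1 at v, so that
    \<open>y' v\<close> is zero and v drops out. The leading form is homogeneous, so its value
    \<open>K\<close> at c is still nonzero.\<close>
  define c where "c w = a w / a v" for w
  define K where "K = mpoly_eval c Fe"
  have "monomial_eval c \<alpha> = monomial_eval a \<alpha> / a v ^ mdeg \<alpha>" for \<alpha>
    by (simp add: monomial_eval_def c_def power_divide prod_dividef mdeg_def power_sum)
  then have "K = mpoly_eval a Fe / a v ^ e"
    unfolding K_def evFe sum_divide_distrib by (intro sum.cong) (auto simp: T_def)
  then have K: "K \<noteq> 0" using a v(2) by simp
  define Y where "Y = y v"
  define y' where "y' w = y w - mpoly_const (c w) * Y" for w
  have y_eq: "y w = y' w + mpoly_const (c w) * Y" for w by (simp add: y'_def)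
  have y'v: "y' v = 0" using v(2) by (simp add: y'_def Y_def c_def)
  define B where "B = subst y' ` mpoly_on (V - {v})"
  have B: "subring_set B" unfolding B_def by (rule subring_subst_image)
  note Bs = subring_setD[OF B]
  have B_const: "mpoly_const c \<in> B" for c unfolding B_def by (rule const_in_subst_image)
  have B_y: "y' w \<in> B" if "w \<in> V" for w
    using that y'v Bs(1) var_in_subst_image[of w "V - {v}" y'] by (cases "w = v") (auto simp: B_def)
  \<comment> \<open>Expressions of degree below i in Y over B; the computations below keep track of
    the top power of Y only.\<close>
  define U where "U i = {\<Sum>j<i. b j * Y ^ j | b. \<forall>j. b j \<in> B}" for i
  have U0: "0 \<in> U i" for i unfolding U_def using Bs(1) by (auto intro!: exI[of _ "\<lambda>_. 0"])
  have U_D: "\<exists>b. f = (\<Sum>j<i. b j * Y ^ j) \<and> (\<forall>j. b j \<in> B)" if "f \<in> U i" for f i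
    using that by (auto simp: U_def)
  have U_add: "f + g \<in> U i" if f: "f \<in> U i" and g: "g \<in> U i" for f g i
  proof -
    obtain b b' where "f = (\<Sum>j<i. b j * Y ^ j)" "g = (\<Sum>j<i. b' j * Y ^ j)" "\<forall>j. b j \<in> B" "\<forall>j. b' j \<in> B"
      using U_D[OF f] U_D[OF g] by blast
    then show ?thesis using Bs(3) unfolding U_def
      by (intro CollectI exI[of _ "\<lambda>j. b j + b' j"]) (auto simp: distrib_right sum.distrib)
  qed
  have U_mult: "s * f \<in> U i" if s: "s \<in> B" and f: "f \<in> U i" for s f i
  proof -
    obtain b where "f = (\<Sum>j<i. b j * Y ^ j)" "\<forall>j. b j \<in> B" using U_D[OF f] by blast
    then show ?thesis using Bs(4) s unfolding U_def
      by (intro CollectI exI[of _ "\<lambda>j. s * b j"]) (auto simp: sum_distrib_left mult.assoc)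
  qed
  have U_Suc: "f + s * Y ^ i \<in> U (Suc i)" if f: "f \<in> U i" and s: "s \<in> B" for f s i
  proof -
    obtain b where "f = (\<Sum>j<i. b j * Y ^ j)" "\<forall>j. b j \<in> B" using U_D[OF f] by blast
    then show ?thesis using s unfolding U_def
      by (intro CollectI exI[of _ "b(i := s)"]) auto
  qed
  have U_up: "f \<in> U (Suc i)" if "f \<in> U i" for f i using U_Suc[OF that Bs(1)] by simp
  have U_mono: "f \<in> U j" if "i \<le> j" "f \<in> U i" for f i j
    using that by (induction j) (auto simp: le_Suc_eq U_up)
  have U_Y: "Y * f \<in> U (Suc i)" if f: "f \<in> U i" for f i
  proof -
    obtain b where b: "f = (\<Sum>j<i. b j * Y ^ j)" "\<forall>j. b j \<in> B" using U_D[OF f] by blast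
    have "(\<Sum>j<Suc i. (case j of 0 \<Rightarrow> 0 | Suc k \<Rightarrow> b k) * Y ^ j) = Y * f"
      unfolding sum.lessThan_Suc_shift b(1) by (simp add: sum_distrib_left ac_simps)
    then show ?thesis using b(2) Bs(1) unfolding U_def
      by (intro CollectI exI[of _ "\<lambda>j. case j of 0 \<Rightarrow> 0 | Suc k \<Rightarrow> b k"]) (auto split: nat.split)
  qed
  \<comment> \<open>After inserting \<open>y w = y' w + c w * Y\<close> the top power of Y in a
    monomial has the value of that monomial at c as its coefficient.\<close>
  have mono: "monomial_eval y \<alpha> - mpoly_const (monomial_eval c \<alpha>) * Y ^ mdeg \<alpha> \<in> U (mdeg \<alpha>)"
    if "Poly_Mapping.keys \<alpha> \<subseteq> V" for \<alpha>
    using that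
  proof (induction "mdeg \<alpha>" arbitrary: \<alpha>)
    case 0
    then have "\<alpha> = 0" by simp
    then show ?case using U0 by simp
  next
    case (Suc n)
    then have "\<alpha> \<noteq> 0" by auto
    then obtain w where w: "w \<in> Poly_Mapping.keys \<alpha>" by (metis all_not_in_conv keys_eq_empty)
    define \<beta> where "\<beta> = \<alpha> - Poly_Mapping.single w 1"
    have ab: "\<alpha> = Poly_Mapping.single w 1 + \<beta>"
      using w by (intro poly_mapping_eqI)
        (auto simp: \<beta>_def lookup_add lookup_minus lookup_single when_def in_keys_iff)
    have "Poly_Mapping.keys \<beta> \<subseteq> Poly_Mapping.keys \<alpha>" by (auto simp: \<beta>_def in_keys_iff lookup_minus)
    then have \<beta>V: "Poly_Mapping.keys \<beta> \<subseteq> V" using Suc.prems by blast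
    have n: "n = mdeg \<beta>" using Suc.hyps(2) by (simp add: ab mdeg_add)
    define u where "u = monomial_eval y \<beta> - mpoly_const (monomial_eval c \<beta>) * Y ^ n"
    have u: "u \<in> U n" using Suc.hyps(1)[OF n \<beta>V] n by (simp add: u_def)
    let ?k = "mpoly_const (monomial_eval c \<beta>)" and ?cw = "mpoly_const (c w)"
    have my: "monomial_eval y \<beta> = ?k * Y ^ n + u" by (simp add: u_def)
    have "monomial_eval y \<alpha> - mpoly_const (monomial_eval c \<alpha>) * Y ^ Suc n
        = (y' w + ?cw * Y) * (?k * Y ^ n + u) - (?cw * ?k) * Y ^ Suc n"
      by (simp add: ab monomial_eval_add const_mult my y_eq[of w])
    also have "\<dots> = (y' w * u + (y' w * ?k) * Y ^ n) + ?cw * (Y * u)"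
      by (simp add: algebra_simps)
    also have "\<dots> \<in> U (Suc n)"
    proof (rule U_add)
      have yw: "y' w \<in> B" using B_y w Suc.prems by blast
      show "y' w * u + (y' w * ?k) * Y ^ n \<in> U (Suc n)"
        by (rule U_Suc[OF U_mult[OF yw u] Bs(4)[OF yw B_const]])
      show "?cw * (Y * u) \<in> U (Suc n)" by (rule U_mult[OF B_const U_Y[OF u]])
    qed
    finally show ?case using Suc.hyps(2) by simp
  qed
  have U_sum: "sum f S \<in> U i" if "\<And>s. s \<in> S \<Longrightarrow> f s \<in> U i" for f i and S :: "('n \<Rightarrow>\<^sub>0 nat) set"
    using that by (induction S rule: infinite_finite_induct) (auto simp: U0 U_add)
  have "subst y F - mpoly_const K * Y ^ e \<in> U e"
  proof -
    let ?g = "\<lambda>\<alpha>. mpoly_const (Poly_Mapping.lookup F \<alpha>) * monomial_eval y \<alpha>"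
    let ?h = "\<lambda>\<alpha>. if mdeg \<alpha> = e then mpoly_const (Poly_Mapping.lookup F \<alpha> * monomial_eval c \<alpha>) * Y ^ e else 0"
    have "(\<Sum>\<alpha>\<in>Poly_Mapping.keys F. ?h \<alpha>) = mpoly_const K * Y ^ e"
      unfolding K_def evFe T_def const_sum sum_distrib_right by (rule sum.inter_filter[symmetric]) simp
    then have "subst y F - mpoly_const K * Y ^ e = (\<Sum>\<alpha>\<in>Poly_Mapping.keys F. ?g \<alpha> - ?h \<alpha>)"
      by (simp add: sb.gsubst_def sum_subtractf)
    also have "\<dots> \<in> U e"
    proof (rule U_sum)
      fix \<alpha> assume \<alpha>: "\<alpha> \<in> Poly_Mapping.keys F"
      then have \<alpha>V: "Poly_Mapping.keys \<alpha> \<subseteq> V" using F(1) by (auto simp: mpoly_on_def)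
      let ?u = "monomial_eval y \<alpha> - mpoly_const (monomial_eval c \<alpha>) * Y ^ mdeg \<alpha>"
      have u: "mpoly_const (Poly_Mapping.lookup F \<alpha>) * ?u \<in> U (mdeg \<alpha>)"
        by (rule U_mult[OF B_const mono[OF \<alpha>V]])
      show "?g \<alpha> - ?h \<alpha> \<in> U e"
      proof (cases "mdeg \<alpha> = e")
        case True
        then show ?thesis using u by (simp add: const_mult right_diff_distrib mult.assoc)
      next
        case False
        then have "Suc (mdeg \<alpha>) \<le> e" using e_ge[OF \<alpha>] by simp
        moreover have "mpoly_const (Poly_Mapping.lookup F \<alpha>) * ?u
            + (mpoly_const (Poly_Mapping.lookup F \<alpha>) * mpoly_const (monomial_eval c \<alpha>)) * Y ^ mdeg \<alpha> \<in> U (Suc (mdeg \<alpha>))"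
          by (rule U_Suc[OF u Bs(4)[OF B_const B_const]])
        ultimately have "mpoly_const (Poly_Mapping.lookup F \<alpha>) * ?u
            + (mpoly_const (Poly_Mapping.lookup F \<alpha>) * mpoly_const (monomial_eval c \<alpha>)) * Y ^ mdeg \<alpha> \<in> U e"
          by (rule U_mono)
        then show ?thesis using False by (simp add: right_diff_distrib mult.assoc)
      qed
    qed
    finally show ?thesis .
  qed
  then have "mpoly_const (- inverse K) * (subst y F - mpoly_const K * Y ^ e) \<in> U e" by (rule U_mult[OF B_const])
  moreover have "Y ^ e - mpoly_const (- inverse K) * (subst y F - mpoly_const K * Y ^ e)
      = mpoly_const (inverse K) * subst y F"
  proof -
    have "Y ^ e - mpoly_const (- inverse K) * (subst y F - mpoly_const K * Y ^ e)
      = Y ^ e + mpoly_const (inverse K) * subst y F - (mpoly_const (inverse K) * mpoly_const K) * Y ^ e"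
      by (simp add: const_uminus algebra_simps)
    then show ?thesis unfolding const_inverse[OF K] by simp
  qed
  ultimately obtain u where u: "u \<in> U e" "eqmod p (Y ^ e) u"
    unfolding eqmod_def using Id.subspace_scale[OF idp F(3)] by metis
  \<comment> \<open>Everything that is congruent to a B-combination of the powers of Y below e. The
    monic relation for \<open>Y ^ e\<close> makes it stable under multiplication by Y.\<close>
  define M where "M = {f. \<exists>g\<in>U e. eqmod p f g}"
  have M_add: "f + g \<in> M" if "f \<in> M" "g \<in> M" for f g
    using that U_add eqmod_add[OF idp] unfolding M_def by blast
  have M_mult: "s * f \<in> M" if "s \<in> B" "f \<in> M" for s f
    using that U_mult eqmod_mult[OF idp eqmod_refl[OF idp]] unfolding M_def by blast
  have U_M: "f \<in> M" if f: "f \<in> U (Suc e)" for f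
  proof -
    obtain b where b: "f = (\<Sum>j<Suc e. b j * Y ^ j)" "\<forall>j. b j \<in> B" using U_D[OF f] by blast
    have "(\<Sum>j<e. b j * Y ^ j) \<in> M" unfolding M_def U_def using b(2) eqmod_refl[OF idp] by blast
    moreover have "b e * Y ^ e \<in> M" using b(2) u by (intro M_mult) (auto simp: M_def)
    ultimately show ?thesis using M_add b(1) by simp
  qed
  have M_Y: "Y * f \<in> M" if f: "f \<in> M" for f
  proof -
    obtain g where g: "g \<in> U e" "eqmod p f g" using f by (auto simp: M_def)
    have "Y * g \<in> M" by (rule U_M[OF U_Y[OF g(1)]])
    then obtain h where "h \<in> U e" "eqmod p (Y * g) h" by (auto simp: M_def)
    moreover have "eqmod p (Y * f) (Y * g)" by (rule eqmod_mult[OF idp eqmod_refl[OF idp] g(2)])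
    ultimately show ?thesis unfolding M_def using eqmod_trans[OF idp] by blast
  qed
  have M_1: "1 \<in> M"
  proof -
    have "0 + 1 * Y ^ 0 \<in> U (Suc 0)" by (rule U_Suc[OF U0 Bs(2)])
    then have "1 \<in> U e" using U_mono[of "Suc 0" e] e_pos by simp
    then show ?thesis unfolding M_def using eqmod_refl[OF idp] by blast
  qed
  \<comment> \<open>The multipliers of M form a ring that contains B and Y, hence every
    \<open>y w\<close> with w in V and the whole old coefficient ring.\<close>
  define C where "C = {s. \<forall>f\<in>M. s * f \<in> M}"
  have C_mult: "s * t \<in> C" if "s \<in> C" "t \<in> C" for s t using that by (auto simp: C_def mult.assoc)
  have C_add: "s + t \<in> C" if "s \<in> C" "t \<in> C" for s t using that M_add by (auto simp: C_def distrib_right)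
  have C_B: "s \<in> C" if "s \<in> B" for s using that M_mult by (auto simp: C_def)
  have C_pow: "s ^ n \<in> C" if "s \<in> C" for s n
    using that C_B[OF Bs(2)] by (induction n) (auto simp: C_mult)
  have C_y: "y w \<in> C" if "w \<in> V" for w
    unfolding y_eq[of w] using C_B[OF B_y[OF that]] C_mult[OF C_B[OF B_const]] M_Y
    by (intro C_add) (auto simp: C_def)
  have CF: "subst y G \<in> C" if G: "G \<in> mpoly_on V" for G
  proof -
    have "monomial_eval y \<alpha> \<in> C" if "\<alpha> \<in> Poly_Mapping.keys G" for \<alpha>
    proof -
      have "y w ^ Poly_Mapping.lookup \<alpha> w \<in> C" for w
      proof (cases "w \<in> V")
        case False
        then have "Poly_Mapping.lookup \<alpha> w = 0"
          using G that by (metis (mono_tags, lifting) in_keys_iff mem_Collect_eq mpoly_on_def subsetD)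
        then show ?thesis using C_B[OF Bs(2)] by simp
      qed (simp add: C_pow C_y)
      moreover have "(\<Prod>w\<in>S. f w) \<in> C" if "\<And>w. f w \<in> C" for S :: "'n set" and f
        using that C_B[OF Bs(2)] by (induction S rule: infinite_finite_induct) (auto simp: C_mult)
      ultimately show ?thesis by (simp add: monomial_eval_def)
    qed
    then have mem: "mpoly_const (Poly_Mapping.lookup G \<alpha>) * monomial_eval y \<alpha> \<in> C" if "\<alpha> \<in> Poly_Mapping.keys G" for \<alpha>
      using C_mult[OF C_B[OF B_const]] that by simp
    have "(\<Sum>\<alpha>\<in>S. f \<alpha>) \<in> C" if "\<And>\<alpha>. \<alpha> \<in> S \<Longrightarrow> f \<alpha> \<in> C" for S :: "('n \<Rightarrow>\<^sub>0 nat) set" and f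
      using that C_B[OF Bs(1)] by (induction S rule: infinite_finite_induct) (auto simp: C_add)
    then show ?thesis unfolding sb.gsubst_def using mem by simp
  qed
  have AM: "subst y G \<in> M" if "G \<in> mpoly_on V" for G
    using CF[OF that] M_1 by (force simp: C_def)
  \<comment> \<open>Generators over a tower: old module generators times the powers of Y below
    e.\<close>
  define W' where "W' = (\<lambda>(w, j). Y ^ j * w) ` (W \<times> {..<e})"
  have W: "finite W" using N by (simp add: noether_def)
  have finW': "finite W'" unfolding W'_def using W by simp
  have M_W': "m * w \<in> gen_mod p B W'" if m: "m \<in> M" and "w \<in> W" for m w
  proof -
    obtain b where b: "eqmod p m (\<Sum>j<e. b j * Y ^ j)" "\<forall>j. b j \<in> B" using m by (auto simp: M_def U_def)
    have "Y ^ j * w \<in> gen_mod p B W'" if "j < e" for j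
      using gen_mod_base[OF idp B finW', of "Y ^ j * w"] that \<open>w \<in> W\<close> by (force simp: W'_def)
    then have "(\<Sum>j<e. b j * (Y ^ j * w)) \<in> gen_mod p B W'"
      using b(2) gen_mod_mult[OF idp B] by (intro gen_mod_sum[OF idp B]) auto
    moreover have "eqmod p (m * w) (\<Sum>j<e. b j * (Y ^ j * w))"
      using eqmod_mult[OF idp b(1) eqmod_refl[OF idp, of w]] by (simp add: sum_distrib_right mult.assoc)
    ultimately show ?thesis using gen_mod_eqmod[OF idp B] by blast
  qed
  have "f \<in> gen_mod p B W'" for f
  proof -
    have "f \<in> gen_mod p (subst y ` mpoly_on V) W" using N by (simp add: noether_def)
    then obtain b where b: "\<forall>w. b w \<in> subst y ` mpoly_on V" "eqmod p f (\<Sum>w\<in>W. b w * w)"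
      by (auto simp: gen_mod_def)
    have "(\<Sum>w\<in>W. b w * w) \<in> gen_mod p B W'"
    proof (rule gen_mod_sum[OF idp B])
      fix w assume "w \<in> W"
      moreover have "b w \<in> M" using b(1) AM by (metis imageE)
      ultimately show "b w * w \<in> gen_mod p B W'" by (intro M_W')
    qed
    then show ?thesis using gen_mod_eqmod[OF idp B b(2)] by blast
  qed
  then have "gen_mod p B W' = UNIV" by blast
  moreover have "y' w \<in> mpow 1" for w
    unfolding y'_def Y_def using N
    by (intro Id.subspace_diff[OF ideal_mpow] Id.subspace_scale[OF ideal_mpow]) (auto simp: noether_def)
  ultimately have "noether p (V - {v}) y' W'" using finW' by (simp add: noether_def B_def)
  then show ?thesis using v(1) by blast
qed

text \<open>The choice V = \<open>UNIV\<close> with the variables themselves is available, so there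
  is one with as few elements in V as possible; an algebraic relation would let
  \<open>noether_step\<close> remove another.\<close>

theorem noether_normalization:
  fixes p :: "'n::{finite,linorder} mpoly set"
  assumes p: "prime_id p"
  obtains V y W where "noether p V y W" "\<And>F. F \<in> mpoly_on V \<Longrightarrow> subst y F \<in> p \<Longrightarrow> F = 0"
proof -
  have "f \<in> gen_mod p (subst mpoly_var ` mpoly_on UNIV) {1}" for f :: "'n mpoly"
  proof -
    have "f \<in> subst mpoly_var ` mpoly_on UNIV" by (auto simp: mpoly_on_def image_iff)
    moreover have "1 \<in> gen_mod p (subst mpoly_var ` mpoly_on UNIV) {1 :: 'n mpoly}"
      by (rule gen_mod_base[OF prime_id_ideal[OF p] subring_subst_image]) auto
    ultimately show ?thesis
      using gen_mod_mult[OF prime_id_ideal[OF p] subring_subst_image, of f mpoly_var UNIV 1 "{1}"] by simp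
  qed
  then have "noether p UNIV mpoly_var {1}"
    using var_in_mpow by (auto simp: noether_def)
  then have "\<exists>V. (\<exists>y W. noether p V y W) \<and> (\<forall>V'. (\<exists>y W. noether p V' y W) \<longrightarrow> card V \<le> card V')"
    using ex_has_least_nat[of "\<lambda>V. \<exists>y W. noether p V y W" UNIV card] by blast
  then obtain V y W where V: "noether p V y W" "\<And>V' y' W'. noether p V' y' W' \<Longrightarrow> card V \<le> card V'" by blast
  have "F = 0" if F: "F \<in> mpoly_on V" "subst y F \<in> p" for F
  proof (rule ccontr)
    assume "F \<noteq> 0"
    then obtain v y' W' where v: "v \<in> V" "noether p (V - {v}) y' W'"
      using noether_step[OF p V(1) F(1) _ F(2)] by blast
    have "card (V - {v}) < card V" using v(1) by (intro card_Diff1_less) auto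
    then show False using V(2)[OF v(2)] by simp
  qed
  then show ?thesis using that V(1) by blast
qed

section \<open>A prime of dimension one at the origin has dimension one\<close>

text \<open>The height meant is that of the maximal ideal of the origin over p: the localization of
  R/p at the origin has dimension one.\<close>

definition height_one :: "'n::{finite,linorder} mpoly set \<Rightarrow> bool" where
  "height_one p \<longleftrightarrow> prime_id p \<and> p \<subset> mpow 1 \<and> (\<forall>q. prime_id q \<longrightarrow> p \<subset> q \<longrightarrow> \<not> q \<subset> mpow 1)"

text \<open>Otherwise some prime over p and f would avoid all products of a power of h with a unit
  at the origin. It would lie in the maximal ideal, contain f and miss h, and thus lie strictly
  between p and the maximal ideal.\<close>

lemma height_one_power_in_ideal:
  fixes p :: "'n::{finite,linorder} mpoly set"
  assumes p: "height_one p" and f: "f \<in> mpow 1" "f \<notin> p" and h: "h \<in> mpow 1"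
  shows "\<exists>g K r. mpoly_eval origin g \<noteq> 0 \<and> eqmod p (g * h ^ K) (f * r)"
proof (rule ccontr)
  assume no: "\<not> ?thesis"
  have pp: "prime_id p" "p \<subset> mpow 1" using p by (auto simp: height_one_def)
  note idp = prime_id_ideal[OF pp(1)]
  let ?\<Sigma> = "{g * h ^ K | g K. mpoly_eval origin g \<noteq> 0}"
  let ?Q = "Id.span (insert f p)"
  have disj: "?Q \<inter> ?\<Sigma> = {}"
  proof (rule ccontr)
    assume "?Q \<inter> ?\<Sigma> \<noteq> {}"
    then obtain g K where g: "mpoly_eval origin g \<noteq> 0" "g * h ^ K \<in> ?Q" by blast
    from g(2) obtain a r where "a \<in> p" "g * h ^ K = a + r * f"
      unfolding span_insert_ideal[OF idp] by blast
    then have "eqmod p (g * h ^ K) (f * r)" by (simp add: eqmod_def mult.commute)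
    then show False using no g(1) by blast
  qed
  have one: "1 \<in> ?\<Sigma>" by (rule CollectI, rule exI[of _ 1], rule exI[of _ 0]) simp
  have mult: "a * b \<in> ?\<Sigma>" if ab: "a \<in> ?\<Sigma>" "b \<in> ?\<Sigma>" for a b
  proof -
    obtain g K g' K' where "a = g * h ^ K" "b = g' * h ^ K'" "mpoly_eval origin g \<noteq> 0" "mpoly_eval origin g' \<noteq> 0"
      using ab by blast
    then show ?thesis by (intro CollectI exI[of _ "g * g'"] exI[of _ "K + K'"]) (auto simp: power_add ac_simps)
  qed
  have "\<exists>P. prime_id P \<and> ?Q \<subseteq> P \<and> P \<inter> ?\<Sigma> = {}"
    by (rule prime_avoiding_exists[OF Id.subspace_span one mult disj]) iprover+
  then obtain P where P: "prime_id P" "?Q \<subseteq> P" "P \<inter> ?\<Sigma> = {}" by blast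
  have "h \<notin> P" using P(3) by (force intro: exI[of _ 1])
  moreover have "P \<subseteq> mpow 1"
  proof
    fix g assume "g \<in> P"
    then have "g * h ^ 0 \<notin> ?\<Sigma>" using P(3) by auto
    then have "\<not> mpoly_eval origin g \<noteq> 0" by blast
    then show "g \<in> mpow 1" by (simp add: mpow_Suc_0_iff)
  qed
  moreover have "f \<in> P" "p \<subseteq> P" using P(2) Id.span_superset[of "insert f p"] by auto
  ultimately show False using p P(1) f(2) h by (auto simp: height_one_def)
qed

text \<open>The powers of an element a of q2 live in a finite-dimensional space modulo q, so a is
  algebraic and congruent to a constant d. As q2 is proper, d is zero and a lies in q.\<close>

lemma prime_with_small_quotient_maximal:
  fixes q :: "'n::{finite,linorder} mpoly set"
  assumes q: "prime_id q" and W: "finite W" and gen: "\<And>f. \<exists>c. eqmod q f (\<Sum>w\<in>W. mpoly_const (c w) * w)"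
    and q2: "prime_id q2" "q \<subseteq> q2"
  shows "q2 = q"
proof (rule ccontr)
  assume "q2 \<noteq> q"
  then obtain a where a: "a \<in> q2" "a \<notin> q" using q2(2) by blast
  note idq = prime_id_ideal[OF q]
  have "\<forall>i. \<exists>c. eqmod q (a ^ i) (\<Sum>w\<in>W. mpoly_const (c w) * w)" using gen by blast
  from choice[OF this] obtain c where c: "\<And>i. eqmod q (a ^ i) (\<Sum>w\<in>W. mpoly_const (c i w) * w)" by blast
  have "\<exists>b. (\<forall>k. b k \<in> (UNIV :: complex set)) \<and> (\<exists>k\<in>{..card W}. b k \<noteq> 0) \<and>
      (\<forall>w\<in>W. (\<Sum>i\<in>{..card W}. b i * c i w) = 0)"
    by (rule dependent_rows[OF W]) (simp_all add: subring_set_def)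
  then obtain b where b: "\<exists>k\<in>{..card W}. b k \<noteq> 0" "\<forall>w\<in>W. (\<Sum>i\<in>{..card W}. b i * c i w) = 0"
    by blast
  have "eqmod q (\<Sum>i\<le>card W. mpoly_const (b i) * a ^ i) (\<Sum>i\<le>card W. mpoly_const (b i) * (\<Sum>w\<in>W. mpoly_const (c i w) * w))"
    by (intro eqmod_sum eqmod_mult eqmod_refl idq c)
  also have "(\<Sum>i\<le>card W. mpoly_const (b i) * (\<Sum>w\<in>W. mpoly_const (c i w) * w)) = (\<Sum>w\<in>W. mpoly_const (\<Sum>i\<le>card W. b i * c i w) * w)"
    unfolding sum_distrib_left const_sum sum_distrib_right const_mult
    by (subst sum.swap) (simp add: mult.assoc)
  also have "\<dots> = 0" using b(2) by simp
  finally have "(\<Sum>i\<le>card W. mpoly_const (b i) * a ^ i) \<in> q" by (simp add: eqmod_0_iff)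
  then obtain d where d: "a - mpoly_const d \<in> q" using b(1) prime_algebraic_element[OF q, of "{..card W}"] by blast
  have "a - (a - mpoly_const d) \<in> q2" using Id.subspace_diff[OF prime_id_ideal[OF q2(1)] a(1)] d q2(2) by blast
  then have "mpoly_const (inverse d) * mpoly_const d \<in> q2" using Id.subspace_scale[OF prime_id_ideal[OF q2(1)]] by simp
  then have "d = 0" using const_inverse[of d] prime_id_1[OF q2(1)] by metis
  then show False using d a(2) by simp
qed

text \<open>This transfers one-dimensionality from the origin to all of the zero set of p; q1 need
  not lie under the origin. R/p is finite over the polynomial ring in the \<open>y v\<close>. With
  at most one variable, every larger prime has a finite-dimensional quotient and is maximal. With
  two, powers of both would be multiples of f up to units at the origin; as they form a regular
  sequence on a free module that contains D R/p, this puts D locally into every power of (f), which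
  is impossible in a Noetherian domain with f in the maximal ideal.\<close>

theorem height_one_dimension:
  fixes p q1 q2 :: "'n::{finite,linorder} mpoly set"
  assumes p: "height_one p" and q1: "prime_id q1" "p \<subset> q1" and q2: "prime_id q2" "q1 \<subseteq> q2"
  shows "q2 = q1"
proof -
  have pp: "prime_id p" "p \<subset> mpow 1" using p by (auto simp: height_one_def)
  note idp = prime_id_ideal[OF pp(1)] and idq1 = prime_id_ideal[OF q1(1)]
  obtain V y W where N: "noether p V y W" and indep: "\<And>F. F \<in> mpoly_on V \<Longrightarrow> subst y F \<in> p \<Longrightarrow> F = 0"
    using noether_normalization[OF pp(1)] by metis
  have W: "finite W" using N by (simp add: noether_def)
  define A where "A = subst y ` mpoly_on V"
  have A: "subring_set A" unfolding A_def by (rule subring_subst_image)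
  note As = subring_setD[OF A]
  have A_const: "mpoly_const c \<in> A" for c unfolding A_def by (rule const_in_subst_image)
  have Ap: "a = 0" if a: "a \<in> A" "a \<in> p" for a
  proof -
    obtain F where F: "F \<in> mpoly_on V" "a = subst y F" using a(1) by (auto simp: A_def)
    then have "F = 0" using indep a(2) by blast
    then show ?thesis using F(2) by simp
  qed
  have gen: "f \<in> gen_mod p A W" for f using N by (auto simp: noether_def A_def)
  consider (two) v1 v2 where "v1 \<in> V" "v2 \<in> V" "v1 \<noteq> v2" | (one) v0 where "V \<subseteq> {v0}"
    by (metis insertCI subsetI)
  then show ?thesis
  proof cases
    case (one v0)
    note v0 = one
    obtain a where a: "a \<in> q1" "a \<notin> p" using q1(2) by blast
    have "\<forall>i. \<exists>c. (\<forall>w. c w \<in> A) \<and> eqmod p (a ^ i) (\<Sum>w\<in>W. c w * w)" using gen by (simp add: gen_mod_def)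
    from choice[OF this] obtain c where c: "\<And>i w. c i w \<in> A" "\<And>i. eqmod p (a ^ i) (\<Sum>w\<in>W. c i w * w)"
      by blast
    \<comment> \<open>The powers of a up to exponent \<open>card W\<close> have one member more than
      there are module generators, so they are dependent over A.\<close>
    have "\<exists>b. (\<forall>i. b i \<in> A) \<and> (\<exists>i\<in>{..card W}. b i \<noteq> 0) \<and> (\<forall>w\<in>W. (\<Sum>i\<in>{..card W}. b i * c i w) = 0)"
      by (rule dependent_rows[OF W _ _ A c(1)]) simp_all
    then obtain b where b: "\<forall>i. b i \<in> A" "\<exists>i\<in>{..card W}. b i \<noteq> 0" "\<forall>w\<in>W. (\<Sum>i\<in>{..card W}. b i * c i w) = 0"
      by blast
    have "eqmod p (\<Sum>i\<le>card W. b i * a ^ i) (\<Sum>i\<le>card W. b i * (\<Sum>w\<in>W. c i w * w))"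
      by (intro eqmod_sum eqmod_mult eqmod_refl idp c)
    also have "(\<Sum>i\<le>card W. b i * (\<Sum>w\<in>W. c i w * w)) = (\<Sum>w\<in>W. (\<Sum>i\<le>card W. b i * c i w) * w)"
      unfolding sum_distrib_left sum_distrib_right by (subst sum.swap) (simp add: mult.assoc)
    also have "\<dots> = 0" using b(3) by simp
    finally have rel: "(\<Sum>i\<le>card W. b i * a ^ i) \<in> p" by (simp add: eqmod_0_iff)
    \<comment> \<open>Cancelling the lowest power of a leaves a relation whose constant term
      \<open>b i0\<close> is nonzero and lies in q1.\<close>
    define i0 where "i0 = (LEAST i. b i \<noteq> 0)"
    obtain i1 where i1: "i1 \<le> card W" "b i1 \<noteq> 0" using b(2) by auto
    have i0: "b i0 \<noteq> 0" "i0 \<le> card W" "\<And>i. i < i0 \<Longrightarrow> b i = 0"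
    proof -
      show "b i0 \<noteq> 0" unfolding i0_def by (rule LeastI[of "\<lambda>i. b i \<noteq> 0", OF i1(2)])
      show "i0 \<le> card W"
        unfolding i0_def by (rule order_trans[OF Least_le[of "\<lambda>i. b i \<noteq> 0", OF i1(2)] i1(1)])
      show "b i = 0" if "i < i0" for i using not_less_Least[OF that[unfolded i0_def]] by simp
    qed
    have "(\<Sum>i\<le>card W. b i * a ^ i) = (\<Sum>i\<in>{i0..card W}. b i * a ^ i)"
      by (rule sum.mono_neutral_right) (use i0(3) in auto)
    also have "\<dots> = (\<Sum>i\<in>{i0..card W}. a ^ i0 * (b i * a ^ (i - i0)))"
      by (rule sum.cong) (auto simp: mult.left_commute simp flip: power_add)
    also have "\<dots> = a ^ i0 * (\<Sum>i\<in>{i0..card W}. b i * a ^ (i - i0))" by (simp add: sum_distrib_left)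
    finally have "a ^ i0 * (\<Sum>i\<in>{i0..card W}. b i * a ^ (i - i0)) \<in> p" using rel by simp
    then have "(\<Sum>i\<in>{i0..card W}. b i * a ^ (i - i0)) \<in> p"
      unfolding prime_id_mult[OF pp(1)] using prime_id_power[OF pp(1)] a(2) by blast
    moreover have "(\<Sum>i\<in>{i0..card W}. b i * a ^ (i - i0)) = b i0 + (\<Sum>i\<in>{i0<..card W}. b i * a ^ (i - i0))"
      using i0(2) by (simp add: sum.head)
    moreover have "(\<Sum>i\<in>{i0<..card W}. b i * a ^ (i - i0)) \<in> q1"
    proof (rule Id.subspace_sum[OF idq1])
      fix i assume "i \<in> {i0<..card W}"
      then obtain k where "i - i0 = Suc k" by (metis Suc_diff_Suc greaterThanAtMost_iff)
      then have "b i * a ^ (i - i0) = (b i * a ^ k) * a" by (simp add: mult.assoc mult.commute)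
      then show "b i * a ^ (i - i0) \<in> q1" using Id.subspace_scale[OF idq1 a(1)] by metis
    qed
    ultimately have bq: "b i0 \<in> q1"
      using q1(2) Id.subspace_diff[OF idq1, of "b i0 + (\<Sum>i\<in>{i0<..card W}. b i * a ^ (i - i0))"] by fastforce
    obtain F where F: "F \<in> mpoly_on V" "b i0 = subst y F" using b(1) by (auto simp: A_def)
    have keysF: "\<alpha> = Poly_Mapping.single v0 (Poly_Mapping.lookup \<alpha> v0)" if "\<alpha> \<in> Poly_Mapping.keys F" for \<alpha>
    proof (rule poly_mapping_eqI)
      fix w
      have "w \<in> Poly_Mapping.keys \<alpha> \<Longrightarrow> w = v0" using that F(1) v0 by (auto simp: mpoly_on_def)
      then show "Poly_Mapping.lookup \<alpha> w = Poly_Mapping.lookup (Poly_Mapping.single v0 (Poly_Mapping.lookup \<alpha> v0)) w"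
        by (auto simp: lookup_single when_def in_keys_iff)
    qed
    \<comment> \<open>\<open>b i0\<close> is a polynomial in the single generator
      \<open>y v0\<close>; since it lies in q1, the generator is congruent to a constant modulo
      q1.\<close>
    define P where "P = (\<Sum>\<alpha>\<in>Poly_Mapping.keys F. Polynomial.monom (Poly_Mapping.lookup F \<alpha>) (Poly_Mapping.lookup \<alpha> v0))"
    have "monomial_eval y \<alpha> = y v0 ^ Poly_Mapping.lookup \<alpha> v0" if "\<alpha> \<in> Poly_Mapping.keys F" for \<alpha>
      using monomial_eval_single[of y v0 "Poly_Mapping.lookup \<alpha> v0"] keysF[OF that] by simp
    then have "subst y F = pev P (y v0)" by (simp add: sb.gsubst_def P_def pev_sum pev_monom)
    moreover have "P \<noteq> 0"
    proof
      assume "P = 0"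
      have "F \<noteq> 0" using F(2) i0(1) by auto
      then obtain \<alpha> where \<alpha>: "\<alpha> \<in> Poly_Mapping.keys F" by (metis all_not_in_conv keys_eq_empty)
      have "Polynomial.coeff P (Poly_Mapping.lookup \<alpha> v0) = (\<Sum>\<beta>\<in>Poly_Mapping.keys F. if \<beta> = \<alpha> then Poly_Mapping.lookup F \<beta> else 0)"
        unfolding P_def coeff_sum
      proof (rule sum.cong[OF refl])
        fix \<beta> assume "\<beta> \<in> Poly_Mapping.keys F"
        then have "Poly_Mapping.lookup \<beta> v0 = Poly_Mapping.lookup \<alpha> v0 \<longleftrightarrow> \<beta> = \<alpha>" using keysF[of \<beta>] keysF[OF \<alpha>] by metis
        then show "Polynomial.coeff (Polynomial.monom (Poly_Mapping.lookup F \<beta>) (Poly_Mapping.lookup \<beta> v0)) (Poly_Mapping.lookup \<alpha> v0)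
          = (if \<beta> = \<alpha> then Poly_Mapping.lookup F \<beta> else 0)" by simp
      qed
      then show False using \<alpha> \<open>P = 0\<close> by (simp add: in_keys_iff)
    qed
    ultimately obtain d where d: "y v0 - mpoly_const d \<in> q1"
      using prime_linear_factor[OF q1(1)] bq F(2) by metis
    have A_const_mod: "\<exists>c. eqmod q1 a (mpoly_const c)" if "a \<in> A" for a
    proof -
      obtain G where G: "G \<in> mpoly_on V" "a = subst y G" using \<open>a \<in> A\<close> by (auto simp: A_def)
      have yd: "eqmod q1 (y v0) (mpoly_const d)" using d by (simp add: eqmod_def)
      have "eqmod q1 (subst y G) (\<Sum>\<alpha>\<in>Poly_Mapping.keys G. mpoly_const (Poly_Mapping.lookup G \<alpha>) * mpoly_const (d ^ Poly_Mapping.lookup \<alpha> v0))"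
        unfolding sb.gsubst_def
      proof (intro eqmod_sum eqmod_mult eqmod_refl idq1)
        fix \<alpha> assume \<alpha>: "\<alpha> \<in> Poly_Mapping.keys G"
        have "\<alpha> = Poly_Mapping.single v0 (Poly_Mapping.lookup \<alpha> v0)"
        proof (rule poly_mapping_eqI)
          fix w
          have "w \<in> Poly_Mapping.keys \<alpha> \<Longrightarrow> w = v0" using \<alpha> G(1) v0 by (auto simp: mpoly_on_def)
          then show "Poly_Mapping.lookup \<alpha> w = Poly_Mapping.lookup (Poly_Mapping.single v0 (Poly_Mapping.lookup \<alpha> v0)) w"
            by (auto simp: lookup_single when_def in_keys_iff)
        qed
        then have "monomial_eval y \<alpha> = y v0 ^ Poly_Mapping.lookup \<alpha> v0"
          using monomial_eval_single[of y v0 "Poly_Mapping.lookup \<alpha> v0"] by simp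
        then show "eqmod q1 (monomial_eval y \<alpha>) (mpoly_const (d ^ Poly_Mapping.lookup \<alpha> v0))"
          using eqmod_power[OF idq1 yd] by (simp add: const_power)
      qed
      then show ?thesis unfolding const_mult[symmetric] const_sum[symmetric] G(2) by blast
    qed
    show ?thesis
    proof (rule prime_with_small_quotient_maximal[OF q1(1) W _ q2])
      fix f
      obtain b where b: "\<forall>w. b w \<in> A" "eqmod p f (\<Sum>w\<in>W. b w * w)" using gen[of f] by (auto simp: gen_mod_def)
      then obtain c where c: "\<And>w. eqmod q1 (b w) (mpoly_const (c w))" using A_const_mod by metis
      have "eqmod q1 f (\<Sum>w\<in>W. b w * w)" using b(2) q1(2) by (auto simp: eqmod_def)
      moreover have "eqmod q1 (\<Sum>w\<in>W. b w * w) (\<Sum>w\<in>W. mpoly_const (c w) * w)"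
        by (intro eqmod_sum eqmod_mult eqmod_refl idq1 c)
      ultimately show "\<exists>c. eqmod q1 f (\<Sum>w\<in>W. mpoly_const (c w) * w)" using eqmod_trans[OF idq1] by blast
    qed
  next
    case (two v1 v2)
    note v = two
    obtain f where f: "f \<in> mpow 1" "f \<notin> p" using pp(2) by blast
    have ym: "y v \<in> mpow 1" for v using N by (simp add: noether_def)
    have yp: "y v \<notin> p" if "v \<in> V" for v
    proof
      assume "y v \<in> p"
      then have "mpoly_var v = (0 :: 'n mpoly)" using indep[of "mpoly_var v"] mpoly_on_var[OF that] by simp
      then have "Poly_Mapping.lookup (mpoly_var v :: 'n mpoly) (Poly_Mapping.single v 1) = 0" by simp
      then show False by (simp add: mpoly_var_def)
    qed
    obtain g1 K1 r1 where 1: "mpoly_eval origin g1 \<noteq> 0" "eqmod p (g1 * y v1 ^ K1) (f * r1)"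
      using height_one_power_in_ideal[OF p f ym] by blast
    obtain g2 K2 r2 where 2: "mpoly_eval origin g2 \<noteq> 0" "eqmod p (g2 * y v2 ^ K2) (f * r2)"
      using height_one_power_in_ideal[OF p f ym] by blast
    define g where "g = g1 * g2"
    define s1 where "s1 = g2 * r1"
    define s2 where "s2 = g1 * r2"
    have g0: "mpoly_eval origin g \<noteq> 0" using 1 2 by (simp add: g_def)
    have e1: "eqmod p (g * y v1 ^ K1) (f * s1)"
      using eqmod_mult[OF idp eqmod_refl[OF idp, of g2] 1(2)] by (simp add: g_def s1_def ac_simps)
    have e2: "eqmod p (g * y v2 ^ K2) (f * s2)"
      using eqmod_mult[OF idp eqmod_refl[OF idp, of g1] 2(2)] by (simp add: g_def s2_def ac_simps)
    \<comment> \<open>A maximal independent part \<open>W0\<close> of the generators spans a free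
      A-module modulo p, and a common denominator D in A multiplies every element into it.\<close>
    define indepW where "indepW W0 \<longleftrightarrow> (\<forall>b. (\<forall>w. b w \<in> A) \<longrightarrow> (\<Sum>w\<in>W0. b w * w) \<in> p \<longrightarrow> (\<forall>w\<in>W0. b w = 0))" for W0
    have "\<exists>W0\<in>{W0. W0 \<subseteq> W \<and> indepW W0}. \<forall>W1\<in>{W0. W0 \<subseteq> W \<and> indepW W0}. W0 \<subseteq> W1 \<longrightarrow> W0 = W1"
      by (rule finite_has_maximal) (use W in \<open>auto simp: indepW_def intro: exI[of _ "{}"]\<close>)
    then obtain W0 where W0m: "W0 \<in> {W0. W0 \<subseteq> W \<and> indepW W0}"
      "\<forall>W1\<in>{W0. W0 \<subseteq> W \<and> indepW W0}. W0 \<subseteq> W1 \<longrightarrow> W0 = W1" by (rule bexE)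
    have W0: "W0 \<subseteq> W" "indepW W0" using W0m(1) by simp_all
    have W0max: "W0 = W1" if "W1 \<subseteq> W" "indepW W1" "W0 \<subseteq> W1" for W1 using W0m(2) that by simp
    have finW0: "finite W0" using W0(1) W finite_subset by blast
    have "\<exists>d\<in>A. d \<noteq> 0 \<and> d * w \<in> gen_mod p A W0" if w: "w \<in> W" for w
    proof (cases "w \<in> W0")
      case True
      then show ?thesis using gen_mod_base[OF idp A finW0] As(2) by (intro bexI[of _ 1]) auto
    next
      case False
      then have "\<not> indepW (insert w W0)" using W0max[of "insert w W0"] W0(1) w by auto
      then obtain b where b: "\<forall>w. b w \<in> A" "(\<Sum>w\<in>insert w W0. b w * w) \<in> p" "\<exists>w\<in>insert w W0. b w \<noteq> 0"
        unfolding indepW_def by blast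
      have sum: "b w * w + (\<Sum>w\<in>W0. b w * w) \<in> p" using b(2) False finW0 by simp
      have "b w \<noteq> 0"
      proof
        assume "b w = 0"
        then have "\<forall>w\<in>W0. b w = 0" using W0(2) b(1) sum unfolding indepW_def by simp
        then show False using b(3) \<open>b w = 0\<close> by auto
      qed
      moreover have "eqmod p (b w * w) (\<Sum>w\<in>W0. (- b w) * w)"
        using sum by (simp add: eqmod_def sum_negf)
      then have "b w * w \<in> gen_mod p A W0"
        unfolding gen_mod_def using b(1) As(5) by (intro CollectI exI[of _ "\<lambda>w. - b w"]) auto
      ultimately show ?thesis using b(1) by blast
    qed
    then obtain d where d: "\<And>w. w \<in> W \<Longrightarrow> d w \<in> A \<and> d w \<noteq> 0 \<and> d w * w \<in> gen_mod p A W0" by metis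
    define D where "D = (\<Prod>w\<in>W. d w)"
    have DA: "D \<in> A" unfolding D_def using d by (intro subring_set_prod[OF A]) auto
    have D0: "D \<noteq> 0" unfolding D_def using d W by simp
    have Dp: "D \<notin> p" using Ap[OF DA] D0 by blast
    have Dw: "D * w \<in> gen_mod p A W0" if w: "w \<in> W" for w
    proof -
      have "D = d w * (\<Prod>w\<in>W - {w}. d w)" unfolding D_def by (rule prod.remove[OF W w])
      then have "D * w = (\<Prod>w\<in>W - {w}. d w) * (d w * w)" by (simp only: ac_simps)
      moreover have "(\<Prod>w\<in>W - {w}. d w) \<in> A" using d by (intro subring_set_prod[OF A]) auto
      then have "(\<Prod>w\<in>W - {w}. d w) * (d w * w) \<in> gen_mod p A W0"
        using gen_mod_mult[OF idp A] d[OF w] by blast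
      ultimately show ?thesis by (simp only:)
    qed
    have Dall: "\<exists>u. (\<forall>w. u w \<in> A) \<and> eqmod p (D * s) (\<Sum>w\<in>W0. u w * w)" for s
    proof -
      obtain b where b: "\<forall>w. b w \<in> A" "eqmod p s (\<Sum>w\<in>W. b w * w)" using gen[of s] by (auto simp: gen_mod_def)
      have "(\<Sum>w\<in>W. b w * (D * w)) \<in> gen_mod p A W0"
        using gen_mod_mult[OF idp A] b(1) Dw by (intro gen_mod_sum[OF idp A]) auto
      moreover have "eqmod p (D * s) (\<Sum>w\<in>W. b w * (D * w))"
        using eqmod_mult[OF idp eqmod_refl[OF idp, of D] b(2)] by (simp add: sum_distrib_left mult.left_commute)
      ultimately have "D * s \<in> gen_mod p A W0" using gen_mod_eqmod[OF idp A] by blast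
      then show ?thesis by (simp add: gen_mod_def)
    qed
    \<comment> \<open>From \<open>e1\<close> and \<open>e2\<close>, the products of
      \<open>s1 ^ j\<close> with the power of \<open>y v2\<close> and of \<open>s2 ^ j\<close> with
      the power of \<open>y v1\<close> agree modulo p. Their D-multiples have coordinates over
      \<open>W0\<close>, and coprimality of the two powers makes \<open>D * s1 ^ j\<close> divisible
      by the power of \<open>y v1\<close>. Cancelling that power leaves \<open>D * g ^ j\<close>
      divisible by \<open>f ^ j\<close>.\<close>
    have step: "\<exists>z. eqmod p (D * g ^ j) (f ^ j * z)" for j
    proof -
      let ?y1 = "y v1 ^ (K1 * j)" and ?y2 = "y v2 ^ (K2 * j)"
      have e1j: "eqmod p (g ^ j * ?y1) (f ^ j * s1 ^ j)"
        using eqmod_power[OF idp e1, of j] by (simp add: power_mult_distrib power_mult)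
      have e2j: "eqmod p (g ^ j * ?y2) (f ^ j * s2 ^ j)"
        using eqmod_power[OF idp e2, of j] by (simp add: power_mult_distrib power_mult)
      have "eqmod p (?y2 * (f ^ j * s1 ^ j)) (?y2 * (g ^ j * ?y1))"
        by (rule eqmod_sym[OF idp eqmod_mult[OF idp eqmod_refl[OF idp] e1j]])
      moreover have "eqmod p (?y1 * (g ^ j * ?y2)) (?y1 * (f ^ j * s2 ^ j))"
        by (rule eqmod_mult[OF idp eqmod_refl[OF idp] e2j])
      moreover have "?y2 * (g ^ j * ?y1) = ?y1 * (g ^ j * ?y2)" by (simp add: ac_simps)
      ultimately have "eqmod p (?y2 * (f ^ j * s1 ^ j)) (?y1 * (f ^ j * s2 ^ j))"
        by (simp only: eqmod_trans[OF idp])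
      then have "eqmod p (f ^ j * (?y2 * s1 ^ j)) (f ^ j * (?y1 * s2 ^ j))" by (simp add: mult.left_commute)
      moreover have "f ^ j \<notin> p" using f(2) prime_id_power[OF pp(1)] by blast
      ultimately have ss: "eqmod p (?y2 * s1 ^ j) (?y1 * s2 ^ j)" by (rule eqmod_cancel[OF pp(1), rotated])
      obtain u where u: "\<forall>w. u w \<in> A" "eqmod p (D * s1 ^ j) (\<Sum>w\<in>W0. u w * w)" using Dall by blast
      obtain u' where u': "\<forall>w. u' w \<in> A" "eqmod p (D * s2 ^ j) (\<Sum>w\<in>W0. u' w * w)" using Dall by blast
      have "eqmod p (?y2 * (D * s1 ^ j) - ?y1 * (D * s2 ^ j)) (?y2 * (\<Sum>w\<in>W0. u w * w) - ?y1 * (\<Sum>w\<in>W0. u' w * w))"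
        by (intro eqmod_diff eqmod_mult eqmod_refl idp u u')
      moreover have "D * (?y2 * s1 ^ j - ?y1 * s2 ^ j) \<in> p"
        using Id.subspace_scale[OF idp] ss by (simp add: eqmod_def)
      then have "?y2 * (D * s1 ^ j) - ?y1 * (D * s2 ^ j) \<in> p" by (simp add: right_diff_distrib mult.left_commute)
      ultimately have "?y2 * (\<Sum>w\<in>W0. u w * w) - ?y1 * (\<Sum>w\<in>W0. u' w * w) \<in> p"
        using eqmod_mem[OF idp eqmod_sym[OF idp]] by blast
      moreover have "?y2 * (\<Sum>w\<in>W0. u w * w) - ?y1 * (\<Sum>w\<in>W0. u' w * w) = (\<Sum>w\<in>W0. (?y2 * u w - ?y1 * u' w) * w)"
        by (simp add: sum_distrib_left sum_subtractf left_diff_distrib mult.assoc)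
      ultimately have sum0: "(\<Sum>w\<in>W0. (?y2 * u w - ?y1 * u' w) * w) \<in> p" by (simp only:)
      have yA: "y v \<in> A" if "v \<in> V" for v unfolding A_def using that by (rule var_in_subst_image)
      have "?y2 * u w - ?y1 * u' w \<in> A" for w
        using u(1) u'(1) yA[OF v(1)] yA[OF v(2)] As(4,6,7) by meson
      note yyA = this
      have eqw: "?y2 * u w = ?y1 * u' w" if w: "w \<in> W0" for w
      proof -
        have "?y2 * u w - ?y1 * u' w = 0"
          by (rule W0(2)[unfolded indepW_def, rule_format, of "\<lambda>w. ?y2 * u w - ?y1 * u' w" w, OF yyA sum0 w])
        then show ?thesis by simp
      qed
      have "\<exists>u2. u2 \<in> A \<and> u w = ?y1 * u2" if w: "w \<in> W0" for w
      proof -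
        obtain U U' where U: "U \<in> mpoly_on V" "u w = subst y U" "U' \<in> mpoly_on V" "u' w = subst y U'"
          using u(1) u'(1) unfolding A_def by (metis imageE)
        let ?F = "mpoly_var v2 ^ (K2 * j) * U - mpoly_var v1 ^ (K1 * j) * U'"
        have "subst y ?F = 0"
          using eqw[OF w] U by (simp add: sb.gsubst_diff sb.gsubst_mult sb.gsubst_power)
        moreover have "?F \<in> mpoly_on V"
          using U(1,3) v by (intro subring_setD(4,6,7)[OF subring_mpoly_on]) (auto simp: mpoly_on_var)
        ultimately have "?F = 0" using indep Id.subspace_0[OF idp] by metis
        then have "mpoly_var v2 ^ (K2 * j) * U = mpoly_var v1 ^ (K1 * j) * U'" by simp
        then obtain U2 where "U2 \<in> mpoly_on V" "U = mpoly_var v1 ^ (K1 * j) * U2"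
          using mpoly_on_mult_cancel[OF v(3) _ U(1)] by metis
        then show ?thesis using U(2) by (auto simp: A_def sb.gsubst_mult sb.gsubst_power)
      qed
      then obtain u2 where u2: "\<And>w. w \<in> W0 \<Longrightarrow> u w = ?y1 * u2 w" by metis
      define z where "z = (\<Sum>w\<in>W0. u2 w * w)"
      have "(\<Sum>w\<in>W0. u w * w) = ?y1 * z"
        unfolding z_def sum_distrib_left by (rule sum.cong) (simp_all add: u2 mult.assoc)
      then have uz: "eqmod p (D * s1 ^ j) (?y1 * z)" using u(2) by simp
      have "eqmod p (D * (g ^ j * ?y1)) (D * (f ^ j * s1 ^ j))" by (rule eqmod_mult[OF idp eqmod_refl[OF idp] e1j])
      moreover have "eqmod p (f ^ j * (D * s1 ^ j)) (f ^ j * (?y1 * z))" by (rule eqmod_mult[OF idp eqmod_refl[OF idp] uz])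
      moreover have "D * (f ^ j * s1 ^ j) = f ^ j * (D * s1 ^ j)" by (rule mult.left_commute)
      ultimately have "eqmod p (D * (g ^ j * ?y1)) (f ^ j * (?y1 * z))"
        by (simp only: eqmod_trans[OF idp])
      then have "eqmod p (?y1 * (D * g ^ j)) (?y1 * (f ^ j * z))" by (simp add: ac_simps)
      moreover have "?y1 \<notin> p" using yp[OF v(1)] prime_id_power[OF pp(1)] by blast
      ultimately show ?thesis using eqmod_cancel[OF pp(1)] by blast
    qed
    \<comment> \<open>This replaces the Krull intersection theorem. The ideals of those s for which
      \<open>s * f ^ j\<close> is a multiple of D after inverting g increase with j; where they
      become stationary, a power of g turns out to be a multiple of f modulo p, which fails at the
      origin.\<close>
    define C where "C j = {s. \<exists>i t. eqmod p (g ^ i * (s * f ^ j)) (D * t)}" for j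
    have idC: "ideal_of (C j)" for j
      unfolding Id.subspace_def
    proof (intro conjI ballI allI)
      show "0 \<in> C j" unfolding C_def by (intro CollectI exI[of _ 0]) (simp add: eqmod_refl[OF idp])
    next
      fix a b assume "a \<in> C j" "b \<in> C j"
      then obtain i t i' t' where it: "eqmod p (g ^ i * (a * f ^ j)) (D * t)" "eqmod p (g ^ i' * (b * f ^ j)) (D * t')"
        by (auto simp: C_def)
      have "eqmod p (g ^ i' * (g ^ i * (a * f ^ j)) + g ^ i * (g ^ i' * (b * f ^ j))) (g ^ i' * (D * t) + g ^ i * (D * t'))"
        by (intro eqmod_add eqmod_mult eqmod_refl idp it)
      then have "eqmod p (g ^ (i + i') * ((a + b) * f ^ j)) (D * (g ^ i' * t + g ^ i * t'))"
        by (simp add: power_add algebra_simps)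
      then show "a + b \<in> C j" unfolding C_def by blast
    next
      fix c a assume "a \<in> C j"
      then obtain i t where it: "eqmod p (g ^ i * (a * f ^ j)) (D * t)" by (auto simp: C_def)
      have "eqmod p (c * (g ^ i * (a * f ^ j))) (c * (D * t))" by (intro eqmod_mult eqmod_refl idp it)
      then have "eqmod p (g ^ i * (c * a * f ^ j)) (D * (c * t))" by (simp add: ac_simps)
      then show "c * a \<in> C j" unfolding C_def by blast
    qed
    have "incseq C"
    proof (rule incseq_SucI, rule subsetI)
      fix j s assume "s \<in> C j"
      then obtain i t where it: "eqmod p (g ^ i * (s * f ^ j)) (D * t)" by (auto simp: C_def)
      have "eqmod p (f * (g ^ i * (s * f ^ j))) (f * (D * t))" by (intro eqmod_mult eqmod_refl idp it)
      then have "eqmod p (g ^ i * (s * f ^ Suc j)) (D * (f * t))" by (simp add: ac_simps)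
      then show "s \<in> C (Suc j)" unfolding C_def by blast
    qed
    then obtain n where n: "\<And>k. C k \<subseteq> C n" using ideal_chain_stabilizes[of C, OF idC] by blast
    obtain z where z: "eqmod p (D * g ^ Suc n) (f ^ Suc n * z)" using step by blast
    have "eqmod p (g ^ 0 * (z * f ^ Suc n)) (D * g ^ Suc n)"
      using eqmod_sym[OF idp z] by (simp add: mult.commute)
    then have "z \<in> C (Suc n)" unfolding C_def by blast
    then have "z \<in> C n" using n by blast
    then obtain i t where it: "eqmod p (g ^ i * (z * f ^ n)) (D * t)" by (auto simp: C_def)
    have "eqmod p (f * (D * t)) (f * (g ^ i * (z * f ^ n)))"
      by (rule eqmod_sym[OF idp eqmod_mult[OF idp eqmod_refl[OF idp] it]])
    moreover have "eqmod p (g ^ i * (f ^ Suc n * z)) (g ^ i * (D * g ^ Suc n))"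
      by (rule eqmod_mult[OF idp eqmod_refl[OF idp] eqmod_sym[OF idp z]])
    moreover have "f * (g ^ i * (z * f ^ n)) = g ^ i * (f ^ Suc n * z)" by (simp add: ac_simps)
    ultimately have "eqmod p (f * (D * t)) (g ^ i * (D * g ^ Suc n))" by (simp only: eqmod_trans[OF idp])
    then have "eqmod p (D * (f * t)) (D * (g ^ i * g ^ Suc n))" by (simp add: mult.left_commute)
    then have "eqmod p (f * t) (g ^ i * g ^ Suc n)" using Dp by (rule eqmod_cancel[OF pp(1), rotated])
    then have "f * t - g ^ i * g ^ Suc n \<in> mpow 1" using pp(2) by (auto simp: eqmod_def)
    then show ?thesis using f(1) g0 by (simp add: mpow_Suc_0_iff)
  qed
qed

section \<open>The local ring at the origin\<close>

lemma mpoly_ring_simps [simp]: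
  "carrier mpoly_ring = UNIV" "x \<otimes>\<^bsub>mpoly_ring\<^esub> y = x * y" "x \<oplus>\<^bsub>mpoly_ring\<^esub> y = x + y"
  "\<one>\<^bsub>mpoly_ring\<^esub> = 1" "\<zero>\<^bsub>mpoly_ring\<^esub> = 0"
  by (simp_all add: mpoly_ring_def ring_of_type_algebra_def)

lemma cring_mpoly_ring: "cring (mpoly_ring :: 'n mpoly ring)"
  unfolding mpoly_ring_def by (rule cring_from_type_algebra)

lemma ideal_mpoly_ring_iff: "ideal Q (mpoly_ring :: 'n mpoly ring) \<longleftrightarrow> ideal_of Q"
proof
  interpret M: cring "mpoly_ring :: 'n mpoly ring" by (rule cring_mpoly_ring)
  {
    assume "ideal Q (mpoly_ring :: 'n mpoly ring)"
    then interpret ideal Q "mpoly_ring :: 'n mpoly ring" .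
    show "ideal_of Q"
      unfolding Id.subspace_def using zero_closed a_closed I_l_closed by auto
  next
    assume Q: "ideal_of Q"
    show "ideal Q (mpoly_ring :: 'n mpoly ring)"
    proof (rule idealI[OF M.ring_axioms])
      show "subgroup Q (add_monoid (mpoly_ring :: 'n mpoly ring))"
      proof (rule M.add.subgroupI)
        show "Q \<noteq> {}" using Id.subspace_0[OF Q] by blast
        fix a assume a: "a \<in> Q"
        have "\<ominus>\<^bsub>mpoly_ring\<^esub> a = - a" by (rule M.minus_equality) auto
        then show "\<ominus>\<^bsub>mpoly_ring\<^esub> a \<in> Q" using Id.subspace_neg[OF Q a] by simp
      next
        fix a b assume "a \<in> Q" "b \<in> Q"
        then show "a \<oplus>\<^bsub>mpoly_ring\<^esub> b \<in> Q" using Id.subspace_add[OF Q] by simp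
      qed simp
    next
      fix a x assume a: "a \<in> Q"
      show "x \<otimes>\<^bsub>mpoly_ring\<^esub> a \<in> Q" using Id.subspace_scale[OF Q a] by simp
      show "a \<otimes>\<^bsub>mpoly_ring\<^esub> x \<in> Q" using Id.subspace_scale[OF Q a, of x] by (simp add: mult.commute[of a x])
    qed
  }
qed

lemma max_ideal_eq: "max_ideal = (mpow 1 :: 'n::finite mpoly set)"
proof
  interpret M: cring "mpoly_ring :: 'n mpoly ring" by (rule cring_mpoly_ring)
  show "max_ideal \<subseteq> (mpow 1 :: 'n mpoly set)"
    unfolding max_ideal_def
  proof (rule M.genideal_minimal)
    show "ideal (mpow 1) (mpoly_ring :: 'n mpoly ring)" by (simp only: ideal_mpoly_ring_iff ideal_mpow)
    show "range mpoly_var \<subseteq> (mpow 1 :: 'n mpoly set)" using var_in_mpow by blast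
  qed
  have "ideal (max_ideal :: 'n mpoly set) mpoly_ring"
    unfolding max_ideal_def by (rule M.genideal_ideal) simp
  moreover have "range mpoly_var \<subseteq> (max_ideal :: 'n mpoly set)"
    unfolding max_ideal_def by (rule M.genideal_self) simp
  ultimately show "mpow 1 \<subseteq> (max_ideal :: 'n mpoly set)"
    unfolding mpow_1_eq ideal_mpoly_ring_iff by (intro Id.span_minimal)
qed

lemma ideal_prod_eq:
  fixes A B :: "'n mpoly set"
  assumes "ideal_of A" "ideal_of B"
  shows "ideal_prod mpoly_ring A B = Id.span {a * b | a b. a \<in> A \<and> b \<in> B}" (is "_ = Id.span ?S")
proof
  show "ideal_prod mpoly_ring A B \<subseteq> Id.span ?S"
  proof
    fix x assume "x \<in> ideal_prod mpoly_ring A B"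
    then show "x \<in> Id.span ?S"
    proof induction
      case (prod i j)
      then show ?case by (intro Id.span_base) auto
    next
      case (sum s1 s2)
      then show ?case by (simp add: Id.span_add)
    qed
  qed
  show "Id.span ?S \<subseteq> ideal_prod mpoly_ring A B"
  proof
    fix x assume "x \<in> Id.span ?S"
    then show "x \<in> ideal_prod mpoly_ring A B"
    proof (induction rule: Id.span_induct_alt)
      case base
      have "0 \<otimes>\<^bsub>mpoly_ring\<^esub> 0 \<in> ideal_prod mpoly_ring A B"
        using assms by (intro ideal_prod.prod) (auto simp: Id.subspace_0)
      then show ?case by simp
    next
      case (step c x y)
      then obtain a b where ab: "x = a * b" "a \<in> A" "b \<in> B" by blast
      have "(c * a) \<otimes>\<^bsub>mpoly_ring\<^esub> b \<in> ideal_prod mpoly_ring A B"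
        using ab Id.subspace_scale[OF assms(1)] by (intro ideal_prod.prod)
      then have "(c * a) \<otimes>\<^bsub>mpoly_ring\<^esub> b \<oplus>\<^bsub>mpoly_ring\<^esub> y \<in> ideal_prod mpoly_ring A B"
        using step(2) by (rule ideal_prod.sum)
      then show ?case by (simp add: ab(1) mult.assoc)
    qed
  qed
qed

lemma max_ideal_power: "max_ideal [^]\<^bsub>ideals_set mpoly_ring\<^esub> (k :: nat) = (mpow k :: 'n::finite mpoly set)"
proof (induction k)
  case 0
  show ?case by (simp add: nat_pow_def ideals_set_def)
next
  case (Suc k)
  have "max_ideal [^]\<^bsub>ideals_set mpoly_ring\<^esub> Suc k = ideal_prod mpoly_ring (mpow k) (mpow 1 :: 'n mpoly set)"
    using Suc by (simp add: nat_pow_def ideals_set_def max_ideal_eq)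
  also have "\<dots> = mpow (k + 1)" by (simp only: ideal_prod_eq ideal_mpow mpow_add_eq)
  finally show ?case by simp
qed

text \<open>The extension of an ideal to the local ring, written out as fractions; see
  \<open>extend_ideal_eq\<close>.\<close>

definition fracs :: "'n::{finite,linorder} mpoly set \<Rightarrow> 'n mpoly fract set" where
  "fracs Q = {Fract f g | f g. f \<in> Q \<and> mpoly_eval origin g \<noteq> 0}"

lemma local_ring_simps [simp]:
  "carrier local_ring = fracs UNIV" "x \<otimes>\<^bsub>local_ring\<^esub> y = x * y" "x \<oplus>\<^bsub>local_ring\<^esub> y = x + y"
  "\<one>\<^bsub>local_ring\<^esub> = 1" "\<zero>\<^bsub>local_ring\<^esub> = 0"
  by (simp_all add: local_ring_def ring_of_type_algebra_def fracs_def)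

lemma eval_nonzero_imp: "mpoly_eval origin g \<noteq> 0 \<Longrightarrow> g \<noteq> 0"
  by auto

lemma fracsE:
  assumes "x \<in> fracs Q"
  obtains f g where "x = Fract f g" "f \<in> Q" "mpoly_eval origin g \<noteq> 0" "g \<noteq> 0"
proof -
  obtain f g where "x = Fract f g" "f \<in> Q" "mpoly_eval origin g \<noteq> 0" using assms unfolding fracs_def by blast
  then show ?thesis using eval_nonzero_imp that by blast
qed

lemma fracsI: "f \<in> Q \<Longrightarrow> mpoly_eval origin g \<noteq> 0 \<Longrightarrow> Fract f g \<in> fracs Q"
  by (auto simp: fracs_def)

lemma fracs_add:
  assumes "ideal_of Q" "x \<in> fracs Q" "y \<in> fracs Q"
  shows "x + y \<in> fracs Q"
proof -
  obtain f g f' g' where fg: "x = Fract f g" "f \<in> Q" "mpoly_eval origin g \<noteq> 0" "g \<noteq> 0"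
    "y = Fract f' g'" "f' \<in> Q" "mpoly_eval origin g' \<noteq> 0" "g' \<noteq> 0"
    using assms(2,3) by (metis fracsE)
  have "x + y = Fract (g' * f + g * f') (g * g')" using fg by (simp add: mult.commute)
  moreover have "g' * f + g * f' \<in> Q"
    using fg by (intro Id.subspace_add[OF assms(1)] Id.subspace_scale[OF assms(1)])
  ultimately show ?thesis using fg by (simp add: fracsI)
qed

lemma fracs_mult:
  assumes "ideal_of Q" "x \<in> fracs UNIV" "y \<in> fracs Q"
  shows "x * y \<in> fracs Q"
proof -
  obtain f g f' g' where fg: "x = Fract f g" "mpoly_eval origin g \<noteq> 0"
    "y = Fract f' g'" "f' \<in> Q" "mpoly_eval origin g' \<noteq> 0"
    using assms(2,3) by (metis fracsE)
  then show ?thesis using Id.subspace_scale[OF assms(1)] by (simp add: fracsI)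
qed

lemma fracs_uminus:
  assumes "ideal_of Q" "x \<in> fracs Q"
  shows "- x \<in> fracs Q"
proof -
  obtain f g where "x = Fract f g" "f \<in> Q" "mpoly_eval origin g \<noteq> 0" using assms(2) by (metis fracsE)
  then show ?thesis using Id.subspace_neg[OF assms(1)] by (simp add: fracsI)
qed

lemma fracs_diff: "ideal_of Q \<Longrightarrow> x \<in> fracs Q \<Longrightarrow> y \<in> fracs Q \<Longrightarrow> x - y \<in> fracs Q"
  using fracs_add[of Q x "- y"] fracs_uminus[of Q y] by simp

lemma fracs_0: "ideal_of Q \<Longrightarrow> 0 \<in> fracs Q"
  using fracsI[of 0 Q 1] Id.subspace_0[of Q] by (simp add: fract_collapse)

lemma one_in_fracs: "1 \<in> fracs UNIV"
  using fracsI[of 1 UNIV 1] by (simp add: fract_collapse)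

lemma fracs_mono: "Q \<subseteq> Q' \<Longrightarrow> fracs Q \<subseteq> fracs Q'"
  by (auto simp: fracs_def)

text \<open>Clearing denominators shows that \<open>loc\<close> is contraction after
  extension.\<close>

lemma Fract_in_fracs_iff:
  assumes "ideal_of Q" "mpoly_eval origin g \<noteq> 0"
  shows "Fract f g \<in> fracs Q \<longleftrightarrow> f \<in> loc Q"
proof
  assume "Fract f g \<in> fracs Q"
  then obtain f' g' where "Fract f g = Fract f' g'" "f' \<in> Q" "mpoly_eval origin g' \<noteq> 0" "g' \<noteq> 0" by (rule fracsE)
  then show "f \<in> loc Q"
    using eval_nonzero_imp[OF assms(2)] Id.subspace_scale[OF assms(1), of f' g]
    by (intro locI[of g']) (simp_all add: eq_fract mult.commute)
next
  assume "f \<in> loc Q"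
  then obtain h where h: "mpoly_eval origin h \<noteq> 0" "h * f \<in> Q" by (auto simp: loc_def)
  then have "Fract f g = Fract (h * f) (h * g)"
    using eval_nonzero_imp[OF assms(2)] eval_nonzero_imp[OF h(1)] by (simp add: eq_fract ac_simps)
  then show "Fract f g \<in> fracs Q" using h assms(2) by (simp add: fracsI)
qed

lemma cring_local_ring: "cring (local_ring :: 'n::{finite,linorder} mpoly fract ring)"
proof -
  let ?R = "ring_of_type_algebra :: 'n mpoly fract ring"
  interpret R: cring ?R by (rule cring_from_type_algebra)
  have simps: "carrier ?R = UNIV" "\<And>x y. x \<otimes>\<^bsub>?R\<^esub> y = x * y" "\<And>x y. x \<oplus>\<^bsub>?R\<^esub> y = x + y" "\<one>\<^bsub>?R\<^esub> = 1" "\<zero>\<^bsub>?R\<^esub> = 0"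
    by (simp_all add: ring_of_type_algebra_def)
  have "subring (fracs UNIV) ?R"
  proof (rule R.subringI)
    show "\<ominus>\<^bsub>?R\<^esub> h \<in> fracs UNIV" if "h \<in> fracs UNIV" for h
    proof -
      have "\<ominus>\<^bsub>?R\<^esub> h = - h" by (rule R.minus_equality) (simp_all add: simps)
      then show ?thesis using fracs_uminus[OF Id.subspace_UNIV that] by simp
    qed
  qed (use fracs_add[of UNIV] fracs_mult[of UNIV] one_in_fracs in \<open>simp_all add: simps\<close>)
  then have "subcring (fracs UNIV) ?R" by (rule R.subcringI) (simp add: simps mult.commute)
  then have "cring (?R\<lparr>carrier := fracs UNIV\<rparr>)" by (subst (asm) R.subcring_iff) (simp_all add: simps)
  then show ?thesis by (simp add: local_ring_def fracs_def)
qed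

lemma ideal_fracs:
  fixes Q :: "'n::{finite,linorder} mpoly set"
  assumes "ideal_of Q"
  shows "ideal (fracs Q) local_ring"
proof -
  interpret L: cring "local_ring :: 'n mpoly fract ring" by (rule cring_local_ring)
  show ?thesis
  proof (rule idealI[OF L.ring_axioms])
    show "subgroup (fracs Q) (add_monoid local_ring)"
    proof (rule L.add.subgroupI)
      show "fracs Q \<subseteq> carrier local_ring" using fracs_mono[of Q UNIV] by simp
      show "fracs Q \<noteq> {}" using fracs_0[OF assms] by blast
      fix a assume a: "a \<in> fracs Q"
      have "a \<in> fracs UNIV" using a fracs_mono[of Q UNIV] by blast
      then have "\<ominus>\<^bsub>local_ring\<^esub> a = - a"
        using fracs_uminus[of UNIV a] by (intro L.minus_equality) simp_all
      then show "\<ominus>\<^bsub>local_ring\<^esub> a \<in> fracs Q" using fracs_uminus[OF assms a] by simp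
    next
      fix a b assume "a \<in> fracs Q" "b \<in> fracs Q"
      then show "a \<oplus>\<^bsub>local_ring\<^esub> b \<in> fracs Q" using fracs_add[OF assms] by simp
    qed
  next
    fix a x :: "'n mpoly fract" assume ax: "a \<in> fracs Q" "x \<in> carrier local_ring"
    then show "x \<otimes>\<^bsub>local_ring\<^esub> a \<in> fracs Q" using fracs_mult[OF assms] by simp
    then show "a \<otimes>\<^bsub>local_ring\<^esub> x \<in> fracs Q" by (simp add: mult.commute)
  qed
qed

lemma extend_ideal_eq:
  fixes Q :: "'n::{finite,linorder} mpoly set"
  assumes "ideal_of Q"
  shows "extend_ideal Q = fracs Q"
proof
  interpret L: cring "local_ring :: 'n mpoly fract ring" by (rule cring_local_ring)
  have sub: "(\<lambda>f. Fract f 1) ` Q \<subseteq> fracs Q" by (auto intro!: fracsI)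
  then have sub': "(\<lambda>f. Fract f 1) ` Q \<subseteq> carrier local_ring" using fracs_mono[of Q UNIV] by auto
  show "extend_ideal Q \<subseteq> fracs Q"
    unfolding extend_ideal_def by (rule L.genideal_minimal[OF ideal_fracs[OF assms] sub])
  have id: "ideal (extend_ideal Q) local_ring" unfolding extend_ideal_def by (rule L.genideal_ideal[OF sub'])
  have self: "(\<lambda>f. Fract f 1) ` Q \<subseteq> extend_ideal Q" unfolding extend_ideal_def by (rule L.genideal_self[OF sub'])
  show "fracs Q \<subseteq> extend_ideal Q"
  proof
    fix x assume "x \<in> fracs Q"
    then obtain f g where fg: "x = Fract f g" "f \<in> Q" "mpoly_eval origin g \<noteq> 0" by (metis fracsE)
    have "Fract 1 g \<otimes>\<^bsub>local_ring\<^esub> Fract f 1 \<in> extend_ideal Q"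
      using fg self by (intro ideal.I_l_closed[OF id]) (auto intro: fracsI)
    then show "x \<in> extend_ideal Q" using fg by simp
  qed
qed

lemma fracs_plus:
  assumes "ideal_of Q" "ideal_of Q'"
  shows "fracs Q <+>\<^bsub>local_ring\<^esub> fracs Q' = fracs (Q + Q')"
proof
  have "x + y \<in> fracs (Q + Q')" if "x \<in> fracs Q" "y \<in> fracs Q'" for x y
    using that fracs_mono[OF plus_superset1, of Q' Q] fracs_mono[OF plus_superset2, of Q Q'] assms
    by (intro fracs_add ideal_plus) (auto simp: Id.subspace_0)
  then show "fracs Q <+>\<^bsub>local_ring\<^esub> fracs Q' \<subseteq> fracs (Q + Q')" by (auto simp: set_add_def')
  show "fracs (Q + Q') \<subseteq> fracs Q <+>\<^bsub>local_ring\<^esub> fracs Q'"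
  proof
    fix x assume "x \<in> fracs (Q + Q')"
    then obtain h g where h: "x = Fract h g" "h \<in> Q + Q'" "mpoly_eval origin g \<noteq> 0" "g \<noteq> 0" by (rule fracsE)
    from h(2) obtain a b where ab: "a \<in> Q" "b \<in> Q'" "h = a + b" by (rule set_plus_elim)
    have "x = Fract a g + Fract b g" using h ab by (simp add: eq_fract distrib_left distrib_right ac_simps)
    then show "x \<in> fracs Q <+>\<^bsub>local_ring\<^esub> fracs Q'"
      using fracsI[OF ab(1) h(3)] fracsI[OF ab(2) h(3)] by (auto simp: set_add_def')
  qed
qed

section \<open>Quotients of the local ring and their dimension\<close>

lemma rcoset_local_ring_eq_iff:
  assumes "ideal_of Q"
  shows "fracs Q +>\<^bsub>local_ring\<^esub> x = fracs Q +>\<^bsub>local_ring\<^esub> y \<longleftrightarrow> x - y \<in> fracs Q"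
proof -
  have coset: "fracs Q +>\<^bsub>local_ring\<^esub> x = {h + x | h. h \<in> fracs Q}" for x
    by (auto simp: a_r_coset_def')
  show ?thesis
    unfolding coset
  proof
    assume "{h + x | h. h \<in> fracs Q} = {h + y | h. h \<in> fracs Q}"
    moreover have "0 + x \<in> {h + x | h. h \<in> fracs Q}" using fracs_0[OF assms] by blast
    ultimately obtain h where "h \<in> fracs Q" "x = h + y" by auto
    then show "x - y \<in> fracs Q" by simp
  next
    assume xy: "x - y \<in> fracs Q"
    have "h + x = (h + (x - y)) + y" "h + y = (h - (x - y)) + x" for h by simp_all
    then show "{h + x | h. h \<in> fracs Q} = {h + y | h. h \<in> fracs Q}"
      using fracs_add[OF assms _ xy] fracs_diff[OF assms _ xy] by blast
  qed
qed

locale local_quotient =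
  fixes Q :: "'n::{finite,linorder} mpoly set"
  assumes Q: "ideal_of Q"
begin

sublocale L: cring "local_ring :: 'n mpoly fract ring" by (rule cring_local_ring)

sublocale QI: ideal "fracs Q" "local_ring :: 'n mpoly fract ring" by (rule ideal_fracs[OF Q])

abbreviation S where "S \<equiv> local_ring Quot (fracs Q)"

sublocale S: cring S by (rule QI.quotient_is_cring[OF L.cring_axioms])

abbreviation cset :: "'n mpoly fract \<Rightarrow> 'n mpoly fract set" where
  "cset x \<equiv> fracs Q +>\<^bsub>local_ring\<^esub> x"

lemma carrier_S: "carrier S = cset ` fracs UNIV"
  by (auto simp: FactRing_def A_RCOSETS_def')

lemma zero_S: "\<zero>\<^bsub>S\<^esub> = fracs Q"
  by (simp add: FactRing_def)

lemma one_S: "\<one>\<^bsub>S\<^esub> = cset 1"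
  by (simp add: FactRing_def)

lemma cset_mult: "x \<in> fracs UNIV \<Longrightarrow> y \<in> fracs UNIV \<Longrightarrow> cset x \<otimes>\<^bsub>S\<^esub> cset y = cset (x * y)"
  using ring_hom_mult[OF QI.rcos_ring_hom, of x y] by simp

lemma cset_add: "x \<in> fracs UNIV \<Longrightarrow> y \<in> fracs UNIV \<Longrightarrow> cset x \<oplus>\<^bsub>S\<^esub> cset y = cset (x + y)"
  using ring_hom_add[OF QI.rcos_ring_hom, of x y] by simp

lemma cset_eq_iff: "cset x = cset y \<longleftrightarrow> x - y \<in> fracs Q"
  by (rule rcoset_local_ring_eq_iff[OF Q])

lemma cset_0: "cset 0 = \<zero>\<^bsub>S\<^esub>"
  using fracs_0[OF Q] by (auto simp: zero_S a_r_coset_def')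

definition cls :: "'n mpoly \<Rightarrow> 'n mpoly fract set" where
  "cls f = cset (Fract f 1)"

lemma Fract_1_in: "Fract f 1 \<in> fracs UNIV"
  by (rule fracsI) simp_all

lemma cls_mult: "cls (f * g) = cls f \<otimes>\<^bsub>S\<^esub> cls g"
  by (simp add: cls_def cset_mult Fract_1_in)

lemma cls_add: "cls (f + g) = cls f \<oplus>\<^bsub>S\<^esub> cls g"
  by (simp add: cls_def cset_add Fract_1_in)

lemma cls_eq_iff: "cls f = cls g \<longleftrightarrow> f - g \<in> loc Q"
proof -
  have "Fract f 1 - Fract g 1 = Fract (f - g) 1" by simp
  then show ?thesis unfolding cls_def cset_eq_iff by (simp add: Fract_in_fracs_iff[OF Q])
qed

lemma cls_0: "cls 0 = \<zero>\<^bsub>S\<^esub>"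
  using cset_0 by (simp add: cls_def fract_collapse)

lemma cls_carrier: "cls f \<in> carrier S"
  unfolding cls_def carrier_S by (intro imageI Fract_1_in)

lemma cls_1: "cls 1 = \<one>\<^bsub>S\<^esub>"
  by (simp add: cls_def one_S fract_collapse)

text \<open>Denominators are invertible modulo \<open>mpow k\<close>, so polynomials represent all
  classes.\<close>

lemma range_cls:
  assumes "mpow k \<subseteq> Q"
  shows "range cls = carrier S"
proof
  show "range cls \<subseteq> carrier S" using cls_carrier by blast
  show "carrier S \<subseteq> range cls"
  proof
    fix Z assume "Z \<in> carrier S"
    then obtain z where z: "z \<in> fracs UNIV" "Z = cset z" unfolding carrier_S by (rule imageE)
    from z(1) obtain f g where "z = Fract f g" "mpoly_eval origin g \<noteq> 0" "g \<noteq> 0" by (rule fracsE)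
    with z(2) have fg: "Z = cset (Fract f g)" "mpoly_eval origin g \<noteq> 0" "g \<noteq> 0" by simp_all
    obtain h where h: "h * g - 1 \<in> mpow k" using eval_origin_unit_mod_mpow[OF fg(2)] by blast
    have "Fract f g - Fract (h * f) 1 = Fract (f - h * f * g) g"
      using fg(3) by (simp add: eq_fract)
    moreover have "f - h * f * g = (- f) * (h * g - 1)" by (simp add: algebra_simps)
    then have "f - h * f * g \<in> Q" using Id.subspace_scale[OF Q, of "h * g - 1" "- f"] h assms by auto
    ultimately have "cset (Fract f g) = cls (h * f)"
      unfolding cls_def cset_eq_iff using fg(2) by (simp add: fracsI)
    then show "Z \<in> range cls" using fg(1) by blast
  qed
qed

text \<open>The copy of the complex numbers over which \<open>quot_dim\<close> counts.\<close>

definition KK where "KK = range (\<lambda>a. cls (mpoly_const a))"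

text \<open>Each element of B contributes one line extension; the last assumption is linear
  independence of B modulo Q.\<close>

lemma dimension_span:
  assumes "loc Q = Q" "finite B" "\<forall>b\<in>B. b \<notin> Vs.span (Q \<union> (B - {b}))"
  shows "S.dimension (card B) KK (cls ` Vs.span (Q \<union> B))"
  using assms(2,3)
proof (induction B rule: finite_induct)
  case empty
  have "Vs.span Q = Q" using Vs.span_eq_iff[THEN iffD2, OF ideal_imp_subspace[OF Q]] .
  moreover have "cls f = \<zero>\<^bsub>S\<^esub>" if "f \<in> Q" for f
    using that assms(1) cls_eq_iff[of f 0] cls_0 by simp
  ultimately have "cls ` Vs.span (Q \<union> {}) = {\<zero>\<^bsub>S\<^esub>}"
    using Id.subspace_0[OF Q] by (simp only: Un_empty_right) blast
  then show ?case using S.zero_dim by simp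
next
  case (insert b B)
  let ?W = "Vs.span (Q \<union> B)"
  have bW: "b \<notin> ?W" using insert.prems insert.hyps(2) by simp
  have "\<forall>b'\<in>B. b' \<notin> Vs.span (Q \<union> (B - {b'}))"
  proof
    fix b' assume b': "b' \<in> B"
    have "Vs.span (Q \<union> (B - {b'})) \<subseteq> Vs.span (Q \<union> (insert b B - {b'}))" by (intro Vs.span_mono) auto
    then show "b' \<notin> Vs.span (Q \<union> (B - {b'}))" using insert.prems b' by blast
  qed
  then have IH: "S.dimension (card B) KK (cls ` ?W)" by (rule insert.IH)
  have notin: "cls b \<notin> cls ` ?W"
  proof
    assume "cls b \<in> cls ` ?W"
    then obtain w where w: "w \<in> ?W" "b - w \<in> Q" using cls_eq_iff assms(1) by auto
    have "(b - w) + w \<in> ?W" using w by (intro Vs.span_add) (auto intro: Vs.span_base)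
    then show False using bW by simp
  qed
  have "cls ` Vs.span (Q \<union> insert b B) = S.line_extension KK (cls b) (cls ` ?W)"
  proof (intro equalityI subsetI)
    fix Z assume "Z \<in> cls ` Vs.span (Q \<union> insert b B)"
    then obtain f where f: "f \<in> Vs.span (insert b (Q \<union> B))" "Z = cls f" by auto
    then obtain c where c: "f - cscale c b \<in> ?W" by (auto simp: Vs.span_insert)
    have "Z = cls (mpoly_const c) \<otimes>\<^bsub>S\<^esub> cls b \<oplus>\<^bsub>S\<^esub> cls (f - cscale c b)"
      using f(2) by (simp add: cscale_def flip: cls_mult cls_add)
    then show "Z \<in> S.line_extension KK (cls b) (cls ` ?W)"
      unfolding S.line_extension_mem_iff KK_def using c by blast
  next
    fix Z assume "Z \<in> S.line_extension KK (cls b) (cls ` ?W)"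
    then obtain c w where cw: "w \<in> ?W" "Z = cls (mpoly_const c) \<otimes>\<^bsub>S\<^esub> cls b \<oplus>\<^bsub>S\<^esub> cls w"
      unfolding S.line_extension_mem_iff KK_def by blast
    have "Z = cls (cscale c b + w)" using cw(2) by (simp add: cscale_def cls_mult cls_add)
    moreover have "cscale c b + w \<in> Vs.span (Q \<union> insert b B)"
      using cw(1) Vs.span_mono[of "Q \<union> B" "Q \<union> insert b B"]
      by (intro Vs.span_add Vs.span_scale) (auto intro: Vs.span_base)
    ultimately show "Z \<in> cls ` Vs.span (Q \<union> insert b B)" by blast
  qed
  then show ?case
    using S.Suc_dim[OF cls_carrier notin IH] insert.hyps by simp
qed

lemma subfield_KK:
  assumes "\<one>\<^bsub>S\<^esub> \<noteq> \<zero>\<^bsub>S\<^esub>"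
  shows "subfield KK S"
proof -
  let ?C = "ring_of_type_algebra :: complex ring"
  interpret C: Ring.field ?C by (rule field_from_type_algebra)
  have simps: "carrier ?C = UNIV" "\<And>x y. x \<otimes>\<^bsub>?C\<^esub> y = x * y" "\<And>x y. x \<oplus>\<^bsub>?C\<^esub> y = x + y" "\<one>\<^bsub>?C\<^esub> = 1" "\<zero>\<^bsub>?C\<^esub> = 0"
    by (simp_all add: ring_of_type_algebra_def)
  have "(\<lambda>a. cls (mpoly_const a)) \<in> ring_hom ?C S"
    by (rule ring_hom_memI) (simp_all add: simps cls_carrier const_mult const_add cls_mult cls_add cls_1)
  then interpret h: ring_hom_ring ?C S "\<lambda>a. cls (mpoly_const a)"
    by (intro ring_hom_ringI2 C.ring_axioms S.ring_axioms)
  have "subfield ((\<lambda>a. cls (mpoly_const a)) ` carrier ?C) S"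
    by (rule h.img_is_subfield(2)[OF C.carrier_is_subfield assms])
  then show ?thesis by (simp add: KK_def simps)
qed

text \<open>A spanning set modulo Q of least size is linearly independent, so its size is the
  dimension.\<close>

lemma quot_dim_eq:
  assumes mk: "mpow k \<subseteq> Q"
  shows "quot_dim (fracs Q) = qdim Q UNIV"
proof -
  have locQ: "loc Q = Q" by (rule loc_eq_if_mpow_subset[OF Q mk])
  note subQ = ideal_imp_subspace[OF Q]
  obtain n where "qgen Q n UNIV" using qgen_above_mpow[OF mk subQ Vs.subspace_UNIV] by auto
  from qgen_qdim[OF this] obtain B where B: "finite B" "card B \<le> qdim Q UNIV" "UNIV \<subseteq> Vs.span (Q \<union> B)"
    by (auto simp: qgen_def)
  have qd: "qdim Q UNIV \<le> card B'" if "finite B'" "UNIV \<subseteq> Vs.span (Q \<union> B')" for B'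
    using that by (intro qdim_le) (auto simp: qgen_def)
  have "\<forall>b\<in>B. b \<notin> Vs.span (Q \<union> (B - {b}))"
  proof
    fix b assume b: "b \<in> B"
    show "b \<notin> Vs.span (Q \<union> (B - {b}))"
    proof
      assume "b \<in> Vs.span (Q \<union> (B - {b}))"
      then have "Q \<union> B \<subseteq> Vs.span (Q \<union> (B - {b}))" using Vs.span_superset[of "Q \<union> (B - {b})"] by blast
      then have "Vs.span (Q \<union> B) \<subseteq> Vs.span (Q \<union> (B - {b}))" by (intro Vs.span_minimal) auto
      then have "qdim Q UNIV \<le> card (B - {b})" using B(1,3) by (intro qd) auto
      moreover have "card (B - {b}) < card B" using b B(1) by (intro card_Diff1_less)
      ultimately show False using B(2) by simp
    qed
  qed
  from dimension_span[OF locQ B(1) this] have dim: "S.dimension (card B) KK (carrier S)"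
    using B(3) range_cls[OF mk] by (simp add: top.extremum_unique)
  have cardB: "card B = qdim Q UNIV" using B qd[of B] by simp
  have KK: "range (\<lambda>a. fracs Q +>\<^bsub>local_ring\<^esub> Fract (mpoly_const a) 1) = KK"
    by (simp add: KK_def cls_def)
  have "S.dim KK (carrier S) = card B"
  proof (cases "\<one>\<^bsub>S\<^esub> = \<zero>\<^bsub>S\<^esub>")
    case False
    show ?thesis using S.dimI[OF subfield_KK[OF False] dim] by (simp add: over_def)
  next
    \<comment> \<open>In the zero ring the image of the constants is not a field, and uniqueness of
      dimension over a field does not apply. There no proper line extension exists, so that only
      dimension 0 occurs.\<close>
    case True
    then have triv: "carrier S = {\<zero>\<^bsub>S\<^esub>}" by (rule S.one_zeroD)
    have dim0: "n = 0 \<and> E = {\<zero>\<^bsub>S\<^esub>}" if "S.dimension n KK E" for n E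
      using that
    proof (induction rule: S.dimension.induct)
      case (Suc_dim v E n)
      then show ?case using triv by (metis singletonD)
    qed simp
    show ?thesis
      unfolding S.dim_def over_def
    proof (rule the_equality)
      show "S.dimension (card B) KK (carrier S)" by (rule dim)
      fix n assume "S.dimension n KK (carrier S)"
      from dim0[OF this] dim0[OF dim] show "n = card B" by simp
    qed
  qed
  then show ?thesis unfolding quot_dim_def KK cardB .
qed

end

theorem truncated_dim_eq:
  fixes I :: "'n::{finite,linorder} mpoly set"
  assumes I: "ideal_of I"
  shows "truncated_dim I k = hilb_sum I k"
proof -
  have id: "ideal_of (I + mpow k)" by (intro ideal_plus I ideal_mpow)
  then interpret local_quotient "I + mpow k" by unfold_locales
  show ?thesis
    unfolding truncated_dim_def max_ideal_power extend_ideal_eq[OF I] extend_ideal_eq[OF ideal_mpow]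
      fracs_plus[OF I ideal_mpow] hilb_sum_def
    by (rule quot_dim_eq[OF mpow_subset_plus[OF I]])
qed

section \<open>Hilbert polynomial, multiplicity and regularity index\<close>

lemma hilbert_fun_eq: "ideal_of I \<Longrightarrow> hilbert_fun I k = int (hilb I k)"
  by (simp add: hilbert_fun_def truncated_dim_eq hilb_sum_Suc)

lemma hilbert_poly_eq:
  assumes I: "ideal_of I" and e: "\<And>k. k \<ge> k0 \<Longrightarrow> hilb I k = e"
  shows "hilbert_poly I = [:of_nat e:]"
  unfolding hilbert_poly_def
proof (rule the_equality)
  show "\<exists>k\<^sub>0. \<forall>k\<ge>k\<^sub>0. of_int (hilbert_fun I k) = poly [:of_nat e :: rat:] (of_nat k)"
    using e by (intro exI[of _ k0]) (simp add: hilbert_fun_eq[OF I])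
  fix p :: "rat poly"
  assume "\<exists>k\<^sub>0. \<forall>k\<ge>k\<^sub>0. of_int (hilbert_fun I k) = poly p (of_nat k)"
  then obtain k1 where k1: "\<And>k. k \<ge> k1 \<Longrightarrow> of_int (hilbert_fun I k) = poly p (of_nat k)" by blast
  have "poly (p - [:of_nat e:]) (of_nat k) = 0" if "k \<ge> max k0 k1" for k
    using k1[of k] e[of k] that by (simp add: hilbert_fun_eq[OF I])
  then have "of_nat ` {max k0 k1..} \<subseteq> {x. poly (p - [:of_nat e:]) x = 0}" by auto
  moreover have "infinite (of_nat ` {max k0 k1..} :: rat set)"
    using finite_imageD[of "of_nat :: nat \<Rightarrow> rat" "{max k0 k1..}"] infinite_Ici by (auto simp: inj_on_def)
  ultimately have "p - [:of_nat e:] = 0" using poly_roots_finite finite_subset by metis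
  then show "p = [:of_nat e:]" by simp
qed

lemma multiplicity_eq:
  assumes "ideal_of I" "\<And>k. k \<ge> k0 \<Longrightarrow> hilb I k = e"
  shows "multiplicity_at_origin I = e"
  unfolding multiplicity_at_origin_def
  by (rule the_equality) (simp_all add: hilbert_poly_eq[OF assms])

lemma regularity_index_hilb:
  assumes I: "ideal_of I" and e: "\<And>k. k \<ge> k0 \<Longrightarrow> hilb I k = e" and "k \<ge> regularity_index I"
  shows "hilb I k = e"
proof -
  have "\<forall>k\<ge>k0. of_int (hilbert_fun I k) = poly (hilbert_poly I) (of_nat k)"
    using e by (simp add: hilbert_fun_eq[OF I] hilbert_poly_eq[OF I e])
  then have "\<forall>k\<ge>regularity_index I. of_int (hilbert_fun I k) = poly (hilbert_poly I) (of_nat k)"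
    unfolding regularity_index_def by (rule LeastI)
  then show ?thesis using assms(3) by (simp add: hilbert_fun_eq[OF I] hilbert_poly_eq[OF I e])
qed

section \<open>Primes of the local ring\<close>

lemma loc_prime:
  assumes "prime_id p" "p \<subseteq> mpow 1"
  shows "loc p = p"
proof
  show "loc p \<subseteq> p"
  proof
    fix f assume "f \<in> loc p"
    then obtain g where "mpoly_eval origin g \<noteq> 0" "g * f \<in> p" by (auto simp: loc_def)
    moreover from this have "g \<notin> p" using assms(2) by (auto simp: mpow_Suc_0_iff)
    ultimately show "f \<in> p" using prime_id_mult[OF assms(1)] by blast
  qed
qed (rule loc_superset)

context local_quotient
begin

lemma cset_in_image_iff:
  assumes "Q \<subseteq> p" "ideal_of p"
  shows "cset x \<in> cset ` fracs p \<longleftrightarrow> x \<in> fracs p"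
proof
  assume "cset x \<in> cset ` fracs p"
  then obtain z where z: "z \<in> fracs p" "x - z \<in> fracs Q" using cset_eq_iff by blast
  have "(x - z) + z \<in> fracs p" using z fracs_mono[OF assms(1)] by (intro fracs_add[OF assms(2)]) auto
  then show "x \<in> fracs p" by simp
qed simp

lemma primeideal_image:
  assumes p: "prime_id p" "Q \<subseteq> p" "p \<subseteq> mpow 1"
  shows "primeideal (cset ` fracs p) S"
proof (rule primeidealI)
  note idp = prime_id_ideal[OF p(1)]
  show "ideal (cset ` fracs p) S"
    by (rule L.ring_ideal_imp_quot_ideal[OF QI.ideal_axioms ideal_fracs[OF idp]])
  show "cring S" by (rule S.cring_axioms)
  have "1 \<notin> loc p" using loc_prime[OF p(1,3)] prime_id_1[OF p(1)] by simp
  then have "Fract 1 1 \<notin> fracs p" using Fract_in_fracs_iff[OF idp, of 1 1] by simp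
  then have "cset (Fract 1 1) \<notin> cset ` fracs p" using cset_in_image_iff[OF p(2) idp] by simp
  then show "carrier S \<noteq> cset ` fracs p" using cls_carrier[of 1] by (auto simp: cls_def)
  fix a b assume "a \<in> carrier S" "b \<in> carrier S" and ab: "a \<otimes>\<^bsub>S\<^esub> b \<in> cset ` fracs p"
  then obtain x y where xy: "x \<in> fracs UNIV" "y \<in> fracs UNIV" "a = cset x" "b = cset y"
    unfolding carrier_S by blast
  obtain f g where f: "x = Fract f g" "mpoly_eval origin g \<noteq> 0" using xy(1) by (metis fracsE)
  obtain f' g' where f': "y = Fract f' g'" "mpoly_eval origin g' \<noteq> 0" using xy(2) by (metis fracsE)
  have "x * y \<in> fracs p" using ab xy cset_mult cset_in_image_iff[OF p(2) idp] by simp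
  then have "f * f' \<in> p" using f f' Fract_in_fracs_iff[OF idp, of "g * g'" "f * f'"] loc_prime[OF p(1,3)] by simp
  then have "f \<in> p \<or> f' \<in> p" using prime_id_mult[OF p(1)] by simp
  then show "a \<in> cset ` fracs p \<or> b \<in> cset ` fracs p" using xy f f' by (auto intro: fracsI)
qed

lemma image_strict_mono:
  assumes p: "prime_id p" "Q \<subseteq> p" "p \<subseteq> mpow 1" and q: "p \<subset> q"
  shows "cset ` fracs p \<subset> cset ` fracs q"
proof -
  obtain f where f: "f \<in> q" "f \<notin> p" using q by blast
  have "Fract f 1 \<notin> fracs p"
    using f(2) Fract_in_fracs_iff[OF prime_id_ideal[OF p(1)], of 1 f] loc_prime[OF p(1,3)] by simp
  then have "cset (Fract f 1) \<notin> cset ` fracs p" using cset_in_image_iff[OF p(2) prime_id_ideal[OF p(1)]] by simp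
  moreover have "cset (Fract f 1) \<in> cset ` fracs q" using f(1) by (intro imageI fracsI) auto
  moreover have "cset ` fracs p \<subseteq> cset ` fracs q" using q by (intro image_mono fracs_mono) auto
  ultimately show ?thesis by blast
qed

end

text \<open>Primes over I inside the maximal ideal of the origin stay prime and distinct in the
  local quotient, so three nested ones force Krull dimension at least two.\<close>

theorem one_dimensional_no_chain:
  fixes I :: "'n::{finite,linorder} mpoly set"
  assumes I: "ideal_of I" and one: "one_dimensional_at_origin I"
    and p: "prime_id p0" "prime_id p1" "prime_id p2" "I \<subseteq> p0" "p0 \<subset> p1" "p1 \<subset> p2" "p2 \<subseteq> mpow 1"
  shows False
proof -
  interpret local_quotient I by unfold_locales (rule I)
  define c where "c i = cset ` fracs (if i = 0 then p0 else if i = Suc 0 then p1 else p2)" for i :: nat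
  have "primeideal (c i) S" for i
    unfolding c_def by (rule primeideal_image) (use p in auto)
  moreover have "c i \<subset> c (Suc i)" if "i < 2" for i
  proof -
    have "i = 0 \<or> i = Suc 0" using that by auto
    then show ?thesis
    proof
      assume "i = 0"
      then show ?thesis using image_strict_mono[of p0 p1] p by (auto simp: c_def)
    next
      assume "i = Suc 0"
      then show ?thesis using image_strict_mono[of p1 p2] p by (auto simp: c_def)
    qed
  qed
  ultimately have "enat 2 \<in> {enat n | n. \<exists>c :: nat \<Rightarrow> 'n mpoly fract set set.
     (\<forall>i\<le>n. c i \<in> {P. primeideal P S}) \<and> (\<forall>i<n. c i \<subset> c (Suc i))}" by blast
  then have "enat 2 \<le> krull_dim S" unfolding krull_dim_def chain_dim_def by (rule Sup_upper)
  then show False using one by (simp add: one_dimensional_at_origin_def extend_ideal_eq[OF I] one_enat_def)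
qed

section \<open>Prime ideals and irreducible sets\<close>

definition van :: "('n::finite \<Rightarrow> complex) set \<Rightarrow> 'n mpoly set" where
  "van C = {f. \<forall>a\<in>C. mpoly_eval a f = 0}"

lemma van_antimono: "C \<subseteq> C' \<Longrightarrow> van C' \<subseteq> van C"
  by (auto simp: van_def)

lemma zero_set_antimono: "Q \<subseteq> Q' \<Longrightarrow> zero_set Q' \<subseteq> zero_set Q"
  by (auto simp: zero_set_def)

lemma ideal_van: "ideal_of (van C)"
  by (auto simp: Id.subspace_def van_def)

lemma subset_van_iff: "Q \<subseteq> van C \<longleftrightarrow> C \<subseteq> zero_set Q"
  by (auto simp: van_def zero_set_def)

lemma zero_set_van: "algebraic_set C \<Longrightarrow> zero_set (van C) = C"
  unfolding algebraic_set_def by (auto simp: van_def zero_set_def)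

lemma van_zero_set_prime:
  fixes P :: "'n::{finite,linorder} mpoly set"
  assumes "prime_id P"
  shows "van (zero_set P) = P"
proof
  show "van (zero_set P) \<subseteq> P"
  proof
    fix f assume f: "f \<in> van (zero_set P)"
    show "f \<in> P"
    proof (rule ccontr)
      assume "f \<notin> P"
      then obtain a where "\<And>g. g \<in> P \<Longrightarrow> mpoly_eval a g = 0" "mpoly_eval a f \<noteq> 0"
        by (rule nullstellensatz_prime[OF assms]) blast
      then show False using f by (auto simp: van_def zero_set_def)
    qed
  qed
qed (simp add: subset_van_iff)

lemma irreducible_imp_algebraic: "irreducible_set C \<Longrightarrow> algebraic_set C"
  by (simp add: irreducible_set_def)

text \<open>If f g vanishes on C, then C is the union of its algebraic parts where f, respectively
  g, vanishes.\<close>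

lemma prime_van:
  assumes "irreducible_set C"
  shows "prime_id (van C)"
  unfolding prime_id_def
proof (intro conjI allI impI)
  show "ideal_of (van C)" by (rule ideal_van)
  show "1 \<notin> van C" using assms by (auto simp: van_def irreducible_set_def)
  fix f g assume fg: "f * g \<in> van C"
  have cut: "algebraic_set (C \<inter> {a. mpoly_eval a h = 0})" for h
  proof -
    have "C = zero_set (van C)" using zero_set_van irreducible_imp_algebraic[OF assms] by blast
    then have "C \<inter> {a. mpoly_eval a h = 0} = zero_set (insert h (van C))" by (auto simp: zero_set_def)
    then show ?thesis unfolding algebraic_set_def by blast
  qed
  have "C = (C \<inter> {a. mpoly_eval a f = 0}) \<union> (C \<inter> {a. mpoly_eval a g = 0})"
    using fg by (auto simp: van_def)
  then have "C = C \<inter> {a. mpoly_eval a f = 0} \<or> C = C \<inter> {a. mpoly_eval a g = 0}"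
    using assms cut[of f] cut[of g] unfolding irreducible_set_def by blast
  then show "f \<in> van C \<or> g \<in> van C" by (auto simp: van_def)
qed

text \<open>On two proper algebraic parts there vanish elements f and g outside P; if the parts
  covered the zero set, f g would lie in P by the Nullstellensatz.\<close>

lemma irreducible_zero_set:
  fixes P :: "'n::{finite,linorder} mpoly set"
  assumes P: "prime_id P"
  shows "irreducible_set (zero_set P)"
  unfolding irreducible_set_def
proof (intro conjI allI impI)
  show "algebraic_set (zero_set P)" by (auto simp: algebraic_set_def)
  show "zero_set P \<noteq> {}"
  proof
    assume "zero_set P = {}"
    then have "1 \<in> van (zero_set P)" by (simp add: van_def)
    then show False using van_zero_set_prime[OF P] prime_id_1[OF P] by simp
  qed
  fix A B assume AB: "algebraic_set A \<and> algebraic_set B \<and> zero_set P = A \<union> B"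
  show "zero_set P = A \<or> zero_set P = B"
  proof (rule ccontr)
    assume ne: "\<not> ?thesis"
    have sep: "\<exists>f. f \<in> van D \<and> f \<notin> P" if D: "algebraic_set D" "D \<subseteq> zero_set P" "zero_set P \<noteq> D" for D
    proof (rule ccontr)
      assume "\<not> ?thesis"
      then have "van D \<subseteq> P" by blast
      then have "zero_set P \<subseteq> zero_set (van D)" by (rule zero_set_antimono)
      then show False using D zero_set_van[OF D(1)] by blast
    qed
    obtain f where f: "f \<in> van A" "f \<notin> P" using sep[of A] AB ne by blast
    obtain g where g: "g \<in> van B" "g \<notin> P" using sep[of B] AB ne by blast
    have "f * g \<in> van (zero_set P)" using f(1) g(1) AB by (auto simp: van_def)
    then show False using f(2) g(2) van_zero_set_prime[OF P] prime_id_mult[OF P] by simp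
  qed
qed

lemma prime_mpow_1: "prime_id (mpow 1 :: 'n::finite mpoly set)"
  by (auto simp: prime_id_def mpow_Suc_0_iff)

lemma zero_set_mpow_1: "zero_set (mpow 1 :: 'n::finite mpoly set) = {origin}"
proof (intro equalityI subsetI)
  fix a assume a: "a \<in> zero_set (mpow 1 :: 'n mpoly set)"
  have "a v = origin v" for v
  proof -
    have "mpoly_eval a (mpoly_var v) = 0" using a var_in_mpow[of v] unfolding zero_set_def by blast
    then show ?thesis by (simp add: origin_def)
  qed
  then show "a \<in> {origin}" by (simp add: fun_eq_iff)
qed (auto simp: zero_set_def mpow_Suc_0_iff)

text \<open>In a chain of three irreducible sets inside the zero set, the two smaller ones give
  nested distinct primes strictly above P, which \<open>height_one_dimension\<close> excludes. The
  origin inside the zero set is a chain of length one.\<close>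

lemma variety_dim_height_one:
  fixes P :: "'n::{finite,linorder} mpoly set"
  assumes P: "height_one P"
  shows "variety_dim (zero_set P) = 1"
proof -
  have pP: "prime_id P" "P \<subset> mpow 1" using P by (auto simp: height_one_def)
  let ?C = "zero_set P"
  let ?F = "{C. irreducible_set C \<and> C \<subseteq> ?C}"
  let ?L = "{enat n | n. \<exists>c :: nat \<Rightarrow> ('n \<Rightarrow> complex) set. (\<forall>i\<le>n. c i \<in> ?F) \<and> (\<forall>i<n. c i \<subset> c (Suc i))}"
  have "Sup ?L \<le> 1"
  proof (rule Sup_least)
    fix l assume "l \<in> ?L"
    then obtain n c where l: "l = enat n" "\<And>i. i \<le> n \<Longrightarrow> irreducible_set (c i)" "\<And>i. i \<le> n \<Longrightarrow> c i \<subseteq> ?C"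
      "\<And>i. i < n \<Longrightarrow> c i \<subset> c (Suc i)" by blast
    have "n \<le> 1"
    proof (rule ccontr)
      assume n: "\<not> n \<le> 1"
      have sub: "van (c 1) \<subseteq> van (c 0)" using l(4)[of 0] n by (intro van_antimono) auto
      have pr: "prime_id (van (c 0))" "prime_id (van (c 1))" using l(2) n by (auto intro: prime_van)
      have neq: "van C \<noteq> van C'" if "C \<subset> C'" "irreducible_set C" "irreducible_set C'"
        for C C' :: "('n \<Rightarrow> complex) set"
        using that zero_set_van irreducible_imp_algebraic by (metis psubset_eq)
      have "P \<subseteq> van (c 2)" using l(3)[of 2] n by (simp add: subset_van_iff)
      moreover have "van (c 2) \<subseteq> van (c 1)"
        using l(4)[of 1] n by (intro van_antimono) (auto simp: numeral_2_eq_2)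
      moreover have "van (c 1) \<noteq> van (c 2)"
        using l(4)[of 1] l(2)[of 1] l(2)[of 2] n by (intro neq) (auto simp: numeral_2_eq_2)
      ultimately have "P \<subset> van (c 1)" by blast
      then have "van (c 0) = van (c 1)" by (rule height_one_dimension[OF P pr(2) _ pr(1) sub])
      moreover have "van (c 0) \<noteq> van (c 1)" using l(4)[of 0] l(2)[of 0] l(2)[of 1] n by (intro neq) auto
      ultimately show False by simp
    qed
    then show "l \<le> 1" using l(1) by (simp add: one_enat_def)
  qed
  moreover have "1 \<le> Sup ?L"
  proof (rule Sup_upper)
    define c where "c i = (if i = 0 then zero_set (mpow 1) else ?C)" for i :: nat
    have sub: "zero_set (mpow 1) \<subseteq> ?C" using pP(2) by (intro zero_set_antimono) auto
    moreover have "zero_set (mpow 1) \<noteq> ?C" using van_zero_set_prime pP prime_mpow_1 by (metis psubset_eq)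
    ultimately have "\<forall>i<1. c i \<subset> c (Suc i)" by (auto simp: c_def)
    moreover have "c i \<in> ?F" for i
      using sub irreducible_zero_set[OF pP(1)] irreducible_zero_set[where 'n = 'n, OF prime_mpow_1]
      unfolding c_def by (cases "i = 0") (simp_all only: if_True if_False mem_Collect_eq order_refl simp_thms)
    ultimately show "1 \<in> ?L" unfolding one_enat_def by blast
  qed
  ultimately show ?thesis unfolding variety_dim_def chain_dim_def by (rule antisym)
qed

section \<open>Existence of the parameter\<close>

lemma var_power_eq: "mpoly_var j ^ n = (Poly_Mapping.single (Poly_Mapping.single j n) 1 :: 'n::finite mpoly)"
  by (simp add: single_1_eq_prod)

lemma single_eq_mult_var_power:
  assumes "n \<le> Poly_Mapping.lookup \<alpha> v"
  shows "(Poly_Mapping.single \<alpha> c :: 'n::finite mpoly) =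
    Poly_Mapping.single (\<alpha> - Poly_Mapping.single v n) c * mpoly_var v ^ n"
proof -
  have "\<alpha> - Poly_Mapping.single v n + Poly_Mapping.single v n = \<alpha>"
    using assms by (intro poly_mapping_eqI) (auto simp: lookup_add lookup_minus lookup_single when_def)
  then show ?thesis by (simp add: var_power_eq mult_single)
qed

text \<open>Pigeonhole: a monomial whose degree is at least the sum of the \<open>K w\<close> has
  some exponent that reaches \<open>K w\<close>.\<close>

lemma mpow_subset_if_var_powers:
  fixes Q :: "'n::finite mpoly set"
  assumes Q: "ideal_of Q" and K: "\<And>w. mpoly_var w ^ K w \<in> Q"
  shows "mpow (\<Sum>w\<in>UNIV. K w) \<subseteq> Q"
proof
  fix f :: "'n mpoly" assume f: "f \<in> mpow (\<Sum>w\<in>UNIV. K w)"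
  have "Poly_Mapping.single \<alpha> (Poly_Mapping.lookup f \<alpha>) \<in> Q" if \<alpha>: "\<alpha> \<in> Poly_Mapping.keys f" for \<alpha>
  proof -
    have deg: "(\<Sum>w\<in>UNIV. K w) \<le> (\<Sum>w\<in>UNIV. Poly_Mapping.lookup \<alpha> w)"
      using f \<alpha> unfolding mpow_iff mdeg_def by (meson in_keys_iff not_le)
    have "\<exists>w. K w \<le> Poly_Mapping.lookup \<alpha> w"
    proof (rule ccontr)
      assume "\<not> ?thesis"
      then have "(\<Sum>w\<in>UNIV. Poly_Mapping.lookup \<alpha> w) < (\<Sum>w\<in>UNIV. K w)"
        by (intro sum_strict_mono) (auto simp: not_le)
      then show False using deg by simp
    qed
    then obtain w where w: "K w \<le> Poly_Mapping.lookup \<alpha> w" ..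
    show ?thesis unfolding single_eq_mult_var_power[OF w] by (rule Id.subspace_scale[OF Q K])
  qed
  then show "f \<in> Q" by (subst mpoly_eq_sum_single) (rule Id.subspace_sum[OF Q])
qed

text \<open>If no power of some x_w were locally in I + (x_v), a prime P over that ideal inside the
  maximal ideal of the origin would miss x_w. By one-dimensionality no prime lies strictly between P
  and the maximal ideal, and none over I lies strictly below P. So the zero set of P is a
  one-dimensional component through the origin inside the hyperplane.\<close>

theorem regular_position_parameter:
  fixes I :: "'n::{finite,linorder} mpoly set"
  assumes I: "ideal_of I" and one: "one_dimensional_at_origin I" and reg: "regular_position I v"
  shows "\<exists>n. mpow n \<subseteq> loc (I + principal (mpoly_var v))"
proof -
  let ?Q = "I + principal (mpoly_var v)"
  have idQ: "ideal_of ?Q" by (intro ideal_plus I ideal_principal)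
  have IQ: "I \<subseteq> ?Q" by (rule plus_superset1[OF zero_in_ideal[OF ideal_principal]])
  have "mpoly_var v \<in> principal (mpoly_var v)" unfolding principal_def by (metis mult_1_right rangeI)
  then have vQ: "mpoly_var v \<in> ?Q" using plus_superset2[OF zero_in_ideal[OF I]] by blast
  have "\<exists>K. mpoly_var w ^ K \<in> loc ?Q" for w
  proof (rule ccontr)
    assume no: "\<not> ?thesis"
    define \<Sigma> where "\<Sigma> = {g * mpoly_var w ^ K | g K. mpoly_eval origin g \<noteq> 0}"
    have \<Sigma>I: "g * mpoly_var w ^ K \<in> \<Sigma>" if "mpoly_eval origin g \<noteq> 0" for g K
      using that by (auto simp: \<Sigma>_def)
    have "?Q \<inter> \<Sigma> = {}" using no by (auto simp: \<Sigma>_def intro: locI)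
    moreover have "1 \<in> \<Sigma>" using \<Sigma>I[of 1 0] by simp
    moreover have "a * b \<in> \<Sigma>" if ab: "a \<in> \<Sigma>" "b \<in> \<Sigma>" for a b
    proof -
      obtain g K h L where gh: "a = g * mpoly_var w ^ K" "b = h * mpoly_var w ^ L"
        "mpoly_eval origin g \<noteq> 0" "mpoly_eval origin h \<noteq> 0" using ab unfolding \<Sigma>_def by blast
      have "a * b = (g * h) * mpoly_var w ^ (K + L)" by (simp add: gh(1,2) power_add ac_simps)
      then show ?thesis using \<Sigma>I[of "g * h" "K + L"] gh(3,4) by simp
    qed
    ultimately obtain P where P: "prime_id P" "?Q \<subseteq> P" "P \<inter> \<Sigma> = {}"
      using prime_avoiding_exists[OF idQ, of \<Sigma>] by metis
    have "g \<in> mpow 1" if "g \<in> P" for g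
    proof (rule ccontr)
      assume "g \<notin> mpow 1"
      then have "g * mpoly_var w ^ 0 \<in> \<Sigma>" by (intro \<Sigma>I) (simp add: mpow_Suc_0_iff)
      then show False using P(3) that by auto
    qed
    moreover have "mpoly_var w \<notin> P" using \<Sigma>I[of 1 1] P(3) by auto
    ultimately have Pm: "P \<subset> mpow 1" using var_in_mpow[of w] by blast
    have IP: "I \<subseteq> P" using IQ P(2) by (rule order_trans)
    have h1: "height_one P"
      unfolding height_one_def
      using one_dimensional_no_chain[OF I one P(1) _ prime_mpow_1 IP] P(1) Pm by blast
    have min: "q = P" if q: "prime_id q" "I \<subseteq> q" "q \<subseteq> P" for q
      using one_dimensional_no_chain[OF I one q(1) P(1) prime_mpow_1 q(2) _ Pm] q(3) by blast
    let ?C = "zero_set P"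
    have "irreducible_component ?C (zero_set I)"
      unfolding irreducible_component_def
    proof (intro conjI allI impI)
      show "irreducible_set ?C" by (rule irreducible_zero_set[OF P(1)])
      show "?C \<subseteq> zero_set I" by (rule zero_set_antimono[OF IP])
      fix C' assume C': "irreducible_set C' \<and> ?C \<subseteq> C' \<and> C' \<subseteq> zero_set I"
      have "van C' = P"
      proof (rule min)
        show "prime_id (van C')" using C' by (intro prime_van) simp
        show "I \<subseteq> van C'" using C' by (simp add: subset_van_iff)
        show "van C' \<subseteq> P" using C' van_antimono[of ?C C'] van_zero_set_prime[OF P(1)] by simp
      qed
      then show "C' = ?C" using zero_set_van[of C'] C' irreducible_imp_algebraic by blast
    qed
    moreover have "origin \<in> ?C" using Pm zero_set_antimono[of P "mpow 1"] zero_set_mpow_1 by blast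
    moreover have "?C \<subseteq> {a. a v = 0}"
    proof
      fix a assume "a \<in> ?C"
      then have "mpoly_eval a (mpoly_var v) = 0" using vQ P(2) unfolding zero_set_def by blast
      then show "a \<in> {a. a v = 0}" by simp
    qed
    ultimately show False using reg variety_dim_height_one[OF h1] unfolding regular_position_def by blast
  qed
  then obtain K where "\<And>w. mpoly_var w ^ K w \<in> loc ?Q" by metis
  from mpow_subset_if_var_powers[OF ideal_loc[OF idQ] this] show ?thesis ..
qed

section \<open>Functionals supported at the origin\<close>

lemma lookup_partial_deriv:
  "Poly_Mapping.lookup (partial_deriv j f) \<beta> =
    of_nat (Suc (Poly_Mapping.lookup \<beta> j)) * Poly_Mapping.lookup f (\<beta> + Poly_Mapping.single j 1)"
proof -
  let ?e = "Poly_Mapping.single j 1 :: 'a \<Rightarrow>\<^sub>0 nat"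
  have "Poly_Mapping.lookup (Poly_Mapping.single (\<alpha> - ?e) (of_nat (Poly_Mapping.lookup \<alpha> j) * Poly_Mapping.lookup f \<alpha>)) \<beta> =
     (if \<alpha> = \<beta> + ?e then of_nat (Suc (Poly_Mapping.lookup \<beta> j)) * Poly_Mapping.lookup f (\<beta> + ?e) else 0)" for \<alpha>
  proof (cases "Poly_Mapping.lookup \<alpha> j = 0")
    case True
    then have "\<alpha> \<noteq> \<beta> + ?e" by (auto simp: lookup_add)
    then show ?thesis using True by (simp add: lookup_single)
  next
    case False
    then have "\<alpha> - ?e + ?e = \<alpha>"
      by (intro poly_mapping_eqI) (auto simp: lookup_add lookup_minus lookup_single when_def)
    then have "\<alpha> - ?e = \<beta> \<longleftrightarrow> \<alpha> = \<beta> + ?e" by auto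
    then show ?thesis by (auto simp: lookup_single when_def lookup_add)
  qed
  then show ?thesis
    by (simp add: partial_deriv_def lookup_sum not_in_keys_iff_lookup_eq_zero)
qed

text \<open>Factorials on both sides keep the induction free of quotients.\<close>

lemma lookup_partial_deriv_power:
  "fact (Poly_Mapping.lookup \<beta> j) * Poly_Mapping.lookup ((partial_deriv j ^^ n) f) \<beta> =
    fact (Poly_Mapping.lookup \<beta> j + n) * Poly_Mapping.lookup f (\<beta> + Poly_Mapping.single j n)"
proof (induction n arbitrary: \<beta>)
  case (Suc n)
  let ?b = "\<beta> + Poly_Mapping.single j 1"
  have "fact (Poly_Mapping.lookup \<beta> j) * Poly_Mapping.lookup ((partial_deriv j ^^ Suc n) f) \<beta> =
     fact (Poly_Mapping.lookup ?b j) * Poly_Mapping.lookup ((partial_deriv j ^^ n) f) ?b"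
    by (simp add: lookup_partial_deriv lookup_add)
  also have "\<dots> = fact (Poly_Mapping.lookup \<beta> j + Suc n) * Poly_Mapping.lookup f (\<beta> + Poly_Mapping.single j (Suc n))"
    unfolding Suc by (simp add: lookup_add add.assoc flip: single_add)
  finally show ?case .
qed simp

lemma lookup_foldr_partial_deriv:
  assumes "distinct js" "\<And>j. j \<in> set js \<Longrightarrow> Poly_Mapping.lookup \<beta> j = 0"
  shows "Poly_Mapping.lookup (foldr (\<lambda>j. partial_deriv j ^^ n j) js f) \<beta> =
    (\<Prod>j\<in>set js. fact (n j)) * Poly_Mapping.lookup f (\<beta> + (\<Sum>j\<in>set js. Poly_Mapping.single j (n j)))"
  using assms
proof (induction js arbitrary: \<beta>)
  case (Cons j js)
  let ?g = "foldr (\<lambda>j. partial_deriv j ^^ n j) js f"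
  have "Poly_Mapping.lookup ((partial_deriv j ^^ n j) ?g) \<beta> =
     fact (n j) * Poly_Mapping.lookup ?g (\<beta> + Poly_Mapping.single j (n j))"
    using lookup_partial_deriv_power[of \<beta> j "n j" ?g] Cons.prems(2)[of j] by simp
  moreover have "Poly_Mapping.lookup (\<beta> + Poly_Mapping.single j (n j)) i = 0" if "i \<in> set js" for i
    using Cons.prems that by (auto simp: lookup_add lookup_single when_def)
  ultimately show ?case using Cons.IH[of "\<beta> + Poly_Mapping.single j (n j)"] Cons.prems(1)
    by (simp add: add.assoc)
qed simp

text \<open>The division by \<alpha>! cancels the factorials that the iterated derivative
  produces.\<close>

lemma diff_functional_eq: "diff_functional \<alpha> f = Poly_Mapping.lookup f \<alpha>"
proof -
  have "(\<Sum>j\<in>UNIV. Poly_Mapping.single j (Poly_Mapping.lookup \<alpha> j)) = \<alpha>"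
    by (rule poly_mapping_eqI) (simp add: lookup_sum lookup_single when_def)
  then show ?thesis
    by (simp add: diff_functional_def iterated_deriv_def eval_origin lookup_foldr_partial_deriv)
qed

lemma functional_eq: "functional c f = (\<Sum>\<alpha>\<in>Poly_Mapping.keys c. Poly_Mapping.lookup c \<alpha> * Poly_Mapping.lookup f \<alpha>)"
  by (simp add: functional_def diff_functional_eq)

lemma lin_functional_add: "lin_functional q \<Longrightarrow> q (f + g) = q f + q g"
  by (simp add: lin_functional_iff)

lemma lin_functional_const: "lin_functional q \<Longrightarrow> q (mpoly_const c * f) = c * q f"
  by (simp add: lin_functional_iff)

lemma lin_functional_0: "lin_functional q \<Longrightarrow> q 0 = 0"
  using lin_functional_add[of q 0 0] by simp

lemma lin_functional_diff: "lin_functional q \<Longrightarrow> q (f - g) = q f - q g"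
  using lin_functional_add[of q "f - g" g] by simp

lemma lin_functional_functional: "lin_functional (functional c)"
  by (simp add: lin_functional_iff functional_eq lookup_add lookup_const_mult distrib_left sum.distrib
      sum_distrib_left mult.left_commute)

lemma lookup_mult_var_power:
  assumes "Poly_Mapping.lookup \<alpha> v < D"
  shows "Poly_Mapping.lookup (mpoly_var v ^ D * f :: 'n::finite mpoly) \<alpha> = 0"
proof (induction f rule: mpoly_induct)
  case (single \<beta> c)
  have "Poly_Mapping.single v D + \<beta> \<noteq> \<alpha>" using assms by (auto simp: lookup_add)
  then show ?case by (simp add: var_power_eq mult_single lookup_single)
qed (simp_all add: distrib_left lookup_add)

text \<open>A description without coefficients: finitely many terms means that a power of the
  maximal ideal is killed, and exponents of v below D mean that all multiples of x_v^D are killed.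
  With D natural, the bound D - 1 includes -1.\<close>

lemma elim_dual_space_iff:
  fixes I :: "'n::{finite,linorder} mpoly set"
  shows "q \<in> elim_dual_space (int D - 1) I v \<longleftrightarrow>
    lin_functional q \<and> (\<exists>M. \<forall>f\<in>mpow M. q f = 0) \<and> (\<forall>f\<in>I. q f = 0) \<and> (\<forall>f. q (mpoly_var v ^ D * f) = 0)"
proof
  assume "q \<in> elim_dual_space (int D - 1) I v"
  then obtain c where c: "q = functional c" "\<And>f. f \<in> I \<Longrightarrow> q f = 0"
    "\<And>\<alpha>. \<alpha> \<in> Poly_Mapping.keys c \<Longrightarrow> int (Poly_Mapping.lookup \<alpha> v) \<le> int D - 1"
    by (auto simp: elim_dual_space_def dual_space_def)
  define M where "M = Suc (\<Sum>\<alpha>\<in>Poly_Mapping.keys c. mdeg \<alpha>)"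
  have M: "mdeg \<alpha> < M" if "\<alpha> \<in> Poly_Mapping.keys c" for \<alpha>
    unfolding M_def less_Suc_eq_le using that by (intro member_le_sum) auto
  have "\<forall>f\<in>mpow M. q f = 0"
    unfolding c(1) functional_eq using M by (auto simp: mpow_iff intro!: sum.neutral)
  moreover have "q (mpoly_var v ^ D * f) = 0" for f
    unfolding c(1) functional_eq
  proof (intro sum.neutral ballI)
    fix \<alpha> assume "\<alpha> \<in> Poly_Mapping.keys c"
    then have "Poly_Mapping.lookup \<alpha> v < D" using c(3) by fastforce
    then show "Poly_Mapping.lookup c \<alpha> * Poly_Mapping.lookup (mpoly_var v ^ D * f) \<alpha> = 0"
      by (simp add: lookup_mult_var_power)
  qed
  ultimately show "lin_functional q \<and> (\<exists>M. \<forall>f\<in>mpow M. q f = 0) \<and> (\<forall>f\<in>I. q f = 0) \<and>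
      (\<forall>f. q (mpoly_var v ^ D * f) = 0)"
    using c(1,2) lin_functional_functional by blast
next
  assume "lin_functional q \<and> (\<exists>M. \<forall>f\<in>mpow M. q f = 0) \<and> (\<forall>f\<in>I. q f = 0) \<and> (\<forall>f. q (mpoly_var v ^ D * f) = 0)"
  then obtain M where q: "lin_functional q" "\<And>f. f \<in> mpow M \<Longrightarrow> q f = 0" "\<And>f. f \<in> I \<Longrightarrow> q f = 0"
    "\<And>f. q (mpoly_var v ^ D * f) = 0" by blast
  \<comment> \<open>Only monomials of degree below M can have a nonzero value; these values become
    the coefficients of the functional.\<close>
  have "{\<alpha>. q (Poly_Mapping.single \<alpha> 1) \<noteq> 0} \<subseteq> {\<alpha>. mdeg \<alpha> < M}"
    using q(2) single_in_mpow by (force simp: not_le)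
  then have fin: "finite {\<alpha>. q (Poly_Mapping.single \<alpha> 1) \<noteq> 0}" using finite_mdeg_less by (rule finite_subset)
  define c where "c = Abs_poly_mapping (\<lambda>\<alpha>. q (Poly_Mapping.single \<alpha> 1))"
  have c: "Poly_Mapping.lookup c \<alpha> = q (Poly_Mapping.single \<alpha> 1)" for \<alpha>
    unfolding c_def by (subst lookup_Abs_poly_mapping[OF fin]) simp
  have "q f = functional c f" for f
  proof (induction f rule: mpoly_induct)
    case zero
    then show ?case using q(1) lin_functional_functional lin_functional_0 by metis
  next
    case (single \<alpha> b)
    have "functional c (Poly_Mapping.single \<alpha> b) = b * Poly_Mapping.lookup c \<alpha>"
      by (simp add: functional_eq lookup_single when_def sum.delta if_distrib not_in_keys_iff_lookup_eq_zero
          mult.commute cong: if_cong)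
    also have "\<dots> = q (Poly_Mapping.single \<alpha> b)"
      using lin_functional_const[OF q(1), of b "Poly_Mapping.single \<alpha> 1"]
      by (simp add: c flip: single_eq_const_mult)
    finally show ?case by simp
  next
    case (add f g)
    then show ?case by (simp add: lin_functional_add[OF q(1)] lin_functional_add[OF lin_functional_functional])
  qed
  then have qc: "q = functional c" by blast
  moreover have "int (Poly_Mapping.lookup \<alpha> v) \<le> int D - 1" if \<alpha>: "\<alpha> \<in> Poly_Mapping.keys c" for \<alpha>
  proof (rule ccontr)
    assume "\<not> ?thesis"
    then have D: "D \<le> Poly_Mapping.lookup \<alpha> v" by linarith
    have "q (Poly_Mapping.single \<alpha> 1) = 0"
      unfolding single_eq_mult_var_power[of D \<alpha> v 1, OF D] mult.commute[of _ "mpoly_var v ^ D"] by (rule q(4))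
    then show False using \<alpha> c by (simp add: in_keys_iff)
  qed
  ultimately show "q \<in> elim_dual_space (int D - 1) I v"
    using q(3) by (auto simp: elim_dual_space_def dual_space_def D0_def)
qed

text \<open>On the sum of U and the multiples of \<open>a\<close> the value at u + a f has to be q
  f. The condition \<open>ker\<close> makes this well defined, and a linear functional extends from
  a subspace.\<close>

lemma functional_lift:
  fixes U :: "'n mpoly set"
  assumes U: "Vs.subspace U" and q: "lin_functional q" and ker: "\<And>f. a * f \<in> U \<Longrightarrow> q f = 0"
  obtains q' where "lin_functional q'" "\<And>u. u \<in> U \<Longrightarrow> q' u = 0" "\<And>f. q' (a * f) = q f"
proof -
  define W where "W = {w. \<exists>f. w - a * f \<in> U}"
  have uniq: "q f = q f'" if "w - a * f \<in> U" "w - a * f' \<in> U" for w f f'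
  proof -
    have "a * (f' - f) = (w - a * f) - (w - a * f')" by (simp add: algebra_simps)
    then have "a * (f' - f) \<in> U" using Vs.subspace_diff[OF U that] by simp
    then show ?thesis using ker lin_functional_diff[OF q] by fastforce
  qed
  have addU: "(w + w') - a * (f + f') \<in> U" if "w - a * f \<in> U" "w' - a * f' \<in> U" for w w' f f'
    using Vs.subspace_add[OF U that] by (simp add: algebra_simps)
  have scaleU: "cscale c w - a * (mpoly_const c * f) \<in> U" if "w - a * f \<in> U" for c w f
    using Vs.subspace_scale[OF U that, of c] by (simp add: cscale_def algebra_simps)
  have zeroU: "0 - a * 0 \<in> U" using Vs.subspace_0[OF U] by simp
  have "Vs.subspace W"
    unfolding W_def Vs.subspace_def using addU scaleU zeroU by blast
  moreover obtain B where B: "B \<subseteq> W" "Vs.independent B" "W \<subseteq> Vs.span B" by (metis Vs.basis_exists)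
  define rep where "rep w = (SOME f. w - a * f \<in> U)" for w
  obtain g where g: "Vector_Spaces.linear cscale (*) g" "\<forall>b\<in>B. g b = q (rep b)"
    using VC.linear_independent_extend[OF B(2), of "\<lambda>b. q (rep b)"] by metis
  have lg: "lin_functional g" using g(1) by (simp add: lin_functional_def)
  \<comment> \<open>The elements at which g has the value that is forced on it; a subspace that
    contains the basis B, hence all of W.\<close>
  let ?S = "{w. \<exists>f. w - a * f \<in> U \<and> g w = q f}"
  have "Vs.subspace ?S"
    unfolding Vs.subspace_def
  proof (intro conjI ballI allI)
    show "0 \<in> ?S"
      using zeroU lin_functional_0[OF lg] lin_functional_0[OF q] by (intro CollectI exI[of _ 0]) simp
  next
    fix w w' assume "w \<in> ?S" "w' \<in> ?S"
    then obtain f f' where "w - a * f \<in> U" "g w = q f" "w' - a * f' \<in> U" "g w' = q f'" by blast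
    then show "w + w' \<in> ?S"
      using addU lin_functional_add[OF lg] lin_functional_add[OF q] by (intro CollectI exI[of _ "f + f'"]) simp
  next
    fix c w assume "w \<in> ?S"
    then obtain f where "w - a * f \<in> U" "g w = q f" by blast
    then show "cscale c w \<in> ?S"
      using scaleU lin_functional_const[OF lg] lin_functional_const[OF q]
      by (intro CollectI exI[of _ "mpoly_const c * f"]) (simp add: cscale_def)
  qed
  moreover have "B \<subseteq> ?S"
  proof
    fix b assume b: "b \<in> B"
    then have "\<exists>f. b - a * f \<in> U" using B(1) unfolding W_def by blast
    then have "b - a * rep b \<in> U" unfolding rep_def by (rule someI_ex)
    then show "b \<in> ?S" using g(2) b by blast
  qed
  ultimately have "Vs.span B \<subseteq> ?S" by (intro Vs.span_minimal)
  then have WS: "W \<subseteq> ?S" using B(3) by blast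
  have val: "g w = q f" if w: "w - a * f \<in> U" for w f
  proof -
    have "w \<in> ?S" using WS w unfolding W_def by blast
    then obtain f' where "w - a * f' \<in> U" "g w = q f'" by blast
    then show ?thesis using uniq[OF w] by simp
  qed
  show ?thesis
  proof (rule that[OF lg])
    show "g u = 0" if "u \<in> U" for u using val[of u 0] that lin_functional_0[OF q] by simp
    show "g (a * f) = q f" for f using val[of "a * f" f] Vs.subspace_0[OF U] by simp
  qed
qed

section \<open>The origin as an embedded component\<close>

text \<open>Modulo I, g acts on a as the nonzero constant g(0). So a socle element of R/I that is
  zero locally is zero.\<close>

lemma socle_mult_unit:
  assumes I: "ideal_of I" and a: "\<And>g. g \<in> mpow 1 \<Longrightarrow> g * a \<in> I" and g: "mpoly_eval origin g \<noteq> 0" "g * a \<in> I"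
  shows "a \<in> I"
proof -
  let ?c = "mpoly_eval origin g"
  have "g - mpoly_const ?c \<in> mpow 1" by (simp add: mpow_Suc_0_iff)
  then have "g * a - (g - mpoly_const ?c) * a \<in> I" using Id.subspace_diff[OF I g(2) a] by blast
  then have "mpoly_const ?c * a \<in> I" by (simp add: algebra_simps)
  then have "mpoly_const (inverse ?c) * (mpoly_const ?c * a) \<in> I" by (rule Id.subspace_scale[OF I])
  then show ?thesis unfolding mult.assoc[symmetric] const_inverse[OF g(1)] by simp
qed

lemma primeideal_mpow_1: "primeideal (mpow 1) (mpoly_ring :: 'n::finite mpoly ring)"
proof (rule primeidealI)
  show "ideal (mpow 1) (mpoly_ring :: 'n mpoly ring)" by (simp only: ideal_mpoly_ring_iff ideal_mpow)
  show "cring (mpoly_ring :: 'n mpoly ring)" by (rule cring_mpoly_ring)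
  have "(1 :: 'n mpoly) \<notin> mpow 1" by (simp add: mpow_Suc_0_iff)
  then show "carrier mpoly_ring \<noteq> (mpow 1 :: 'n mpoly set)" by auto
qed (simp add: mpow_Suc_0_iff)

text \<open>An element that does not vanish at the origin acts on a socle class as a nonzero
  constant, so the annihilator of a nonzero socle class cannot exceed the maximal ideal.\<close>

lemma associated_prime_iff:
  fixes I :: "'n::finite mpoly set"
  assumes I: "ideal_of I"
  shows "associated_prime mpoly_ring max_ideal I \<longleftrightarrow> (\<exists>a. a \<notin> I \<and> (\<forall>g\<in>mpow 1. g * a \<in> I))"
proof -
  interpret M: cring "mpoly_ring :: 'n mpoly ring" by (rule cring_mpoly_ring)
  interpret II: ideal I "mpoly_ring :: 'n mpoly ring" using I by (simp add: ideal_mpoly_ring_iff)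
  have car: "carrier (mpoly_ring Quot I) = range (\<lambda>b. I +>\<^bsub>mpoly_ring\<^esub> b)"
    by (auto simp: FactRing_def A_RCOSETS_def')
  have mult: "(I +>\<^bsub>mpoly_ring\<^esub> g) \<otimes>\<^bsub>mpoly_ring Quot I\<^esub> (I +>\<^bsub>mpoly_ring\<^esub> b) = I +>\<^bsub>mpoly_ring\<^esub> (g * b)" for g b
    using ring_hom_mult[OF II.rcos_ring_hom, of g b] by simp
  have zero: "I +>\<^bsub>mpoly_ring\<^esub> h = \<zero>\<^bsub>mpoly_ring Quot I\<^esub> \<longleftrightarrow> h \<in> I" for h
    using II.rcos_const_imp_mem[of h] II.a_rcos_const[of h] by (auto simp: FactRing_def)
  have "associated_prime mpoly_ring max_ideal I \<longleftrightarrow> (\<exists>b. mpow 1 = {g. g * b \<in> I})"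
    unfolding associated_prime_def max_ideal_eq car by (simp add: mult zero primeideal_mpow_1[simplified])
  also have "\<dots> \<longleftrightarrow> (\<exists>a. a \<notin> I \<and> (\<forall>g\<in>mpow 1. g * a \<in> I))"
  proof (intro ex_cong1)
    fix b :: "'n mpoly"
    show "mpow 1 = {g. g * b \<in> I} \<longleftrightarrow> b \<notin> I \<and> (\<forall>g\<in>mpow 1. g * b \<in> I)"
    proof
      assume eq: "mpow 1 = {g. g * b \<in> I}"
      have "1 \<notin> (mpow 1 :: 'n mpoly set)" by (simp add: mpow_Suc_0_iff)
      then show "b \<notin> I \<and> (\<forall>g\<in>mpow 1. g * b \<in> I)" unfolding eq by simp
    next
      assume b: "b \<notin> I \<and> (\<forall>g\<in>mpow 1. g * b \<in> I)"
      then have "mpoly_eval origin g = 0" if "g * b \<in> I" for g using socle_mult_unit[OF I, of b g] that by blast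
      then show "mpow 1 = {g. g * b \<in> I}" using b by (auto simp: mpow_Suc_0_iff)
    qed
  qed
  finally show ?thesis .
qed

context local_param
begin

text \<open>If f in J is not zero locally, all its multiples by m^K lie in both J and m^K and vanish
  locally. The last power m^(t-1) that does not kill f contains a g for which g f is a nonzero socle
  element of the local ring; clearing denominators moves it to R/I.\<close>

lemma finite_part_trivial:
  assumes K: "J \<inter> (I + mpow K) \<subseteq> loc I" and no: "\<And>a. (\<And>g. g \<in> mpow 1 \<Longrightarrow> g * a \<in> I) \<Longrightarrow> a \<in> I"
  shows "J \<subseteq> loc I"
proof
  fix f assume f: "f \<in> J"
  show "f \<in> loc I"
  proof (rule ccontr)
    assume nf: "f \<notin> loc I"
    have "\<forall>g\<in>mpow K. g * f \<in> loc I"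
    proof
      fix g :: "'n mpoly" assume g: "g \<in> mpow K"
      have "g * f \<in> J" by (rule Id.subspace_scale[OF idJ f])
      moreover have "g * f \<in> mpow K"
        unfolding mult.commute[of g] by (rule Id.subspace_scale[OF ideal_mpow g])
      then have "g * f \<in> I + mpow K" using mpow_subset_plus[OF I] by blast
      ultimately show "g * f \<in> loc I" using K by blast
    qed
    then have ex: "\<exists>t. \<forall>g\<in>mpow t. g * f \<in> loc I" by blast
    define t where "t = (LEAST t. \<forall>g\<in>mpow t. g * f \<in> loc I)"
    have t: "\<And>g. g \<in> mpow t \<Longrightarrow> g * f \<in> loc I" using LeastI_ex[OF ex] unfolding t_def by blast
    have "t \<noteq> 0"
    proof
      assume "t = 0"
      then show False using t[of 1] nf by simp
    qed
    then obtain t' where t': "t = Suc t'" using not0_implies_Suc by blast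
    then have "\<not> (\<forall>g\<in>mpow t'. g * f \<in> loc I)" using not_less_Least[of t' "\<lambda>t. \<forall>g\<in>mpow t. g * f \<in> loc I"]
      unfolding t_def by simp
    then obtain g where g: "g \<in> mpow t'" "g * f \<notin> loc I" by blast
    have "\<exists>h. mpoly_eval origin h \<noteq> 0 \<and> h * (mpoly_var w * (g * f)) \<in> I" for w
    proof -
      have "mpoly_var w * g \<in> mpow t" using mpow_mult[OF var_in_mpow g(1), of w] t' by simp
      then have "mpoly_var w * (g * f) \<in> loc I" using t by (simp flip: mult.assoc)
      then show ?thesis by (simp add: loc_def)
    qed
    then obtain h where h: "\<And>w. mpoly_eval origin (h w) \<noteq> 0" "\<And>w. h w * (mpoly_var w * (g * f)) \<in> I" by metis
    \<comment> \<open>One denominator for all variables at once; it does not vanish at the origin,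
      so \<open>H * (g * f)\<close> is still nonzero locally.\<close>
    define H where "H = (\<Prod>w\<in>UNIV. h w)"
    have H: "mpoly_eval origin H \<noteq> 0" by (simp add: H_def h(1))
    have "mpoly_var w * (H * (g * f)) \<in> I" for w
    proof -
      have "H = (\<Prod>w\<in>UNIV - {w}. h w) * h w" unfolding H_def by (simp add: prod.remove[of UNIV w] mult.commute)
      then have "mpoly_var w * (H * (g * f)) = (\<Prod>w\<in>UNIV - {w}. h w) * (h w * (mpoly_var w * (g * f)))"
        by (simp only: ac_simps)
      then show ?thesis by (simp only: Id.subspace_scale[OF I h(2)])
    qed
    then have "range mpoly_var \<subseteq> {p. p * (H * (g * f)) \<in> I}" by blast
    moreover have "ideal_of {p. p * (H * (g * f)) \<in> I}"
      unfolding Id.subspace_def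
      using zero_in_ideal[OF I] Id.subspace_add[OF I] Id.subspace_scale[OF I]
      by (simp add: distrib_right mult.assoc)
    ultimately have "mpow 1 \<subseteq> {p. p * (H * (g * f)) \<in> I}" unfolding mpow_1_eq by (rule Id.span_minimal)
    then have "H * (g * f) \<in> I" using no by blast
    then show False using g(2) locI[OF H] by blast
  qed
qed

text \<open>If g a = p + x^K b with p in I, then x kills x^K b modulo I because it kills a. So x^K b
  lies in J and in m^K and vanishes locally, and with it a.\<close>

lemma socle_avoids_plus_power:
  assumes K: "J \<inter> (I + mpow K) \<subseteq> loc I" and a: "a \<notin> I" "\<And>g. g \<in> mpow 1 \<Longrightarrow> g * a \<in> I"
  shows "a \<notin> loc (I + principal (x ^ K))"
proof
  assume "a \<in> loc (I + principal (x ^ K))"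
  then obtain g p b where g: "mpoly_eval origin g \<noteq> 0" "p \<in> I" "g * a = p + x ^ K * b"
    unfolding in_loc_plus_principal by blast
  have eq: "x ^ K * b = g * a - p" using g(3) by simp
  have "x ^ 1 * (x ^ K * b) = g * (x * a) - x * p" unfolding eq by (simp add: algebra_simps)
  moreover have "g * (x * a) - x * p \<in> I"
    using Id.subspace_diff[OF I Id.subspace_scale[OF I a(2)[OF x]] Id.subspace_scale[OF I g(2)]] .
  ultimately have "x ^ K * b \<in> J" using loc_superset[of I] unfolding J_def by (metis (no_types, lifting) mem_Collect_eq subsetD)
  moreover have "x ^ K * b \<in> mpow K"
    using Id.subspace_scale[OF ideal_mpow power_in_mpow[OF x], of b K] by (simp add: mult.commute)
  then have "x ^ K * b \<in> I + mpow K" using mpow_subset_plus[OF I] by blast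
  ultimately have "x ^ K * b \<in> loc I" using K by blast
  then have "g * a \<in> loc I"
    unfolding g(3) using Id.subspace_add[OF ideal_loc[OF I] subsetD[OF loc_superset g(2)]] by blast
  then have "a \<in> loc I" by (rule loc_mult_cancel[OF g(1)])
  then obtain h where "mpoly_eval origin h \<noteq> 0" "h * a \<in> I" by (auto simp: loc_def)
  then show False using socle_mult_unit[OF I a(2)] a(1) by blast
qed

text \<open>A functional that kills a power of the maximal ideal cannot distinguish an ideal from
  its contraction.\<close>

lemma local_functional_vanishes:
  assumes q: "lin_functional q" "\<And>f. f \<in> mpow M \<Longrightarrow> q f = 0" "\<And>f. f \<in> I \<Longrightarrow> q f = 0" "\<And>f. q (x ^ K * f) = 0"
    and f: "f \<in> loc (I + principal (x ^ K))"
  shows "q f = 0"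
proof -
  have "ideal_of (I + principal (x ^ K))" by (intro ideal_plus I ideal_principal)
  then have "f \<in> (I + principal (x ^ K)) + mpow M" using loc_subset_plus_mpow f by blast
  then obtain p z where pz: "p \<in> I + principal (x ^ K)" "z \<in> mpow M" "f = p + z" by (rule set_plus_elim)
  then obtain p' b where "p' \<in> I" "p = p' + x ^ K * b" unfolding in_plus_principal by blast
  then show ?thesis using pz(2,3) by (simp add: lin_functional_add[OF q(1)] q(2-4))
qed

text \<open>From g x f = p + x^(K+1) b with p in I it follows that x kills g f - x^K b modulo I, so
  that this element lies in J.\<close>

lemma colon_subset:
  assumes J: "J \<subseteq> loc I" and f: "x * f \<in> loc (I + principal (x ^ Suc K))"
  shows "f \<in> loc (I + principal (x ^ K))"
proof -
  obtain g p b where g: "mpoly_eval origin g \<noteq> 0" "p \<in> I" "g * (x * f) = p + x ^ Suc K * b"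
    using f unfolding in_loc_plus_principal by blast
  have "x ^ 1 * (g * f - x ^ K * b) = p" using g(3) by (simp add: algebra_simps)
  then have "g * f - x ^ K * b \<in> J" using g(2) loc_superset[of I] unfolding J_def by (metis (no_types, lifting) mem_Collect_eq subsetD)
  then obtain h where h: "mpoly_eval origin h \<noteq> 0" "h * (g * f - x ^ K * b) \<in> I"
    using J by (auto simp: loc_def)
  have "(h * g) * f = h * (g * f - x ^ K * b) + x ^ K * (h * b)" by (simp add: algebra_simps)
  then show ?thesis
    unfolding in_loc_plus_principal using h g(1)
    by (intro exI[of _ "h * g"] exI[of _ "h * (g * f - x ^ K * b)"] exI[of _ "h * b"]) simp
qed

end

theorem mainTheorem4:
  fixes I :: "'n::{finite,linorder} mpoly set"
    and x1 :: 'n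
    and r m :: nat
    and k :: int
  assumes "ideal I mpoly_ring"
    and "one_dimensional_at_origin I"
    and "regular_position I x1"
    and "r = regularity_index I"
    and "m = multiplicity_at_origin I"
    and "k = max (int r) (int m - 1)"
  shows "associated_prime mpoly_ring max_ideal I \<longleftrightarrow>
    var_action x1 ` elim_dual_space k I x1 \<subset> elim_dual_space (k - 1) I x1"
proof -
  have I: "ideal_of I" using assms(1) by (simp add: ideal_mpoly_ring_iff)
  obtain n where n: "mpow n \<subseteq> loc (I + principal (mpoly_var x1))"
    using regular_position_parameter[OF I assms(2,3)] by blast
  let ?x = "mpoly_var x1 :: 'n mpoly"
  interpret local_param I ?x n by unfold_locales (fact I var_in_mpow n)+
  obtain k0 e where e: "\<And>k. k \<ge> k0 \<Longrightarrow> hilb I k = e" using hilb_eventually_const by blast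
  have m: "m = e" using multiplicity_eq[OF I e] assms(5) by simp
  define K where "K = nat k"
  \<comment> \<open>k is nonnegative because r is a natural number. Both bounds then have the form D
    - 1 of \<open>elim_dual_space_iff\<close>, with D = K + 1 for k and D = K for k - 1.\<close>
  have kK: "k = int (Suc K) - 1" "k - 1 = int K - 1" using assms(6) by (auto simp: K_def)
  have rK: "r \<le> K" "e \<le> Suc K" using assms(6) m by (auto simp: K_def)
  have JK: "J \<inter> (I + mpow K) \<subseteq> loc I"
    by (rule finite_part_avoids_mpow[OF _ rK]) (use regularity_index_hilb[OF I e] assms(4) in simp)
  note E1 = elim_dual_space_iff[of _ "Suc K" I x1, folded kK(1)]
  note E0 = elim_dual_space_iff[of _ K I x1, folded kK(2)]
  have sub: "var_action x1 ` elim_dual_space k I x1 \<subseteq> elim_dual_space (k - 1) I x1"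
  proof
    fix q assume "q \<in> var_action x1 ` elim_dual_space k I x1"
    then obtain q' where q': "q = var_action x1 q'" "q' \<in> elim_dual_space k I x1" by (rule imageE)
    then obtain M where q: "lin_functional q'" "\<And>f. f \<in> mpow M \<Longrightarrow> q' f = 0"
      "\<And>f. f \<in> I \<Longrightarrow> q' f = 0" "\<And>f. q' (?x ^ Suc K * f) = 0" unfolding E1 by blast
    have qx: "q f = q' (?x * f)" for f by (simp add: q'(1) var_action_def)
    have "lin_functional q"
      using q(1) unfolding lin_functional_iff qx by (simp add: distrib_left mult.left_commute[of ?x])
    moreover have "q f = 0" if "f \<in> mpow M" for f
      unfolding qx by (intro q(2) Id.subspace_scale[OF ideal_mpow that])
    moreover have "q f = 0" if "f \<in> I" for f
      unfolding qx by (intro q(3) Id.subspace_scale[OF I that])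
    moreover have "q (?x ^ K * f) = 0" for f
      unfolding qx using q(4)[of f] by (simp add: mult.assoc)
    ultimately show "q \<in> elim_dual_space (k - 1) I x1" unfolding E0 by blast
  qed
  show ?thesis
    unfolding associated_prime_iff[OF I]
  proof
    assume "\<exists>a. a \<notin> I \<and> (\<forall>g\<in>mpow 1. g * a \<in> I)"
    then obtain a where a: "a \<notin> I" "\<And>g. g \<in> mpow 1 \<Longrightarrow> g * a \<in> I" by blast
    let ?L = "loc (I + principal (?x ^ K))"
    \<comment> \<open>This q separates the socle element a from the multiples of x^K. It is not of
      the form x times q', since q'(x a) vanishes: x a lies in I.\<close>
    obtain q where q: "lin_functional q" "\<And>f. f \<in> ?L \<Longrightarrow> q f = 0" "q a = 1"
      using separating_functional[OF ideal_imp_subspace[OF id_loc_power] socle_avoids_plus_power[OF JK a]] by metis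
    have "\<forall>f\<in>mpow (n * K). q f = 0" using mpow_loc_power q(2) by blast
    moreover have "q f = 0" if "f \<in> I" for f
      using q(2) that loc_superset plus_superset1[OF zero_in_ideal[OF ideal_principal]] by blast
    moreover have "q (?x ^ K * f) = 0" for f
    proof (rule q(2))
      show "?x ^ K * f \<in> ?L"
        unfolding in_loc_plus_principal using zero_in_ideal[OF I] by (intro exI[of _ 1] exI[of _ 0] exI[of _ f]) simp
    qed
    ultimately have "q \<in> elim_dual_space (k - 1) I x1" unfolding E0 using q(1) by blast
    moreover have "q \<notin> var_action x1 ` elim_dual_space k I x1"
    proof
      assume "q \<in> var_action x1 ` elim_dual_space k I x1"
      then obtain q' where q': "q = var_action x1 q'" "\<And>f. f \<in> I \<Longrightarrow> q' f = 0"
        by (auto simp: elim_dual_space_def dual_space_def)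
      have "q' (?x * a) = 0" by (intro q'(2) a(2) var_in_mpow)
      then show False using q(3) q'(1) by (simp add: var_action_def)
    qed
    ultimately show "var_action x1 ` elim_dual_space k I x1 \<subset> elim_dual_space (k - 1) I x1" using sub by blast
  next
    assume strict: "var_action x1 ` elim_dual_space k I x1 \<subset> elim_dual_space (k - 1) I x1"
    show "\<exists>a. a \<notin> I \<and> (\<forall>g\<in>mpow 1. g * a \<in> I)"
    proof (rule ccontr)
      assume no: "\<not> ?thesis"
      have J: "J \<subseteq> loc I" by (rule finite_part_trivial[OF JK]) (use no in blast)
      have "q \<in> var_action x1 ` elim_dual_space k I x1" if q0: "q \<in> elim_dual_space (k - 1) I x1" for q
      proof -
        obtain M where q: "lin_functional q" "\<And>f. f \<in> mpow M \<Longrightarrow> q f = 0" "\<And>f. f \<in> I \<Longrightarrow> q f = 0"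
          "\<And>f. q (?x ^ K * f) = 0" using q0 unfolding E0 by blast
        let ?U = "loc (I + principal (?x ^ Suc K))"
        \<comment> \<open>By \<open>colon_subset\<close>, x f in the ideal of x^(K+1) implies f in
          the ideal of x^K locally, where q vanishes; this is the condition for lifting q along
          multiplication by x.\<close>
        obtain q' where q': "lin_functional q'" "\<And>u. u \<in> ?U \<Longrightarrow> q' u = 0" "\<And>f. q' (?x * f) = q f"
          by (rule functional_lift[OF ideal_imp_subspace[OF id_loc_power] q(1)])
            (use local_functional_vanishes[OF q] colon_subset[OF J] in blast)+
        have "\<forall>f\<in>mpow (n * Suc K). q' f = 0" using mpow_loc_power q'(2) by blast
        moreover have "q' f = 0" if "f \<in> I" for f
          using q'(2) that loc_superset plus_superset1[OF zero_in_ideal[OF ideal_principal]] by blast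
        moreover have "q' (?x ^ Suc K * f) = 0" for f
          using q'(3)[of "?x ^ K * f"] q(4) by (simp add: mult.assoc)
        ultimately have "q' \<in> elim_dual_space k I x1" unfolding E1 using q'(1) by blast
        moreover have "q = var_action x1 q'" using q'(3) by (auto simp: var_action_def)
        ultimately show ?thesis by blast
      qed
      then show False using strict by blast
    qed
  qed
qed

end
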